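(* For all partitions $\lambda,\mu$, $$g_{\lambda/\mu}(x)={}^G\langle \mu|\,e^{H(x)}\,|\lambda\rangle^g .$$
   Context: Symmetric functions. $k=\mathbb{C}(\beta)$; $\Lambda$ is the $k$-algebra of symmetric functions in $x=(x_1,x_2,\dots)$, with Schur functions $s_\lambda$ and Hall inner product $\langle s_\lambda,s_\mu\rangle=\delta_{\lambda,\mu}$. $I_n=\mathrm{span}_k\{s_\lambda:\ell(\lambda)>n\}$ and $\widehat\Lambda=\varprojlim\Lambda/I_n$; elements of $\widehat\Lambda$ are formal sums $\sum c_\lambda s_\lambda$ such that for every $n$ only finitely many $\lambda$ with $\ell(\lambda)\le n$ have $c_\lambda\neq0$. The Hall product extends to $\widehat\Lambda\times\Lambda\to k$. The stable Grothendieck polynomial $G_\lambda(x)\in\widehat\Lambda$ is the unique element such that for all $n\ge\ell(\lambda)$, $G_\lambda(x_1,\dots,x_n,0,0,\dots)=\det\bigl(x_i^{\lambda_j+n-j}(1+\beta x_i)^{j-1}\bigr)_{1\le i,j\le n}/\prod_{1\le i<j\le n}(x_i-x_j)$. The dual stable Grothendieck polynomials $g_\mu\in\Lambda$ are determined by $\langle G_\lambda,g_\mu\rangle=\delta_{\lambda,\mu}$. The skew dual stable Grothendieck polynomial $g_{\lambda/\mu}\in\Lambda$ is defined by $\Delta(g_\lambda)=\sum_{\mu}g_\mu\otimes g_{\lambda/\mu}$ (where $(\Delta f)(x,y)=f(x,y)$), equivalently $g_{\lambda/\mu}=G_\mu^\perp g_\lambda$, i.e. $\langle g_{\lambda/\mu},h\rangle=\langle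 G_\mu h,g_\lambda\rangle$ for all $h\in\Lambda$. Fermions. $\mathcal A$ is the $k$-algebra generated by $\psi_n,\psi_n^*$ ($n\in\mathbb Z$) with $[\psi_m,\psi_n]_+=[\psi_m^*,\psi_n^*]_+=0$, $[\psi_m,\psi_n^*]_+=\delta_{m,n}$ ($[A,B]_+=AB+BA$). The Fock space $\mathcal F$ is the left $\mathcal A$-module generated by $|0\rangle$ with $\psi_m|0\rangle=\psi^*_n|0\rangle=0$ for $m<0\le n$ (with basis $\psi_{n_1}\cdots\psi_{n_r}\psi^*_{m_1}\cdots\psi^*_{m_s}|0\rangle$, $n_1>\dots>n_r\ge0>m_s>\dots>m_1$); $\mathcal F^*$ is the right $\mathcal A$-module generated by $\langle0|$ with $\langle0|\psi_n=\langle0|\psi_m^*=0$ for $m<0\le n$. The pairing $\mathcal F^*\otimes\mathcal F\to k$ is the bilinear map with $\langle0|0\rangle=1$ and $(\langle w|X)|v\rangle=\langle w|(X|v\rangle)$ for $X\in\mathcal A$. ${}^*$ is the anti-involution of $\mathcal A$ exchanging $\psi_n$ and $\psi_n^*$, and $\omega:\mathcal F\to\mathcal F^*$, $X|0\rangle\mapsto\langle0|X^*$. For $r\ge0$, $|-r\rangle=\psi^*_{-r}\cdots\psi^*_{-1}|0\rangle$. For $m\ne0$, $a_m=\sum_{j\in\mathbb Z}\psi_j\psi^*_{j+m}$ (so $a_m^*=a_{-m}$). $H(x)=\sum_{n>0}\frac{p_n(x)}{n}a_n$ with $p_n$ the power sums; $\Theta=\sum_{n\ge1}\frac{(-1)^{n-1}\beta^n}{n}a_{-n}$,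 $\theta=\sum_{n\ge1}\frac{(-1)^{n-1}\beta^n}{n}a_{n}$. For a partition $\lambda$ and any $r\ge\ell(\lambda)$ (padding with zeros), $|\lambda\rangle^G=\psi_{\lambda_1-1}e^{\Theta}\psi_{\lambda_2-2}e^{\Theta}\cdots\psi_{\lambda_r-r}e^{\Theta}|-r\rangle$, $|\lambda\rangle^g=\psi_{\lambda_1-1}e^{-\theta}\psi_{\lambda_2-2}e^{-\theta}\cdots\psi_{\lambda_r-r}e^{-\theta}|-r\rangle$; these do not depend on $r$. ${}^G\langle\mu|=\omega(|\mu\rangle^G)$. Infinite linear combinations of basis vectors (produced by $e^{\Theta}$) are allowed, $\omega$ and brackets being extended termwise. *)

theory Defs
  imports
    "HOL-Library.Poly_Mapping"
    "HOL-Computational_Algebra.Polynomial"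
    "HOL-Computational_Algebra.Fraction_Field"
    "Jordan_Normal_Form.Determinant"
begin

section \<open>The ground field\<close>

type_synonym kfield = "complex poly fract"

definition beta :: kfield where
  "beta = Fract [:0, 1:] 1"


section \<open>Formal power series in infinitely many variables\<close>

text \<open>
  The variables are \<open>x\<^sub>0, x\<^sub>1, \<dots>\<close> (numbered from 0), and a monomial is its finitely supported
  exponent vector.
\<close>

type_synonym monom = "nat \<Rightarrow>\<^sub>0 nat"

lemma finite_monom_splits: "finite {(a, b). a + b = (m :: monom)}"
proof -
  let ?B = "{..Max (insert 0 (Poly_Mapping.lookup m ` Poly_Mapping.keys m))}"
  let ?F = "{f. \<forall>i. (i \<in> Poly_Mapping.keys m \<longrightarrow> f i \<in> ?B) \<and>
    (i \<notin> Poly_Mapping.keys m \<longrightarrow> f i = (0::nat))}"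
  let ?L = "{a :: monom. \<forall>i. Poly_Mapping.lookup a i \<le> Poly_Mapping.lookup m i}"
  have le: "Poly_Mapping.lookup m i \<in> ?B" if "i \<in> Poly_Mapping.keys m" for i
    unfolding atMost_iff by (rule Max_ge) (use that in auto)
  have "Poly_Mapping.lookup ` ?L \<subseteq> ?F"
  proof (rule image_subsetI)
    fix a :: monom assume "a \<in> ?L"
    then have a: "Poly_Mapping.lookup a i \<le> Poly_Mapping.lookup m i" for i
      by simp
    have "Poly_Mapping.lookup a i \<in> ?B" if "i \<in> Poly_Mapping.keys m" for i
      using order_trans[OF a[of i] le[OF that, unfolded atMost_iff]] by (simp only: atMost_iff)
    moreover have "Poly_Mapping.lookup a i = 0" if "i \<notin> Poly_Mapping.keys m" for i
      using a[of i] that by (simp add: in_keys_iff)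
    ultimately show "Poly_Mapping.lookup a \<in> ?F"
      by blast
  qed
  moreover have "finite ?F"
    by (rule finite_set_of_finite_funs) (rule finite_keys finite_atMost)+
  ultimately have "finite (Poly_Mapping.lookup ` ?L)"
    by (rule finite_subset)
  then have "finite ?L"
    by (rule finite_imageD) (auto intro: inj_onI poly_mapping_eqI)
  moreover have "{(a, b). a + b = m} \<subseteq> ?L \<times> ?L"
    by (auto simp: lookup_add)
  ultimately show ?thesis
    by (meson finite_SigmaI finite_subset)
qed

typedef 'a mpser = "UNIV :: (monom \<Rightarrow> 'a) set"
  morphisms cf Abs_mpser ..

setup_lifting type_definition_mpser

lemma mpser_eqI: "(\<And>m. cf f m = cf g m) \<Longrightarrow> f = g"
  by (metis cf_inject ext)

instantiation mpser :: (comm_ring_1) comm_ring_1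
begin

lift_definition zero_mpser :: "'a mpser" is "\<lambda>m. 0" .

lift_definition one_mpser :: "'a mpser" is "\<lambda>m. if m = 0 then 1 else 0" .

lift_definition plus_mpser :: "'a mpser \<Rightarrow> 'a mpser \<Rightarrow> 'a mpser" is "\<lambda>f g m. f m + g m" .

lift_definition uminus_mpser :: "'a mpser \<Rightarrow> 'a mpser" is "\<lambda>f m. - f m" .

lift_definition minus_mpser :: "'a mpser \<Rightarrow> 'a mpser \<Rightarrow> 'a mpser" is "\<lambda>f g m. f m - g m" .

lift_definition times_mpser :: "'a mpser \<Rightarrow> 'a mpser \<Rightarrow> 'a mpser"
  is "\<lambda>f g m. \<Sum>(a, b) \<in> {(a, b). a + b = m}. f a * g b" .

instance
proof
  fix f g h :: "'a mpser"
  show "f * g * h = f * (g * h)"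
  proof (rule mpser_eqI)
    fix m
    let ?D = "\<lambda>m :: monom. {(a, b). a + b = m}"
    have fin: "finite (?D m)" for m
      by (rule finite_monom_splits)
    have "cf (f * g * h) m =
        (\<Sum>x\<in>?D m. \<Sum>y\<in>?D (fst x). cf f (fst y) * cf g (snd y) * cf h (snd x))"
      by (simp add: times_mpser.rep_eq sum_distrib_right case_prod_beta)
    also have "\<dots> = (\<Sum>(x, y)\<in>Sigma (?D m) (\<lambda>x. ?D (fst x)).
        cf f (fst y) * cf g (snd y) * cf h (snd x))"
      by (rule sum.Sigma) (use fin in auto)
    also have "\<dots> = (\<Sum>(x, y)\<in>Sigma (?D m) (\<lambda>x. ?D (snd x)).
        cf f (fst x) * (cf g (fst y) * cf h (snd y)))"
      by (rule sum.reindex_bij_witness[where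
            i = "\<lambda>((a, q), (b, c)). ((a + b, c), (a, b))" and
            j = "\<lambda>((p, c), (a, b)). ((a, b + c), (b, c))"])
        (auto simp: ac_simps)
    also have "\<dots> = (\<Sum>x\<in>?D m. \<Sum>y\<in>?D (snd x). cf f (fst x) * (cf g (fst y) * cf h (snd y)))"
      by (rule sum.Sigma[symmetric]) (use fin in auto)
    also have "\<dots> = cf (f * (g * h)) m"
      by (simp add: times_mpser.rep_eq sum_distrib_left case_prod_beta)
    finally show "cf (f * g * h) m = cf (f * (g * h)) m" .
  qed
  show "f * g = g * f"
    by (rule mpser_eqI, unfold times_mpser.rep_eq)
      (rule sum.reindex_bij_witness[where i = prod.swap and j = prod.swap], auto simp: ac_simps)
  show "1 * f = f"
  proof (rule mpser_eqI)
    fix m :: monom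
    have "cf (1 * f) m = (\<Sum>(a, b)\<in>{(0, m)}. cf 1 a * cf f b)"
      unfolding times_mpser.rep_eq
      by (rule sum.mono_neutral_right)
        (auto simp: finite_monom_splits one_mpser.rep_eq split: if_splits)
    then show "cf (1 * f) m = cf f m"
      by (simp add: one_mpser.rep_eq)
  qed
  show "(f + g) * h = f * h + g * h"
    by (rule mpser_eqI)
      (simp add: times_mpser.rep_eq plus_mpser.rep_eq algebra_simps sum.distrib case_prod_beta)
  show "(0 :: 'a mpser) \<noteq> 1"
    by (transfer, metis zero_neq_one)
qed (transfer; simp add: algebra_simps fun_eq_iff)+

end

text \<open>Constants, the variable \<open>x\<^sub>i\<close>, and the substitution \<open>x\<^sub>i = 0\<close> for all \<open>i \<ge> n\<close>.\<close>

lift_definition cst :: "'a :: comm_ring_1 \<Rightarrow> 'a mpser" is "\<lambda>c m. if m = 0 then c else 0" .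

lift_definition var :: "nat \<Rightarrow> 'a :: comm_ring_1 mpser"
  is "\<lambda>i m. if m = Poly_Mapping.single i 1 then 1 else 0" .

lift_definition restrict_vars :: "nat \<Rightarrow> 'a :: comm_ring_1 mpser \<Rightarrow> 'a mpser"
  is "\<lambda>n f m. if Poly_Mapping.keys m \<subseteq> {..<n} then f m else 0" .


section \<open>Partitions\<close>

typedef part = "{xs :: nat list. sorted_wrt (\<ge>) xs \<and> 0 \<notin> set xs}"
  morphisms parts_list Abs_part
  by (rule exI[of _ "[]"]) simp

definition plen :: "part \<Rightarrow> nat" where
  "plen lam = length (parts_list lam)"

text \<open>\<open>pt \<lambda> i\<close> is the part \<open>\<lambda>\<^sub>i\<close>, numbered from \<open>i = 1\<close>, padded by zeros.\<close>

definition pt :: "part \<Rightarrow> nat \<Rightarrow> nat" where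
  "pt lam i = (if 1 \<le> i \<and> i \<le> plen lam then parts_list lam ! (i - 1) else 0)"


section \<open>Symmetric functions\<close>

definition mdeg :: "monom \<Rightarrow> nat" where
  "mdeg m = (\<Sum>i\<in>Poly_Mapping.keys m. Poly_Mapping.lookup m i)"

definition Lam :: "kfield mpser set" where
  "Lam = {f. (\<forall>\<pi> m. bij \<pi> \<longrightarrow> cf f (Poly_Mapping.map_key \<pi> m) = cf f m) \<and>
             (\<exists>d. \<forall>m. cf f m \<noteq> 0 \<longrightarrow> mdeg m \<le> d)}"

definition h_sym :: "int \<Rightarrow> kfield mpser" where
  "h_sym d = Abs_mpser (\<lambda>m. if int (mdeg m) = d then 1 else 0)"

text \<open>The power sum; only used for \<open>n \<ge> 1\<close>.\<close>

definition p_sym :: "nat \<Rightarrow> kfield mpser" where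
  "p_sym n = Abs_mpser (\<lambda>m. if \<exists>i. m = Poly_Mapping.single i n then 1 else 0)"

text \<open>Schur functions, by the Jacobi--Trudi formula \<open>det (h\<^bsub>\<lambda>\<^sub>i - i + j\<^esub>)\<close> (the index shift from
  0-based matrix positions cancels in \<open>j - i\<close>).\<close>

definition schur :: "part \<Rightarrow> kfield mpser" where
  "schur lam = det (mat (plen lam) (plen lam)
     (\<lambda>(i, j). h_sym (int (pt lam (Suc i)) - int i + int j)))"

text \<open>The coefficients of \<open>f \<in> \<Lambda>\<close> in the basis of Schur functions.\<close>

definition schur_coeff :: "kfield mpser \<Rightarrow> part \<Rightarrow> kfield" where
  "schur_coeff f = (THE d. finite {nu. d nu \<noteq> 0} \<and>
     f = (\<Sum>nu | d nu \<noteq> 0. cst (d nu) * schur nu))"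

definition hall :: "kfield mpser \<Rightarrow> kfield mpser \<Rightarrow> kfield" where
  "hall f g = Sum_any (\<lambda>nu. schur_coeff f nu * schur_coeff g nu)"

text \<open>An element \<open>\<Sum>\<^sub>\<nu> c\<^sub>\<nu> s\<^sub>\<nu>\<close> of the completion of \<open>\<Lambda>\<close> is represented by its coefficient
  family \<open>c\<close>.\<close>

definition Lam_hat :: "(part \<Rightarrow> kfield) set" where
  "Lam_hat = {c. \<forall>n. finite {nu. plen nu \<le> n \<and> c nu \<noteq> 0}}"

text \<open>The value of \<open>\<Sum>\<^sub>\<nu> c\<^sub>\<nu> s\<^sub>\<nu>\<close> at \<open>(x\<^sub>0, \<dots>, x\<^sub>n\<^sub>-\<^sub>1, 0, 0, \<dots>)\<close>, where \<open>s\<^sub>\<nu>\<close> vanishes if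
  \<open>\<ell>(\<nu>) > n\<close>.\<close>

definition hat_restrict :: "nat \<Rightarrow> (part \<Rightarrow> kfield) \<Rightarrow> kfield mpser" where
  "hat_restrict n c =
     (\<Sum>nu | plen nu \<le> n \<and> c nu \<noteq> 0. cst (c nu) * restrict_vars n (schur nu))"

definition hall_hat :: "(part \<Rightarrow> kfield) \<Rightarrow> kfield mpser \<Rightarrow> kfield" where
  "hall_hat c f = Sum_any (\<lambda>nu. c nu * hall (schur nu) f)"


section \<open>Stable Grothendieck polynomials and their duals\<close>

text \<open>The entry in row \<open>i\<close> and column \<open>j\<close> (0-based) of the numerator is
  \<open>x\<^sub>i\<^bsup>\<lambda>\<^sub>j\<^sub>+\<^sub>1 + n - (j+1)\<^esup> (1 + \<beta> x\<^sub>i)\<^bsup>j\<^esup>\<close>. The quotient by the Vandermonde product is taken in a ring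
  where that product is cancellable, hence written as a multiplication.\<close>

definition stable_grothendieck :: "part \<Rightarrow> part \<Rightarrow> kfield" where
  "stable_grothendieck lam = (THE c. c \<in> Lam_hat \<and> (\<forall>n\<ge>plen lam.
     hat_restrict n c * (\<Prod>(i, j) \<in> {(i, j). i < j \<and> j < n}. var i - var j) =
     det (mat n n (\<lambda>(i, j).
       var i ^ (pt lam (Suc j) + (n - Suc j)) * (1 + cst beta * var i) ^ j))))"

definition dual_grothendieck :: "part \<Rightarrow> kfield mpser" where
  "dual_grothendieck mu = (THE f. f \<in> Lam \<and>
     (\<forall>lam. hall_hat (stable_grothendieck lam) f = (if lam = mu then 1 else 0)))"

text \<open>
  Elements of \<open>\<Lambda> \<otimes> \<Lambda>\<close> are regarded as power series in two alphabets \<open>x, y\<close>, given by the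
  coefficient of each \<open>x\<^sup>a y\<^sup>b\<close>. Since \<open>f \<in> \<Lambda>\<close> is symmetric, \<open>f(x, y)\<close> may be computed by listing
  the variables of the two alphabets alternately: \<open>x\<^sub>0, y\<^sub>0, x\<^sub>1, y\<^sub>1, \<dots>\<close>.
\<close>

lift_definition interleave :: "monom \<Rightarrow> monom \<Rightarrow> monom"
  is "\<lambda>a b i. if even i then a (i div 2) else b (i div 2)"
proof -
  fix a b :: "nat \<Rightarrow> nat"
  assume fin: "finite {k. a k \<noteq> 0}" "finite {k. b k \<noteq> 0}"
  have "{i. (if even i then a (i div 2) else b (i div 2)) \<noteq> 0} \<subseteq>
      (\<lambda>i. 2 * i) ` {k. a k \<noteq> 0} \<union> (\<lambda>i. 2 * i + 1) ` {k. b k \<noteq> 0}"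
  proof
    fix i assume "i \<in> {i. (if even i then a (i div 2) else b (i div 2)) \<noteq> 0}"
    then show "i \<in> (\<lambda>i. 2 * i) ` {k. a k \<noteq> 0} \<union> (\<lambda>i. 2 * i + 1) ` {k. b k \<noteq> 0}"
      by (cases "even i") (auto simp: image_iff intro!: exI[of _ "i div 2"])
  qed
  then show "finite {i. (if even i then a (i div 2) else b (i div 2)) \<noteq> 0}"
    using fin by (meson finite_UnI finite_imageI finite_subset)
qed

definition coproduct :: "kfield mpser \<Rightarrow> monom \<Rightarrow> monom \<Rightarrow> kfield" where
  "coproduct f a b = cf f (interleave a b)"

definition tensor :: "kfield mpser \<Rightarrow> kfield mpser \<Rightarrow> monom \<Rightarrow> monom \<Rightarrow> kfield" where
  "tensor f g a b = cf f a * cf g b"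

definition skew_dual_grothendieck :: "part \<Rightarrow> part \<Rightarrow> kfield mpser" where
  "skew_dual_grothendieck lam = (THE F.
     (\<forall>mu. F mu \<in> Lam) \<and> finite {mu. F mu \<noteq> 0} \<and>
     (\<forall>a b. coproduct (dual_grothendieck lam) a b =
        (\<Sum>mu | F mu \<noteq> 0. tensor (dual_grothendieck mu) (F mu) a b)))"


section \<open>Fermionic Fock space\<close>

text \<open>
  The Fock space is realised on the orthonormal basis of semi-infinite wedge products
  \<open>s\<^sub>1 \<and> s\<^sub>2 \<and> \<dots>\<close> with \<open>s\<^sub>1 > s\<^sub>2 > \<dots>\<close>, indexed by their sets of occupied positions. The facts
  below show that this is the module described by the relations of the fermions and of the
  vacuum, and that the basis agrees up to signs with the one formed by the products of fermions
  applied to the vacuum.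
\<close>

typedef maya = "{S :: int set. finite {n \<in> S. 0 \<le> n} \<and> finite {n. n \<notin> S \<and> n < 0}}"
  morphisms occ Abs_maya
proof -
  have "{n \<in> {..<0::int}. 0 \<le> n} = {}" "{n. n \<notin> {..<0::int} \<and> n < 0} = {}"
    by auto
  then show ?thesis
    by (intro exI[of _ "{..<0}"]) (simp only: mem_Collect_eq finite.emptyI simp_thms)
qed

setup_lifting type_definition_maya

lift_definition vac_state :: maya is "{..<0}"
proof -
  have "{n \<in> {..<0::int}. 0 \<le> n} = {}" "{n. n \<notin> {..<0::int} \<and> n < 0} = {}"
    by auto
  then show "finite {n \<in> {..<0::int}. 0 \<le> n} \<and> finite {n. n \<notin> {..<0::int} \<and> n < 0}"
    by (metis finite.emptyI)
qed

lift_definition add_state :: "int \<Rightarrow> maya \<Rightarrow> maya" is "insert"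
proof -
  fix n :: int and S :: "int set"
  assume *: "finite {n \<in> S. 0 \<le> n} \<and> finite {n. n \<notin> S \<and> n < 0}"
  have "{m \<in> insert n S. 0 \<le> m} \<subseteq> insert n {m \<in> S. 0 \<le> m}"
    and "{m. m \<notin> insert n S \<and> m < 0} \<subseteq> {m. m \<notin> S \<and> m < 0}"
    by auto
  then show "finite {m \<in> insert n S. 0 \<le> m} \<and> finite {m. m \<notin> insert n S \<and> m < 0}"
    using * by (meson finite_insert finite_subset)
qed

lift_definition del_state :: "int \<Rightarrow> maya \<Rightarrow> maya" is "\<lambda>n S. S - {n}"
proof -
  fix n :: int and S :: "int set"
  assume *: "finite {n \<in> S. 0 \<le> n} \<and> finite {n. n \<notin> S \<and> n < 0}"
  have "{m \<in> S - {n}. 0 \<le> m} \<subseteq> {m \<in> S. 0 \<le> m}"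
    and "{m. m \<notin> S - {n} \<and> m < 0} \<subseteq> insert n {m. m \<notin> S \<and> m < 0}"
    by auto
  then show "finite {m \<in> S - {n}. 0 \<le> m} \<and> finite {m. m \<notin> S - {n} \<and> m < 0}"
    using * by (meson finite_insert finite_subset)
qed

text \<open>
  A ket is a possibly infinite linear combination of basis vectors, given by its coefficients. The
  coefficients may lie in an extension ring of \<open>k\<close>, as is needed for \<open>e\<^bsup>H(x)\<^esup>\<close>. The fermions act
  termwise: \<open>\<psi>\<^sub>n\<close> wedges with \<open>n\<close> from the left and \<open>\<psi>\<^sub>n\<^sup>*\<close> is the corresponding contraction.
\<close>

type_synonym 'r ket = "maya \<Rightarrow> 'r"

definition basis_ket :: "maya \<Rightarrow> 'r :: comm_ring_1 ket" where
  "basis_ket S = (\<lambda>T. if T = S then 1 else 0)"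

definition vacuum :: "'r :: comm_ring_1 ket" where
  "vacuum = basis_ket vac_state"

definition fsign :: "int \<Rightarrow> maya \<Rightarrow> 'r :: comm_ring_1" where
  "fsign n S = (-1) ^ card {i \<in> occ S. n < i}"

definition psi :: "int \<Rightarrow> 'r :: comm_ring_1 ket \<Rightarrow> 'r ket" where
  "psi n v = (\<lambda>S. if n \<in> occ S then fsign n S * v (del_state n S) else 0)"

definition psi_star :: "int \<Rightarrow> 'r :: comm_ring_1 ket \<Rightarrow> 'r ket" where
  "psi_star n v = (\<lambda>S. if n \<notin> occ S then fsign n S * v (add_state n S) else 0)"

text \<open>
  A bra is represented by the functional it defines on kets, and the right action of an operator is
  precomposition. Then \<open>\<omega>\<close> sends a ket to the functional pairing it with other kets via the basis;
  the facts below show \<open>\<omega> (X|0\<rangle>) = \<langle>0|X\<^sup>*\<close>.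
\<close>

definition omega :: "'r :: comm_ring_1 ket \<Rightarrow> ('r ket \<Rightarrow> 'r)" where
  "omega w = (\<lambda>v. Sum_any (\<lambda>S. w S * v S))"

subsection \<open>Characterisation of the Fock space\<close>

lemma occ_eqI: "occ S = occ T \<Longrightarrow> S = T"
  by (simp add: occ_inject)

lemma finite_occ_greater: "finite {i \<in> occ S. n < i}"
proof -
  have "{i \<in> occ S. n < i} \<subseteq> {i \<in> occ S. 0 \<le> i} \<union> {n..0}"
    by auto
  moreover have "finite {i \<in> occ S. 0 \<le> i}"
    using occ[of S] by auto
  ultimately show ?thesis
    by (meson finite_Un finite_atLeastAtMost_int finite_subset)
qed

lemma fsign_square: "fsign n S * fsign n S = 1"
  by (simp add: fsign_def flip: power_mult_distrib)

lemma fsign_add: "fsign n (add_state m S) = (if n < m \<and> m \<notin> occ S then - fsign n S else fsign n S)"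
proof -
  have *: "{i \<in> occ (add_state m S). n < i} =
      (if n < m then insert m {i \<in> occ S. n < i} else {i \<in> occ S. n < i})"
    by (auto simp: add_state.rep_eq)
  show ?thesis
    unfolding fsign_def * by (auto simp: finite_occ_greater insert_absorb)
qed

lemma fsign_del:
  "(fsign n (del_state m S) :: 'a :: comm_ring_1) =
    (if n < m \<and> m \<in> occ S then - fsign n S else fsign n S)"
proof (cases "m \<in> occ S")
  case True
  then have "S = add_state m (del_state m S)" "m \<notin> occ (del_state m S)"
    by (auto intro!: occ_eqI simp: add_state.rep_eq del_state.rep_eq)
  then show ?thesis
    using True fsign_add[of n m "del_state m S", where 'a = 'a] by (metis minus_minus)
next
  case False
  then have "del_state m S = S"
    by (auto intro!: occ_eqI simp: del_state.rep_eq)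
  then show ?thesis
    using False by simp
qed

lemma psi_psi: "psi m (psi n v) S + psi n (psi m v) S = 0"
proof -
  have "del_state m (del_state n S) = del_state n (del_state m S)"
    by (rule occ_eqI) (auto simp: del_state.rep_eq)
  then show ?thesis
    by (cases m n rule: linorder_cases) (auto simp: psi_def fsign_del del_state.rep_eq)
qed

lemma psi_star_psi_star: "psi_star m (psi_star n v) S + psi_star n (psi_star m v) S = 0"
proof -
  have "add_state m (add_state n S) = add_state n (add_state m S)"
    by (rule occ_eqI) (auto simp: add_state.rep_eq)
  then show ?thesis
    by (cases m n rule: linorder_cases) (auto simp: psi_star_def fsign_add add_state.rep_eq)
qed

lemma psi_psi_star:
  "psi m (psi_star n v) S + psi_star n (psi m v) S = (if m = n then v S else 0)"
proof (cases "m = n")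
  case True
  have "add_state n (del_state n S) = S" if "n \<in> occ S"
    using that by (auto intro!: occ_eqI simp: add_state.rep_eq del_state.rep_eq)
  moreover have "del_state n (add_state n S) = S" if "n \<notin> occ S"
    using that by (auto intro!: occ_eqI simp: add_state.rep_eq del_state.rep_eq)
  moreover have "fsign n S * (fsign n S * v S) = v S"
    by (simp add: fsign_square flip: mult.assoc)
  ultimately show ?thesis
    using True by (auto simp: psi_def psi_star_def fsign_add fsign_del add_state.rep_eq del_state.rep_eq)
next
  case False
  then have "add_state n (del_state m S) = del_state m (add_state n S)"
    by (auto intro!: occ_eqI simp: add_state.rep_eq del_state.rep_eq)
  then show ?thesis
    using False
    by (cases m n rule: linorder_cases)
      (auto simp: psi_def psi_star_def fsign_add fsign_del add_state.rep_eq del_state.rep_eq)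
qed

lemma psi_basis_ket:
  "psi n (basis_ket S) = (\<lambda>T. if n \<in> occ S then 0 else fsign n S * basis_ket (add_state n S) T)"
proof (rule ext)
  fix T
  have "n \<in> occ T \<and> del_state n T = S \<longleftrightarrow> n \<notin> occ S \<and> T = add_state n S"
    by (auto simp flip: occ_inject simp: add_state.rep_eq del_state.rep_eq)
  then show "psi n (basis_ket S) T =
      (if n \<in> occ S then 0 else fsign n S * basis_ket (add_state n S) T)"
    by (auto simp: psi_def basis_ket_def fsign_add)
qed

lemma psi_star_basis_ket:
  "psi_star n (basis_ket S) =
    (\<lambda>T. if n \<in> occ S then fsign n S * basis_ket (del_state n S) T else 0)"
proof (rule ext)
  fix T
  have "n \<notin> occ T \<and> add_state n T = S \<longleftrightarrow> n \<in> occ S \<and> T = del_state n S"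
    by (auto simp flip: occ_inject simp: add_state.rep_eq del_state.rep_eq)
  then show "psi_star n (basis_ket S) T =
      (if n \<in> occ S then fsign n S * basis_ket (del_state n S) T else 0)"
    by (auto simp: psi_star_def basis_ket_def fsign_del)
qed

lemma psi_vacuum: "m < 0 \<Longrightarrow> psi m vacuum = (\<lambda>S. 0)"
  by (simp add: vacuum_def psi_basis_ket vac_state.rep_eq)

lemma psi_star_vacuum: "0 \<le> n \<Longrightarrow> psi_star n vacuum = (\<lambda>S. 0)"
  by (simp add: vacuum_def psi_star_basis_ket vac_state.rep_eq)

lemma omega_vacuum: "omega vacuum v = v vac_state"
proof -
  have "(\<lambda>S. vacuum S * v S) = (\<lambda>S. v S when S = vac_state)"
    by (auto simp: vacuum_def basis_ket_def when_def)
  then show ?thesis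
    unfolding omega_def by (simp only: Sum_any_when_equal)
qed

lemma omega_psi: "omega (psi n w) v = omega w (psi_star n v)"
proof -
  have add_del: "add_state n (del_state n S) = S" if "n \<in> occ S" for S
    using that by (auto intro!: occ_eqI simp: add_state.rep_eq del_state.rep_eq)
  have del_add: "del_state n (add_state n S) = S" if "n \<notin> occ S" for S
    using that by (auto intro!: occ_eqI simp: add_state.rep_eq del_state.rep_eq)
  have "(\<Sum>S | psi n w S * v S \<noteq> 0. psi n w S * v S) =
      (\<Sum>S | w S * psi_star n v S \<noteq> 0. w S * psi_star n v S)"
    by (rule sum.reindex_bij_witness[where i = "add_state n" and j = "del_state n"])
      (auto simp: psi_def psi_star_def add_state.rep_eq del_state.rep_eq fsign_add fsign_del
        add_del del_add ac_simps split: if_splits)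
  then show ?thesis
    by (simp add: omega_def Sum_any.expand_set)
qed

lemma omega_psi_star: "omega (psi_star n w) v = omega w (psi n v)"
proof -
  have add_del: "add_state n (del_state n S) = S" if "n \<in> occ S" for S
    using that by (auto intro!: occ_eqI simp: add_state.rep_eq del_state.rep_eq)
  have del_add: "del_state n (add_state n S) = S" if "n \<notin> occ S" for S
    using that by (auto intro!: occ_eqI simp: add_state.rep_eq del_state.rep_eq)
  have "(\<Sum>S | psi_star n w S * v S \<noteq> 0. psi_star n w S * v S) =
      (\<Sum>S | w S * psi n v S \<noteq> 0. w S * psi n v S)"
    by (rule sum.reindex_bij_witness[where i = "del_state n" and j = "add_state n"])
      (auto simp: psi_def psi_star_def add_state.rep_eq del_state.rep_eq fsign_add fsign_del
        add_del del_add ac_simps split: if_splits)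
  then show ?thesis
    by (simp add: omega_def Sum_any.expand_set)
qed

lemma psi_scale: "psi n (\<lambda>S. c * v S) = (\<lambda>S. c * psi n v S)"
  by (rule ext) (simp add: psi_def mult.left_commute)

lemma psi_star_scale: "psi_star n (\<lambda>S. c * v S) = (\<lambda>S. c * psi_star n v S)"
  by (rule ext) (simp add: psi_star_def mult.left_commute)

lemma fsign_cases: "fsign n S \<in> {1, - 1}"
  by (cases "even (card {i \<in> occ S. n < i})") (simp_all add: fsign_def)

lemma foldr_psi_star_basis_ket:
  assumes "distinct ms" "set ms \<subseteq> occ S"
  shows "\<exists>T. \<exists>e\<in>{1, - 1}. occ T = occ S - set ms \<and>
           foldr psi_star ms (basis_ket S) = (\<lambda>U. (e :: 'a :: comm_ring_1) * basis_ket T U)"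
  using assms
proof (induction ms)
  case Nil
  then show ?case by (intro exI[of _ S] bexI[of _ 1]) auto
next
  case (Cons m ms)
  then have "distinct ms" "set ms \<subseteq> occ S"
    by auto
  from Cons.IH[OF this] obtain T and e :: 'a where
    T: "e \<in> {1, - 1}" "occ T = occ S - set ms"
      "foldr psi_star ms (basis_ket S) = (\<lambda>U. e * basis_ket T U)"
    by blast
  have "foldr psi_star (m # ms) (basis_ket S) =
      (\<lambda>U. (e * fsign m T) * basis_ket (del_state m T) U)"
    unfolding foldr.simps o_apply T(3) psi_star_scale psi_star_basis_ket
    using T(2) Cons.prems by (simp add: mult.assoc)
  moreover have "e * fsign m T \<in> {1, - 1}"
    using T(1) fsign_cases[of m T, where 'a = 'a] by auto
  ultimately show ?case
    using T(2) by (intro exI[of _ "del_state m T"] bexI[of _ "e * fsign m T"])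
      (auto simp: del_state.rep_eq)
qed

lemma foldr_psi_basis_ket:
  assumes "distinct ns" "set ns \<inter> occ S = {}"
  shows "\<exists>T. \<exists>e\<in>{1, - 1}. occ T = occ S \<union> set ns \<and>
           foldr psi ns (basis_ket S) = (\<lambda>U. (e :: 'a :: comm_ring_1) * basis_ket T U)"
  using assms
proof (induction ns)
  case Nil
  then show ?case by (intro exI[of _ S] bexI[of _ 1]) auto
next
  case (Cons n ns)
  then have "distinct ns" "set ns \<inter> occ S = {}"
    by auto
  from Cons.IH[OF this] obtain T and e :: 'a where
    T: "e \<in> {1, - 1}" "occ T = occ S \<union> set ns"
      "foldr psi ns (basis_ket S) = (\<lambda>U. e * basis_ket T U)"
    by blast
  have "foldr psi (n # ns) (basis_ket S) =
      (\<lambda>U. (e * fsign n T) * basis_ket (add_state n T) U)"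
    unfolding foldr.simps o_apply T(3) psi_scale psi_basis_ket
    using T(2) Cons.prems by (simp add: mult.assoc)
  moreover have "e * fsign n T \<in> {1, - 1}"
    using T(1) fsign_cases[of n T, where 'a = 'a] by auto
  ultimately show ?case
    using T(2) by (intro exI[of _ "add_state n T"] bexI[of _ "e * fsign n T"])
      (auto simp: add_state.rep_eq)
qed

lemma psi_product_vacuum:
  assumes "distinct ns" "\<forall>n\<in>set ns. 0 \<le> n" "distinct ms" "\<forall>m\<in>set ms. m < 0"
  shows "\<exists>S. \<exists>e\<in>{1, - 1}. occ S = {..<0} - set ms \<union> set ns \<and>
           foldr psi ns (foldr psi_star ms vacuum) =
             (\<lambda>U. (e :: 'a :: comm_ring_1) * basis_ket S U)"
proof -
  have "set ms \<subseteq> occ vac_state"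
    using assms(4) by (auto simp: vac_state.rep_eq)
  from foldr_psi_star_basis_ket[OF assms(3) this, where 'a = 'a] obtain T and e :: 'a where
    T: "e \<in> {1, - 1}" "occ T = {..<0} - set ms"
      "foldr psi_star ms vacuum = (\<lambda>U. e * basis_ket T U)"
    unfolding vacuum_def vac_state.rep_eq by blast
  have "set ns \<inter> occ T = {}"
    using assms(2) T(2) by auto
  from foldr_psi_basis_ket[OF assms(1) this, where 'a = 'a] obtain S and d :: 'a where
    S: "d \<in> {1, - 1}" "occ S = occ T \<union> set ns" "foldr psi ns (basis_ket T) = (\<lambda>U. d * basis_ket S U)"
    by blast
  have scale: "foldr psi ns (\<lambda>U. c * v U) = (\<lambda>U. c * foldr psi ns v U)" for c :: 'a and v
    by (induction ns) (simp_all add: psi_scale)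
  show ?thesis
  proof (intro exI[of _ S] bexI[of _ "e * d"] conjI)
    show "occ S = {..<0} - set ms \<union> set ns"
      using S(2) T(2) by simp
    show "foldr psi ns (foldr psi_star ms vacuum) = (\<lambda>U. (e * d) * basis_ket S U)"
      unfolding T(3) scale S(3) by (simp only: mult.assoc)
    show "e * d \<in> {1, - 1}"
      using S(1) T(1) by auto
  qed
qed

lemma basis_ket_psi_product:
  "\<exists>ns ms. sorted_wrt (>) ns \<and> (\<forall>n\<in>set ns. 0 \<le> n) \<and> sorted_wrt (<) ms \<and> (\<forall>m\<in>set ms. m < 0) \<and>
     (\<exists>e\<in>{1, - 1}. foldr psi ns (foldr psi_star ms vacuum) =
       (\<lambda>U. (e :: 'a :: comm_ring_1) * basis_ket S U))"
proof -
  define ns where "ns = rev (sorted_list_of_set {n \<in> occ S. 0 \<le> n})"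
  define ms where "ms = sorted_list_of_set {n. n \<notin> occ S \<and> n < 0}"
  have fin: "finite {n \<in> occ S. 0 \<le> n}" "finite {n. n \<notin> occ S \<and> n < 0}"
    using occ[of S] by auto
  have sets: "set ns = {n \<in> occ S. 0 \<le> n}" "set ms = {n. n \<notin> occ S \<and> n < 0}"
    using fin by (simp_all add: ns_def ms_def)
  have sorted: "sorted_wrt (>) ns" "sorted_wrt (<) ms"
    by (simp_all add: ns_def ms_def sorted_wrt_rev)
  have signs: "\<forall>n\<in>set ns. 0 \<le> n" "\<forall>m\<in>set ms. m < 0"
    unfolding sets by simp_all
  have "distinct ns" "distinct ms"
    by (simp_all add: ns_def ms_def)
  from psi_product_vacuum[OF this(1) signs(1) this(2) signs(2), where 'a = 'a] obtain T and e :: 'a where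
    T: "e \<in> {1, - 1}" "occ T = {..<0} - set ms \<union> set ns"
      "foldr psi ns (foldr psi_star ms vacuum) = (\<lambda>U. e * basis_ket T U)"
    by blast
  have "T = S"
  proof (rule occ_eqI)
    have "i \<in> occ T \<longleftrightarrow> i \<in> occ S" for i
      unfolding T(2) sets by (cases "i < 0") auto
    then show "occ T = occ S"
      by blast
  qed
  with T have "\<exists>e\<in>{1, - 1}. foldr psi ns (foldr psi_star ms vacuum) =
      (\<lambda>U. (e :: 'a) * basis_ket S U)"
    by blast
  with sorted signs show ?thesis
    by blast
qed


section \<open>Bosons and the Grothendieck states\<close>

text \<open>
  From here on kets have coefficients in the ring of power series in \<open>x\<close>, which contains \<open>k\<close> as its
  constants. All infinite sums are taken coefficientwise; on the kets to which the operators are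
  applied, only finitely many terms contribute to each coefficient.
\<close>

definition boson :: "int \<Rightarrow> 'r :: comm_ring_1 ket \<Rightarrow> 'r ket" where
  "boson m v = (\<lambda>S. Sum_any (\<lambda>j. psi j (psi_star (j + m) v) S))"

definition Theta_op :: "kfield mpser ket \<Rightarrow> kfield mpser ket" where
  "Theta_op v = (\<lambda>S. Sum_any (\<lambda>n. if 1 \<le> n
     then cst ((- 1) ^ (n - 1) * beta ^ n / of_nat n) * boson (- int n) v S else 0))"

definition theta_op :: "kfield mpser ket \<Rightarrow> kfield mpser ket" where
  "theta_op v = (\<lambda>S. Sum_any (\<lambda>n. if 1 \<le> n
     then cst ((- 1) ^ (n - 1) * beta ^ n / of_nat n) * boson (int n) v S else 0))"

definition H_op :: "kfield mpser ket \<Rightarrow> kfield mpser ket" where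
  "H_op v = (\<lambda>S. Sum_any (\<lambda>n. if 1 \<le> n
     then cst (1 / of_nat n) * p_sym n * boson (int n) v S else 0))"

definition exp_op ::
  "(kfield mpser ket \<Rightarrow> kfield mpser ket) \<Rightarrow> kfield mpser ket \<Rightarrow> kfield mpser ket" where
  "exp_op X v = (\<lambda>S. Sum_any (\<lambda>i. cst (1 / of_nat (fact i)) * (X ^^ i) v S))"

primrec shifted_vacuum :: "nat \<Rightarrow> 'r :: comm_ring_1 ket" where
  "shifted_vacuum 0 = vacuum"
| "shifted_vacuum (Suc r) = psi_star (- int (Suc r)) (shifted_vacuum r)"

text \<open>The states for a chosen \<open>r \<ge> \<ell>(\<lambda>)\<close>, on which they do not depend.\<close>

definition ket_G :: "nat \<Rightarrow> part \<Rightarrow> kfield mpser ket" where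
  "ket_G r lam = foldr (\<lambda>i v. psi (int (pt lam i) - int i) (exp_op Theta_op v))
     [1..<Suc r] (shifted_vacuum r)"

definition ket_g :: "nat \<Rightarrow> part \<Rightarrow> kfield mpser ket" where
  "ket_g r lam = foldr (\<lambda>i v. psi (int (pt lam i) - int i) (exp_op (\<lambda>w S. - theta_op w S) v))
     [1..<Suc r] (shifted_vacuum r)"

definition bra_G :: "nat \<Rightarrow> part \<Rightarrow> kfield mpser ket \<Rightarrow> kfield mpser" where
  "bra_G r mu = omega (ket_G r mu)"

end

theory Submission
  imports Defs "HOL-Computational_Algebra.Formal_Power_Series"
begin

text \<open>
  All coefficients involved are minors. Restricted to finitely many modes, the exponential of a
  combination of bosons acts on \<open>\<psi>(f\<^sub>1) \<cdots> \<psi>(f\<^sub>r)|-r\<rangle>\<close> by multiplying every \<open>f\<^sub>i\<close>, viewed as a power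
  series in \<open>t\<close>, by a fixed series: \<open>1 + \<beta>t\<close> for \<open>\<Theta>\<close>, its inverse for \<open>-\<theta>\<close>, and \<open>\<Sum> h\<^sub>m t\<^sup>m\<close> for
  \<open>H(x)\<close>. So the coefficients of \<open>|\<mu>\<rangle>\<^sup>G\<close>, \<open>|\<lambda>\<rangle>\<^sup>g\<close> and \<open>e\<^bsup>H(x)\<^esup>|\<lambda>\<rangle>\<^sup>g\<close> in the basis of partitions are
  determinants, and the Cauchy--Binet formula is applied to them three times. Paired with alternants,
  it identifies the coefficients of \<open>|\<mu>\<rangle>\<^sup>G\<close> with the Schur coefficients of \<open>G\<^sub>\<mu>\<close>. It shows that the
  states \<open>|\<mu>\<rangle>\<^sup>G\<close> and \<open>|\<lambda>\<rangle>\<^sup>g\<close> are dual to each other, so that \<open>|\<lambda>\<rangle>\<^sup>g\<close> lists the Schur coefficients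
  of \<open>g\<^sub>\<lambda>\<close>. Finally \<open>\<Delta> g\<^sub>\<lambda> = \<Sum>\<^sub>\<nu> s\<^sub>\<nu> \<otimes> \<langle>\<nu>|e\<^bsup>H\<^esup>|\<lambda>\<rangle>\<^sup>g\<close>, and the theorem follows by expanding the \<open>s\<^sub>\<nu>\<close> in
  the basis of the \<open>g\<^sub>\<mu>\<close>.
\<close>

section \<open>Partitions and their beta numbers\<close>

text \<open>Why row \<open>i\<close> of every determinant carries an \<open>i\<close>-th power: the
  relation \<open>[a_m, psi_k] = psi_(k - m)\<close> makes an exponential multiply the series of
  each fermion it passes, and the fermion with index \<open>i\<close>, counted from 0, has exactly
  \<open>i\<close> exponentials to its left.

  Three obstacles shape the proof. First, \<open>Sum_any\<close> is 0 on an infinite support, so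
  every infinite sum has to be shown finite before it can be manipulated. Second,
  \<open>e^Theta\<close> also lifts modes from arbitrarily deep in the sea. A computation with
  \<open>r\<close> fermions therefore shows only the coefficients at partitions with at most
  \<open>r\<close> parts, and the others require the independence of \<open>ket_G\<close> from
  \<open>r\<close>. Third, the polynomials are introduced by \<open>THE\<close>, so each
  identification includes a uniqueness proof. These rest on the cancellability of the Vandermonde
  product, on Schur functions being a basis of \<open>Lam\<close>, and on the infinite matrix
  \<open>gco\<close> being injective by triangularity in the size.

  The multiplying series are identified by the differential equation \<open>y' = c' y\<close>; for
  \<open>H_op\<close> it is Newton's identity.\<close>

lemma pt_zero: "plen lam < i \<Longrightarrow> pt lam i = 0"
  by (simp add: pt_def)

lemma pt_pos: "1 \<le> i \<Longrightarrow> i \<le> plen lam \<Longrightarrow> 0 < pt lam i"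
proof -
  assume i: "1 \<le> i" "i \<le> plen lam"
  then have "parts_list lam ! (i - 1) \<in> set (parts_list lam)"
    by (intro nth_mem) (simp add: plen_def)
  moreover have "0 \<notin> set (parts_list lam)"
    using parts_list[of lam] by simp
  ultimately show ?thesis
    using i by (metis gr0I pt_def)
qed

lemma pt_antimono:
  assumes "1 \<le> i" "i \<le> j"
  shows "pt lam j \<le> pt lam i"
proof (cases "j \<le> plen lam \<and> i \<noteq> j")
  case True
  then have ij: "i - 1 < j - 1" "j - 1 < length (parts_list lam)"
    using assms unfolding plen_def by linarith+
  have "sorted_wrt (\<ge>) (parts_list lam)"
    using parts_list[of lam] by simp
  then have "parts_list lam ! (i - 1) \<ge> parts_list lam ! (j - 1)"
    using sorted_wrt_nth_less[OF _ ij] by blast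
  then show ?thesis
    using True assms by (simp add: pt_def)
qed (auto simp: pt_def)

lemma part_eqI:
  assumes "\<And>i. 1 \<le> i \<Longrightarrow> pt lam i = pt mu i"
  shows "lam = mu"
proof -
  have le: "plen a \<le> plen b" if "\<And>i. 1 \<le> i \<Longrightarrow> pt a i = pt b i" for a b
  proof (rule ccontr)
    assume "\<not> plen a \<le> plen b"
    then have "0 < pt a (plen a)" "pt b (plen a) = 0" "1 \<le> plen a"
      by (auto intro: pt_pos simp: pt_zero)
    then show False
      using that by fastforce
  qed
  have len: "plen lam = plen mu"
    using assms by (intro antisym le) simp_all
  have "parts_list lam = parts_list mu"
  proof (rule nth_equalityI)
    show "length (parts_list lam) = length (parts_list mu)"
      using len by (simp add: plen_def)
    fix i assume "i < length (parts_list lam)"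
    then show "parts_list lam ! i = parts_list mu ! i"
      using assms[of "Suc i"] len by (simp add: pt_def plen_def)
  qed
  then show ?thesis
    by (simp add: parts_list_inject)
qed

text \<open>A \<open>part\<close> stores no zeros, so the trailing zeros of \<open>p\<close> have to
  be cut off; \<open>k\<close> in the proof is the length that remains.\<close>

lemma part_of_fun:
  fixes p :: "nat \<Rightarrow> nat"
  assumes anti: "\<And>i j. 1 \<le> i \<Longrightarrow> i \<le> j \<Longrightarrow> j \<le> N \<Longrightarrow> p j \<le> p i"
  shows "\<exists>nu. plen nu \<le> N \<and> (\<forall>i. 1 \<le> i \<longrightarrow> i \<le> N \<longrightarrow> pt nu i = p i)"
proof -
  have "\<exists>k\<le>N. (\<forall>i. 1 \<le> i \<longrightarrow> i \<le> k \<longrightarrow> 0 < p i) \<and> (\<forall>i. k < i \<longrightarrow> i \<le> N \<longrightarrow> p i = 0)"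
    using anti
  proof (induction N)
    case (Suc N)
    show ?case
    proof (cases "p (Suc N) = 0")
      case True
      with Suc.IH Suc.prems show ?thesis
        by (metis le_Suc_eq)
    next
      case False
      with Suc.prems show ?thesis
        by (intro exI[of _ "Suc N"]) (metis le_refl not_gr0 le_0_eq not_less)
    qed
  qed simp
  then obtain k where k: "k \<le> N" "\<And>i. 1 \<le> i \<Longrightarrow> i \<le> k \<Longrightarrow> 0 < p i"
    "\<And>i. k < i \<Longrightarrow> i \<le> N \<Longrightarrow> p i = 0"
    by blast
  define xs where "xs = map p [1..<Suc k]"
  have "sorted_wrt (\<ge>) xs \<and> 0 \<notin> set xs"
  proof
    show "sorted_wrt (\<ge>) xs"
      unfolding xs_def sorted_wrt_iff_nth_less using k(1) anti by (auto simp del: upt_Suc)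
    show "0 \<notin> set xs"
      unfolding xs_def using k(2) by fastforce
  qed
  then have xs: "parts_list (Abs_part xs) = xs"
    by (simp add: Abs_part_inverse)
  show ?thesis
  proof (intro exI[of _ "Abs_part xs"] conjI allI impI)
    have len: "plen (Abs_part xs) = k"
      by (simp add: plen_def xs) (simp add: xs_def)
    then show "plen (Abs_part xs) \<le> N"
      using k by simp
    fix i assume i: "1 \<le> i" "i \<le> N"
    then show "pt (Abs_part xs) i = p i"
      using k unfolding pt_def len xs by (simp add: xs_def del: upt_Suc)
  qed
qed

text \<open>The strictly decreasing numbers \<open>\<lambda>\<^sub>i - i\<close>, with \<open>i = j + 1\<close> numbered from \<open>j = 0\<close>.\<close>

definition bnum :: "part \<Rightarrow> nat \<Rightarrow> int" where
  "bnum nu j = int (pt nu (Suc j)) - int (Suc j)"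

text \<open>The box with \<open>N\<close> rows and \<open>M\<close> columns. Under
  \<open>bnum\<close> its partitions correspond to the \<open>N\<close>-element subsets of
  \<open>{- int N..<int M}\<close>, which makes them the index set of Cauchy-Binet sums.\<close>

definition Par :: "nat \<Rightarrow> nat \<Rightarrow> part set" where
  "Par N M = {nu. plen nu \<le> N \<and> pt nu 1 \<le> M}"

lemma bnum_strict: "i < j \<Longrightarrow> bnum nu j < bnum nu i"
  using pt_antimono[of "Suc i" "Suc j" nu] by (simp add: bnum_def)

lemma bnum_inj: "inj (bnum nu)"
  by (rule injI) (metis bnum_strict less_irrefl linorder_neqE_nat)

lemma bnum_eq_iff [simp]: "bnum nu i = bnum nu j \<longleftrightarrow> i = j"
  using bnum_inj by (auto dest: injD)

lemma bnum_ge: "j < N \<Longrightarrow> - int N \<le> bnum nu j"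
  by (simp add: bnum_def)

lemma bnum_beyond: "plen nu \<le> j \<Longrightarrow> bnum nu j = - int (Suc j)"
  by (simp add: bnum_def pt_zero)

lemma bnum_less: "pt nu 1 \<le> M \<Longrightarrow> bnum nu j < int M"
  using pt_antimono[of 1 "Suc j" nu] by (simp add: bnum_def)

text \<open>The values above \<open>f j\<close> are exactly those at smaller indices. This recovers
  a sequence from its image and later supplies the sign in the Laplace expansion of a wedge
  product.\<close>

lemma strict_dec_above:
  fixes f :: "nat \<Rightarrow> int"
  assumes "\<And>i j. i < j \<Longrightarrow> j < N \<Longrightarrow> f j < f i" "j < N"
  shows "card {x \<in> f ` {..<N}. f j < x} = j"
proof -
  have "{x \<in> f ` {..<N}. f j < x} = f ` {..<j}"
  proof (intro equalityI subsetI)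
    fix x assume "x \<in> {x \<in> f ` {..<N}. f j < x}"
    then obtain i where i: "i < N" "x = f i" "f j < f i"
      by auto
    then have "i < j"
      using assms(1)[of j i] by (cases i j rule: linorder_cases) auto
    then show "x \<in> f ` {..<j}"
      using i by blast
  qed (use assms in auto)
  moreover have "inj_on f {..<j}"
    using assms by (intro linorder_inj_onI) (force+)
  ultimately show ?thesis
    by (simp add: card_image)
qed

lemma strict_dec_unique:
  fixes f g :: "nat \<Rightarrow> int"
  assumes f: "\<And>i j. i < j \<Longrightarrow> j < N \<Longrightarrow> f j < f i"
    and g: "\<And>i j. i < j \<Longrightarrow> j < N \<Longrightarrow> g j < g i"
    and img: "f ` {..<N} = g ` {..<N}" and i: "i < N"
  shows "f i = g i"
proof -
  have "f i \<in> g ` {..<N}"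
    using img i by blast
  then obtain j where j: "j < N" "f i = g j"
    by auto
  have "i = j"
    using strict_dec_above[of N f, OF f i] strict_dec_above[of N g, OF g j(1)] img j(2) by simp
  then show ?thesis
    using j by simp
qed

lemma bnum_image_eqD:
  assumes "bnum nu ` {..<N} = bnum mu ` {..<N}" "plen nu \<le> N" "plen mu \<le> N"
  shows "nu = mu"
proof (rule part_eqI)
  fix i :: nat assume i: "1 \<le> i"
  show "pt nu i = pt mu i"
  proof (cases "i \<le> N")
    case True
    then have "bnum nu (i - 1) = bnum mu (i - 1)"
      using i assms by (intro strict_dec_unique[where N = N] bnum_strict) auto
    then show ?thesis
      using i by (simp add: bnum_def)
  qed (use assms in \<open>simp add: pt_zero\<close>)
qed

text \<open>Each step drops by at least 1, so adding the index leaves a weakly decreasing sequence.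
  This undoes the passage from parts to beta numbers.\<close>

lemma strict_dec_gap:
  fixes s :: "nat \<Rightarrow> int"
  assumes s: "\<And>i j. i < j \<Longrightarrow> j < N \<Longrightarrow> s j < s i" and "i \<le> j" "j < N"
  shows "s j + int j \<le> s i + int i"
  using assms(2,3)
proof (induction j rule: dec_induct)
  case (step n)
  then show ?case
    using s[of n "Suc n"] by simp
qed simp

lemma strict_dec_enum:
  fixes A :: "int set"
  assumes "finite A" "card A = N"
  shows "\<exists>s. (\<forall>i j. i < j \<longrightarrow> j < N \<longrightarrow> s j < s i) \<and> s ` {..<N} = A"
proof (intro exI conjI)
  define xs where "xs = rev (sorted_list_of_set A)"
  have xs: "sorted_wrt (>) xs" "length xs = N" "set xs = A"
    using assms by (simp_all add: xs_def sorted_wrt_rev)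
  show "\<forall>i j. i < j \<longrightarrow> j < N \<longrightarrow> xs ! j < xs ! i"
    using xs by (auto simp: sorted_wrt_iff_nth_less)
  show "(!) xs ` {..<N} = A"
    using xs by (auto simp: set_conv_nth)
qed

text \<open>Sort \<open>A\<close> decreasingly and add \<open>j + 1\<close> to the entry with index
  \<open>j\<close>. The lower bound \<open>- int N\<close> on the last entry makes all the resulting
  parts nonnegative.\<close>

lemma part_of_beta_set:
  assumes A: "A \<subseteq> {- int N..<int M}" "card A = N"
  shows "\<exists>nu\<in>Par N M. bnum nu ` {..<N} = A"
proof -
  have "finite A"
    using A finite_subset by blast
  then obtain s where s: "\<And>i j. i < j \<Longrightarrow> j < N \<Longrightarrow> s j < s i" and img: "s ` {..<N} = A"
    using strict_dec_enum A by metis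
  have sb: "- int N \<le> s i \<and> s i < int M" if "i < N" for i
  proof -
    have "s i \<in> A"
      using img that by blast
    then show ?thesis
      using A by auto
  qed
  define p where "p i = nat (s (i - 1) + int i)" for i
  have p: "int (p (Suc j)) = s j + int (Suc j)" if "j < N" for j
  proof -
    have "s (N - 1) + int (N - 1) \<le> s j + int j"
      using that by (intro strict_dec_gap[where N = N] s) auto
    moreover have "- int N \<le> s (N - 1)"
      using sb that by simp
    ultimately have "0 \<le> s j + int (Suc j)"
      using that by simp
    then show ?thesis
      by (simp add: p_def)
  qed
  have "p j \<le> p i" if ij: "1 \<le> i" "i \<le> j" "j \<le> N" for i j
  proof -
    have "s (j - 1) + int (j - 1) \<le> s (i - 1) + int (i - 1)"
      using ij by (intro strict_dec_gap[where N = N] s) auto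
    then show ?thesis
      using p[of "i - 1"] p[of "j - 1"] ij by (cases i; cases j) simp_all
  qed
  then obtain nu where nu: "plen nu \<le> N" "\<forall>i. 1 \<le> i \<longrightarrow> i \<le> N \<longrightarrow> pt nu i = p i"
    using part_of_fun[of N p] by blast
  have b: "bnum nu j = s j" if "j < N" for j
    using nu(2) p[OF that] that by (simp add: bnum_def)
  have "pt nu 1 \<le> M"
  proof (cases "N = 0")
    case False
    then have "int (pt nu (Suc 0)) = s 0 + 1"
      using nu(2) p[of 0] by simp
    then show ?thesis
      using sb[of 0] False by simp
  qed (use nu in \<open>simp add: pt_zero\<close>)
  moreover have "bnum nu ` {..<N} = A"
    using b img by (metis (no_types, lifting) image_cong lessThan_iff)
  ultimately show ?thesis
    using nu by (auto simp: Par_def)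
qed

lemma finite_Par: "finite (Par N M)"
proof (rule finite_imageD)
  have "(\<lambda>nu. bnum nu ` {..<N}) ` Par N M \<subseteq> Pow {- int N..<int M}"
    using bnum_ge bnum_less by (fastforce simp: Par_def)
  then show "finite ((\<lambda>nu. bnum nu ` {..<N}) ` Par N M)"
    by (rule finite_subset) simp
  show "inj_on (\<lambda>nu. bnum nu ` {..<N}) (Par N M)"
    unfolding Par_def by (rule inj_onI) (rule bnum_image_eqD, auto)
qed

definition psize :: "part \<Rightarrow> nat" where
  "psize nu = (\<Sum>j<plen nu. pt nu (Suc j))"

lemma psize_eq:
  assumes "plen nu \<le> N"
  shows "psize nu = (\<Sum>j<N. pt nu (Suc j))"
  unfolding psize_def using assms by (intro sum.mono_neutral_left) (auto simp: pt_zero)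

lemma finite_psize_le: "finite {nu. psize nu \<le> d}"
proof (rule finite_subset)
  show "{nu. psize nu \<le> d} \<subseteq> Par d d"
  proof (clarsimp simp: Par_def)
    fix nu assume *: "psize nu \<le> d"
    have "plen nu = (\<Sum>j<plen nu. 1)"
      by simp
    also have "\<dots> \<le> psize nu"
      unfolding psize_def using pt_pos[of _ nu] by (intro sum_mono) (simp add: Suc_leI)
    finally have "plen nu \<le> d"
      using * by simp
    moreover have "pt nu (Suc 0) \<le> psize nu"
    proof (cases "plen nu = 0")
      case False
      then show ?thesis
        unfolding psize_def by (intro member_le_sum) auto
    qed (simp add: pt_zero)
    ultimately show "plen nu \<le> d \<and> pt nu (Suc 0) \<le> d"
      using * by simp
  qed
qed (rule finite_Par)

section \<open>Determinants\<close>

abbreviation Det :: "nat \<Rightarrow> (nat \<Rightarrow> nat \<Rightarrow> 'a :: comm_ring_1) \<Rightarrow> 'a" where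
  "Det n A \<equiv> det (mat n n (\<lambda>(i, j). A i j))"

lemma permutes_less: "p permutes {0..<n :: nat} \<Longrightarrow> i < n \<Longrightarrow> p i < n"
  using permutes_in_image[of p "{0..<n}" i] by simp

lemma permutes_image_lessThan: "p permutes {0..<n :: nat} \<Longrightarrow> p ` {..<n} = {..<n}"
  using permutes_image[of p "{0..<n}"] by (simp add: atLeast0LessThan)

lemma ex_permutes_of_image_eq:
  assumes "inj_on f {..<n}" "f ` {..<n} = g ` {..<n :: nat}"
  shows "\<exists>p. p permutes {0..<n} \<and> (\<forall>i<n. g (p i) = f i)"
proof -
  define p where "p i = (if i < n then inv_into {..<n} g (f i) else i)" for i
  have p: "g (p i) = f i" "p i < n" if "i < n" for i
  proof -
    have *: "f i \<in> g ` {..<n}"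
      using assms(2) that by blast
    show "g (p i) = f i"
      using f_inv_into_f[OF *] that by (simp add: p_def)
    show "p i < n"
      using inv_into_into[OF *] that by (simp add: p_def)
  qed
  have "p permutes {0..<n}"
  proof (rule bij_imp_permutes)
    have "inj_on p {0..<n}"
    proof (rule inj_onI)
      fix i j assume ij: "i \<in> {0..<n}" "j \<in> {0..<n}" "p i = p j"
      then have "f i = f j"
        using p(1)[of i] p(1)[of j] by simp
      then show "i = j"
        using assms(1) ij by (auto dest: inj_onD)
    qed
    moreover have "p ` {0..<n} \<subseteq> {0..<n}"
      using p(2) by auto
    ultimately show "bij_betw p {0..<n} {0..<n}"
      by (simp add: bij_betw_def endo_inj_surj)
  qed (simp add: p_def)
  then show ?thesis
    using p(1) by blast
qed

lemma det_Leibniz: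
  "Det n (\<lambda>i j. A i j) =
    (\<Sum>p | p permutes {0..<n}. signof p * (\<Prod>i<n. A i (p i)))"
  by (subst det_def'[of _ n]) (auto intro!: sum.cong prod.cong simp: permutes_less atLeast0LessThan)

lemma det_mat_cong:
  assumes "\<And>i j. i < n \<Longrightarrow> j < n \<Longrightarrow> A i j = B i j"
  shows "Det n (\<lambda>i j. A i j) = Det n (\<lambda>i j. B i j)"
  by (rule arg_cong[of _ _ det]) (auto simp: assms intro!: eq_matI)

lemma det_mat_transpose: "Det n (\<lambda>i j. A j i) = Det n (\<lambda>i j. A i j)"
proof -
  have "transpose_mat (mat n n (\<lambda>(i, j). A i j)) = mat n n (\<lambda>(i, j). A j i)"
    by (rule eq_matI) auto
  then show ?thesis
    using det_transpose[of "mat n n (\<lambda>(i, j). A i j)" n] by simp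
qed

text \<open>Laplace expansion along the last row. Padding a partition with zeros adds such rows or
  columns, so this makes the later determinants independent of their size.\<close>

lemma det_border_row:
  assumes "\<And>j. j < n \<Longrightarrow> A n j = 0" "A n n = 1"
  shows "Det (Suc n) (\<lambda>i j. A i j) = Det n (\<lambda>i j. A i j)"
proof -
  let ?A = "mat (Suc n) (Suc n) (\<lambda>(i, j). A i j)"
  have "det ?A = (\<Sum>j<Suc n. ?A $$ (n, j) * cofactor ?A n j)"
    by (rule laplace_expansion_row) auto
  also have "\<dots> = cofactor ?A n n"
    using assms by (simp add: lessThan_Suc)
  also have "\<dots> = det (mat_delete ?A n n)"
    by (simp add: cofactor_def)
  also have "mat_delete ?A n n = mat n n (\<lambda>(i, j). A i j)"
    by (rule eq_matI) (auto simp: mat_delete_def)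
  finally show ?thesis .
qed

lemma det_border_col:
  assumes "\<And>i. i < n \<Longrightarrow> A i n = 0" "A n n = 1"
  shows "Det (Suc n) (\<lambda>i j. A i j) = Det n (\<lambda>i j. A i j)"
  using det_border_row[of n "\<lambda>i j. A j i"] assms by (simp add: det_mat_transpose[of _ A])

text \<open>Pigeonhole: the \<open>n - p\<close> rows from \<open>p\<close> on could only use the
  \<open>n - p - 1\<close> columns after \<open>p\<close>, so every permutation meets a
  zero.\<close>

lemma det_zero_block:
  assumes "p < n" and zero: "\<And>i j. p \<le> i \<Longrightarrow> i < n \<Longrightarrow> j \<le> p \<Longrightarrow> A i j = 0"
  shows "Det n (\<lambda>i j. A i j) = 0"
  unfolding det_Leibniz
proof (rule sum.neutral, safe)
  fix q assume q: "q permutes {0..<n}"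
  have "\<exists>i. p \<le> i \<and> i < n \<and> q i \<le> p"
  proof (rule ccontr)
    assume "\<not> ?thesis"
    then have "q ` {p..<n} \<subseteq> {Suc p..<n}"
      using permutes_in_image[OF q] by force
    then have "card (q ` {p..<n}) \<le> card {Suc p..<n}"
      by (intro card_mono) auto
    moreover have "card (q ` {p..<n}) = card {p..<n}"
      using permutes_inj[OF q] by (intro card_image) (auto intro: inj_on_subset)
    ultimately show False
      using \<open>p < n\<close> by simp
  qed
  then obtain i where "p \<le> i" "i < n" "q i \<le> p"
    by blast
  then have "(\<Prod>i<n. A i (q i)) = 0"
    using zero by (intro prod_zero) auto
  then show "signof q * (\<Prod>i<n. A i (q i)) = 0"
    by simp
qed

lemma det_zero_block':
  assumes "p < n" and "\<And>i j. i \<le> p \<Longrightarrow> p \<le> j \<Longrightarrow> j < n \<Longrightarrow> A i j = 0"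
  shows "Det n (\<lambda>i j. A i j) = 0"
  using det_zero_block[of p n "\<lambda>i j. A j i"] assms by (simp add: det_mat_transpose[of _ A])

lemma det_zero_row:
  assumes "p < n" "\<And>j. j < n \<Longrightarrow> A p j = 0"
  shows "Det n (\<lambda>i j. A i j) = 0"
  unfolding det_Leibniz
proof (rule sum.neutral, safe)
  fix q assume q: "q permutes {0..<n}"
  then have "q p < n"
    using \<open>p < n\<close> by (rule permutes_less)
  then have "(\<Prod>i<n. A i (q i)) = 0"
    using assms by (intro prod_zero) auto
  then show "signof q * (\<Prod>i<n. A i (q i)) = 0"
    by simp
qed

lemma det_zero_col:
  assumes "p < n" "\<And>i. i < n \<Longrightarrow> A i p = 0"
  shows "Det n (\<lambda>i j. A i j) = 0"
  using det_zero_row[of p n "\<lambda>i j. A j i"] assms by (simp add: det_mat_transpose[of _ A])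

lemma det_unitriangular:
  assumes "\<And>i j. i < j \<Longrightarrow> j < n \<Longrightarrow> A i j = 0" "\<And>i. i < n \<Longrightarrow> A i i = 1"
  shows "Det n (\<lambda>i j. A i j) = 1"
  using assms
proof (induction n)
  case (Suc n)
  then show ?case
    by (subst det_border_col) auto
qed simp

lemma det_unitriangular':
  assumes "\<And>i j. j < i \<Longrightarrow> i < n \<Longrightarrow> A i j = 0" "\<And>i. i < n \<Longrightarrow> A i i = 1"
  shows "Det n (\<lambda>i j. A i j) = 1"
  using det_unitriangular[of n "\<lambda>i j. A j i"] assms by (simp add: det_mat_transpose[of _ A])

lemma det_mat_mult:
  shows "Det n (\<lambda>i j. \<Sum>k<n. A i k * B k j) =
    Det n (\<lambda>i j. A i j) * Det n (\<lambda>i j. B i j)"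
proof -
  have "mat n n (\<lambda>(i, j). A i j) * mat n n (\<lambda>(i, j). B i j) =
      mat n n (\<lambda>(i, j). \<Sum>k<n. A i k * B k j)"
    by (rule eq_matI) (auto simp: scalar_prod_def atLeast0LessThan)
  then show ?thesis
    using det_mult[of "mat n n (\<lambda>(i, j). A i j)" n "mat n n (\<lambda>(i, j). B i j)"] by simp
qed

lemma det_mat_permute_rows:
  assumes "p permutes {0..<n}"
  shows "Det n (\<lambda>i j. A (p i) j) = signof p * Det n (\<lambda>i j. A i j)"
proof -
  have "p i < n" if "i < n" for i
    using assms that by (rule permutes_less)
  then have "mat n n (\<lambda>(i, j). mat n n (\<lambda>(i, j). A i j) $$ (p i, j)) = mat n n (\<lambda>(i, j). A (p i) j)"
    by (intro eq_matI) auto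
  then show ?thesis
    using det_permute_rows[OF _ assms, of "mat n n (\<lambda>(i, j). A i j)"] by simp
qed

lemma det_vandermonde:
  fixes x :: "nat \<Rightarrow> 'a :: comm_ring_1"
  shows "Det n (\<lambda>i j. x i ^ (n - Suc j)) = (\<Prod>(i, j)\<in>{(i, j). i < j \<and> j < n}. x i - x j)"
proof (induction n)
  case (Suc n)
  \<comment> \<open>Multiplication by \<open>T\<close> subtracts \<open>x n\<close> times column
    \<open>j + 1\<close> from column \<open>j\<close>; this clears the last row except for its final
    entry.\<close>
  define T where "T k j = (if k = j then 1 else if k = Suc j then - x n else 0)" for k j :: nat
  have T: "(\<Sum>k<Suc n. x i ^ (Suc n - Suc k) * T k j) =
      (if j < n then (x i - x n) * x i ^ (n - Suc j) else 1)" if "j < Suc n" for i j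
  proof (cases "j < n")
    case True
    have "(\<Sum>k<Suc n. x i ^ (Suc n - Suc k) * T k j) =
        (\<Sum>k\<in>{j, Suc j}. x i ^ (Suc n - Suc k) * T k j)"
      using True by (intro sum.mono_neutral_right) (auto simp: T_def)
    also have "\<dots> = x i ^ (n - j) - x n * x i ^ (n - Suc j)"
      by (simp add: T_def)
    also have "x i ^ (n - j) = x i * x i ^ (n - Suc j)"
      using True by (metis Suc_diff_Suc power_Suc)
    finally show ?thesis
      using True by (simp add: algebra_simps)
  next
    case False
    have "(\<Sum>k<Suc n. x i ^ (Suc n - Suc k) * T k j) =
        (\<Sum>k\<in>{j}. x i ^ (Suc n - Suc k) * T k j)"
      using False that by (intro sum.mono_neutral_right) (auto simp: T_def)
    then show ?thesis
      using False that by (simp add: T_def)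
  qed
  have "Det (Suc n) (\<lambda>i j. x i ^ (Suc n - Suc j)) =
      Det (Suc n) (\<lambda>i j. x i ^ (Suc n - Suc j)) *
      Det (Suc n) (\<lambda>i j. T i j)"
    by (subst (2) det_unitriangular) (auto simp: T_def)
  also have "\<dots> = det (mat (Suc n) (Suc n)
      (\<lambda>(i, j). if j < n then (x i - x n) * x i ^ (n - Suc j) else 1))"
    unfolding det_mat_mult[symmetric] by (rule det_mat_cong) (rule T)
  also have "\<dots> = Det n (\<lambda>i j. if j < n then (x i - x n) * x i ^ (n - Suc j) else 1)"
    by (rule det_border_row) auto
  also have "\<dots> = Det n (\<lambda>i j. (x i - x n) * x i ^ (n - Suc j))"
    by (rule det_mat_cong) auto
  also have "\<dots> = (\<Prod>i<n. x i - x n) * Det n (\<lambda>i j. x i ^ (n - Suc j))"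
    by (simp add: det_Leibniz prod.distrib sum_distrib_left ac_simps)
  also have "\<dots> = (\<Prod>i<n. x i - x n) * (\<Prod>(i, j)\<in>{(i, j). i < j \<and> j < n}. x i - x j)"
    by (simp only: Suc.IH)
  also have "(\<Prod>i<n. x i - x n) = (\<Prod>(i, j)\<in>(\<lambda>i. (i, n)) ` {..<n}. x i - x j)"
    by (subst prod.reindex) (auto intro: inj_onI)
  also have "\<dots> * (\<Prod>(i, j)\<in>{(i, j). i < j \<and> j < n}. x i - x j) =
      (\<Prod>(i, j)\<in>(\<lambda>i. (i, n)) ` {..<n} \<union> {(i, j). i < j \<and> j < n}. x i - x j)"
  proof (rule prod.union_disjoint[symmetric])
    show "finite {(i, j). i < j \<and> j < n}"
      by (rule finite_subset[of _ "{..<n} \<times> {..<n}"]) auto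
  qed auto
  also have "(\<lambda>i. (i, n)) ` {..<n} \<union> {(i, j). i < j \<and> j < n} = {(i, j). i < j \<and> j < Suc n}"
    by auto
  finally show ?case .
qed simp

text \<open>An injective map into the window is determined by its image, which is the beta set of a
  unique partition in the box, and by the order in which it lists that image.\<close>

lemma bij_betw_Par_permutes:
  "bij_betw (\<lambda>(nu, q). restrict (\<lambda>i. bnum nu (q i)) {..<N}) (Par N M \<times> {q. q permutes {0..<N}})
    {f \<in> {..<N} \<rightarrow>\<^sub>E {- int N..<int M}. inj_on f {..<N}}" (is "bij_betw _ _ ?F")
proof (rule bij_betw_imageI)
  show "inj_on (\<lambda>(nu, q). restrict (\<lambda>i. bnum nu (q i)) {..<N}) (Par N M \<times> {q. q permutes {0..<N}})"
  proof (rule inj_onI, clarify)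
    fix nu q nu' q'
    assume P: "nu \<in> Par N M" "nu' \<in> Par N M" and q: "q permutes {0..<N}" "q' permutes {0..<N}"
      and eq: "restrict (\<lambda>i. bnum nu (q i)) {..<N} = restrict (\<lambda>i. bnum nu' (q' i)) {..<N}"
    have eq': "bnum nu (q i) = bnum nu' (q' i)" if "i < N" for i
      using fun_cong[OF eq, of i] that by simp
    have "bnum nu ` {..<N} = (\<lambda>i. bnum nu (q i)) ` {..<N}"
      using permutes_image_lessThan[OF q(1)] by (metis image_image)
    also have "\<dots> = (\<lambda>i. bnum nu' (q' i)) ` {..<N}"
      using eq' by (intro image_cong) auto
    also have "\<dots> = bnum nu' ` {..<N}"
      using permutes_image_lessThan[OF q(2)] by (metis image_image)
    finally have nu: "nu = nu'"
      using P by (intro bnum_image_eqD) (auto simp: Par_def)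
    have "q i = q' i" for i
    proof (cases "i < N")
      case True
      then show ?thesis
        using eq'[OF True] nu by simp
    next
      case False
      then show ?thesis
        using q by (simp add: permutes_def)
    qed
    then show "nu = nu' \<and> q = q'"
      using nu by blast
  qed
  show "(\<lambda>(nu, q). restrict (\<lambda>i. bnum nu (q i)) {..<N}) ` (Par N M \<times> {q. q permutes {0..<N}}) =
      ?F"
  proof (intro equalityI subsetI)
    fix f assume "f \<in> (\<lambda>(nu, q). restrict (\<lambda>i. bnum nu (q i)) {..<N}) ` (Par N M \<times> {q. q permutes {0..<N}})"
    then obtain nu q where nu: "nu \<in> Par N M" and q: "q permutes {0..<N}"
      and f: "f = restrict (\<lambda>i. bnum nu (q i)) {..<N}"
      by auto
    have "inj_on f {..<N}"
      using permutes_inj[OF q] by (auto simp: f inj_on_def)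
    moreover have "bnum nu (q i) \<in> {- int N..<int M}" if "i < N" for i
      using nu permutes_less[OF q that] by (auto simp: Par_def intro: bnum_ge bnum_less)
    then have "f \<in> {..<N} \<rightarrow>\<^sub>E {- int N..<int M}"
      unfolding f by (intro PiE_I) simp_all
    ultimately show "f \<in> ?F"
      by blast
  next
    fix f assume f: "f \<in> ?F"
    have "f ` {..<N} \<subseteq> {- int N..<int M}" "card (f ` {..<N}) = N"
      using f by (auto simp: card_image)
    from part_of_beta_set[OF this] obtain nu where
      nu: "nu \<in> Par N M" "bnum nu ` {..<N} = f ` {..<N}"
      by auto
    obtain q where q: "q permutes {0..<N}" "\<And>i. i < N \<Longrightarrow> bnum nu (q i) = f i"
      using ex_permutes_of_image_eq[of f N "bnum nu"] f nu(2) by auto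
    note q(1)
    moreover have "f = restrict (\<lambda>i. bnum nu (q i)) {..<N}"
      using f q(2) by (auto simp: restrict_def PiE_def extensional_def)
    ultimately show "f \<in> (\<lambda>(nu, q). restrict (\<lambda>i. bnum nu (q i)) {..<N}) ` (Par N M \<times> {q. q permutes {0..<N}})"
      using nu by force
  qed
qed

text \<open>Expand the right side over all maps \<open>f\<close> from rows into the window. A map
  that is not injective produces two equal rows; the injective ones are grouped by their image,
  hence by partition.\<close>

lemma cauchy_binet:
  fixes a b :: "nat \<Rightarrow> int \<Rightarrow> 'a :: comm_ring_1"
  shows "(\<Sum>nu\<in>Par N M. Det N (\<lambda>i j. a i (bnum nu j)) *
        Det N (\<lambda>i j. b i (bnum nu j))) =
    Det N (\<lambda>i j. \<Sum>k\<in>{- int N..<int M}. a i k * b j k)"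
proof -
  let ?K = "{- int N..<int M}" and ?P = "{p. p permutes {0..<N}}"
  let ?E = "{..<N} \<rightarrow>\<^sub>E ?K"
  let ?g = "\<lambda>f. (\<Prod>i<N. a i (f i)) * Det N (\<lambda>i j. b j (f i))"
  have fin: "finite ?E"
    by (rule finite_PiE) auto
  have zero: "Det N (\<lambda>i j. b j (f i)) = 0" if "\<not> inj_on f {..<N}" for f
  proof -
    from that obtain i j where "i < N" "j < N" "i \<noteq> j" "f i = f j"
      by (auto simp: inj_on_def)
    then show ?thesis
      by (intro det_identical_rows[of _ N i j]) (auto simp: row_def)
  qed
  have "Det N (\<lambda>i j. \<Sum>k\<in>?K. a i k * b j k) =
      (\<Sum>p\<in>?P. signof p * (\<Sum>f\<in>?E. \<Prod>i<N. a i (f i) * b (p i) (f i)))"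
    unfolding det_Leibniz
    by (intro sum.cong refl arg_cong2[where f = "(*)"] prod_sum_PiE) auto
  also have "\<dots> = (\<Sum>p\<in>?P. \<Sum>f\<in>?E. signof p * (\<Prod>i<N. a i (f i) * b (p i) (f i)))"
    by (simp add: sum_distrib_left)
  also have "\<dots> = (\<Sum>f\<in>?E. \<Sum>p\<in>?P. signof p * (\<Prod>i<N. a i (f i) * b (p i) (f i)))"
    by (rule sum.swap)
  also have "\<dots> = (\<Sum>f\<in>?E. ?g f)"
    unfolding det_Leibniz sum_distrib_left prod.distrib by (intro sum.cong refl) (simp add: ac_simps)
  also have "\<dots> = (\<Sum>f | f \<in> ?E \<and> inj_on f {..<N}. ?g f)"
    using fin zero by (intro sum.mono_neutral_right) auto
  also have "\<dots> = (\<Sum>x\<in>Par N M \<times> ?P. ?g (case x of (nu, q) \<Rightarrow> restrict (\<lambda>i. bnum nu (q i)) {..<N}))"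
    by (rule sum.reindex_bij_betw[symmetric]) (rule bij_betw_Par_permutes)
  also have "\<dots> = (\<Sum>nu\<in>Par N M. \<Sum>q\<in>?P. ?g (restrict (\<lambda>i. bnum nu (q i)) {..<N}))"
    unfolding sum.cartesian_product by (intro sum.cong refl) (simp add: case_prod_beta)
  also have "\<dots> = (\<Sum>nu\<in>Par N M. \<Sum>q\<in>?P.
      (\<Prod>i<N. a i (bnum nu (q i))) * (signof q * Det N (\<lambda>i j. b i (bnum nu j))))"
  proof (intro sum.cong refl)
    fix nu q assume "q \<in> ?P"
    then have "Det N (\<lambda>i j. b j (bnum nu (q i))) = signof q * Det N (\<lambda>i j. b j (bnum nu i))"
      by (intro det_mat_permute_rows) simp
    also have "Det N (\<lambda>i j. b j (bnum nu i)) = Det N (\<lambda>i j. b i (bnum nu j))"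
      by (rule det_mat_transpose)
    moreover have "Det N (\<lambda>i j. b j (restrict (\<lambda>i. bnum nu (q i)) {..<N} i)) =
        Det N (\<lambda>i j. b j (bnum nu (q i)))"
      by (rule det_mat_cong) simp
    ultimately show "?g (restrict (\<lambda>i. bnum nu (q i)) {..<N}) =
        (\<Prod>i<N. a i (bnum nu (q i))) * (signof q * Det N (\<lambda>i j. b i (bnum nu j)))"
      by simp
  qed
  also have "\<dots> = (\<Sum>nu\<in>Par N M. Det N (\<lambda>i j. a i (bnum nu j)) *
        Det N (\<lambda>i j. b i (bnum nu j)))"
    unfolding det_Leibniz[of _ "\<lambda>i j. a i (bnum _ j)"] sum_distrib_right
    by (simp add: ac_simps)
  finally show ?thesis
    by (rule sym)
qed

section \<open>Determinants of Jacobi--Trudi type\<close>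

text \<open>Extending by zero to negative exponents allows matrix entries to be indexed by
  differences of beta numbers without case distinctions.\<close>

definition cz :: "'a :: zero fps \<Rightarrow> int \<Rightarrow> 'a" where
  "cz F z = (if 0 \<le> z then fps_nth F (nat z) else 0)"

lemma cz_neg: "z < 0 \<Longrightarrow> cz F z = 0"
  by (simp add: cz_def)

lemma cz_of_nat [simp]: "cz F (int n) = fps_nth F n"
  by (simp add: cz_def)

text \<open>Only \<open>k\<close> between \<open>b\<close> and \<open>a\<close> contribute to the
  convolution, and the hypotheses keep that interval inside the range of summation.\<close>

lemma cz_mult:
  fixes F G :: "'a :: comm_ring_1 fps"
  assumes "lo \<le> b" "a < hi"
  shows "(\<Sum>k\<in>{lo..<hi}. cz F (k - b) * cz G (a - k)) = cz (F * G) (a - b)"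
proof (cases "a < b")
  case True
  then show ?thesis
    by (subst sum.neutral) (auto simp: cz_def)
next
  case False
  have "(\<Sum>k\<in>{lo..<hi}. cz F (k - b) * cz G (a - k)) = (\<Sum>k\<in>{b..a}. cz F (k - b) * cz G (a - k))"
    using assms by (intro sum.mono_neutral_right) (auto simp: cz_def)
  also have "\<dots> = (\<Sum>i\<in>{0..nat (a - b)}. fps_nth F i * fps_nth G (nat (a - b) - i))"
    using False by (intro sum.reindex_bij_witness[where i = "\<lambda>i. b + int i" and j = "\<lambda>k. nat (k - b)"])
      (auto simp: cz_def nat_diff_distrib' intro!: arg_cong2[where f = "(*)"] arg_cong[where f = "fps_nth G"])
  finally show ?thesis
    using False by (simp add: cz_def fps_mult_nth)
qed

text \<open>A skew Jacobi-Trudi determinant with its own series in each row. \<open>eps = 1\<close>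
  belongs to lowering operators, which move the beta numbers of \<open>lam\<close> down to those of
  \<open>nu\<close>, and \<open>eps = - 1\<close> to raising ones.\<close>

definition wdet :: "int \<Rightarrow> (nat \<Rightarrow> 'a :: comm_ring_1 fps) \<Rightarrow> nat \<Rightarrow> part \<Rightarrow> part \<Rightarrow> 'a" where
  "wdet eps F n lam nu = Det n (\<lambda>i j. cz (F i) (eps * (bnum lam i - bnum nu j)))"

definition skewdet :: "int \<Rightarrow> (nat \<Rightarrow> 'a :: comm_ring_1 fps) \<Rightarrow> part \<Rightarrow> part \<Rightarrow> 'a" where
  "skewdet eps F lam nu = wdet eps F (max (plen lam) (plen nu)) lam nu"

text \<open>The beta number with index \<open>n\<close> is \<open>- int (Suc n)\<close> for both
  partitions, below all earlier ones. For \<open>eps = 1\<close> this clears the last row and for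
  \<open>eps = - 1\<close> the last column, up to the corner, which is the constant term 1.\<close>

lemma wdet_Suc:
  assumes "eps = 1 \<or> eps = - 1" "fps_nth (F n) 0 = 1" "plen lam \<le> n" "plen nu \<le> n"
  shows "wdet eps F (Suc n) lam nu = wdet eps F n lam nu"
  using assms(1)
proof
  assume eps: "eps = 1"
  show ?thesis
    unfolding wdet_def eps
  proof (rule det_border_row)
    fix j assume "j < n"
    then have "bnum lam n < bnum nu j"
      using assms(3) by (simp add: bnum_beyond) (simp add: bnum_def)
    then show "cz (F n) (1 * (bnum lam n - bnum nu j)) = 0"
      by (simp add: cz_neg)
  qed (use assms in \<open>simp add: bnum_beyond cz_def\<close>)
next
  assume eps: "eps = - 1"
  show ?thesis
    unfolding wdet_def eps
  proof (rule det_border_col)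
    fix i assume "i < n"
    then have "bnum nu n < bnum lam i"
      using assms(4) by (simp add: bnum_beyond) (simp add: bnum_def)
    then show "cz (F i) (- 1 * (bnum lam i - bnum nu n)) = 0"
      by (simp add: cz_neg)
  qed (use assms in \<open>simp add: bnum_beyond cz_def\<close>)
qed

lemma wdet_eq_skewdet:
  assumes "eps = 1 \<or> eps = - 1" "\<And>i. fps_nth (F i) 0 = 1" "plen lam \<le> n" "plen nu \<le> n"
  shows "wdet eps F n lam nu = skewdet eps F lam nu"
proof -
  have "max (plen lam) (plen nu) \<le> n"
    using assms by simp
  then show ?thesis
    unfolding skewdet_def
    by (induction n rule: dec_induct) (use assms in \<open>simp_all add: wdet_Suc\<close>)
qed

lemma skewdet_hom:
  assumes hom: "comm_ring_hom h" and F: "\<And>i m. fps_nth (F' i) m = h (fps_nth (F i) m)"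
  shows "skewdet eps F' lam nu = h (skewdet eps F lam nu)"
proof -
  interpret comm_ring_hom h
    by (rule hom)
  have cz: "cz (F' i) z = h (cz (F i) z)" for i z
    by (simp add: cz_def F)
  have "map_mat h (mat n n (\<lambda>(i, j). cz (F i) (eps * (bnum lam i - bnum nu j)))) =
      mat n n (\<lambda>(i, j). cz (F' i) (eps * (bnum lam i - bnum nu j)))" for n
    by (rule eq_matI) (auto simp: cz)
  then show ?thesis
    unfolding skewdet_def wdet_def by (simp only: hom_det[symmetric])
qed

text \<open>If the first part of \<open>nu\<close> is too large, the first column vanishes; if
  \<open>nu\<close> has too many parts, the row at its last part does. All entries there have
  negative index.\<close>

lemma skewdet_nonzeroD:
  assumes nz: "skewdet 1 F lam nu \<noteq> 0"
  shows "nu \<in> Par (plen lam) (pt lam 1)"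
proof -
  have 1: "pt nu 1 \<le> pt lam 1"
  proof (rule ccontr)
    assume lt: "\<not> pt nu 1 \<le> pt lam 1"
    then have pos: "0 < plen nu"
      by (metis One_nat_def bot_nat_0.extremum bot_nat_0.not_eq_extremum lessI pt_zero)
    have "skewdet 1 F lam nu = 0"
      unfolding skewdet_def wdet_def
    proof (rule det_zero_col[of 0])
      show "0 < max (plen lam) (plen nu)"
        using pos by simp
      fix i
      have "pt lam (Suc i) \<le> pt lam 1"
        by (rule pt_antimono) auto
      then have "bnum lam i < bnum nu 0"
        using lt by (simp add: bnum_def)
      then show "cz (F i) (1 * (bnum lam i - bnum nu 0)) = 0"
        by (simp add: cz_neg)
    qed
    then show False
      using nz by simp
  qed
  have 2: "plen nu \<le> plen lam"
  proof (rule ccontr)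
    assume lt: "\<not> plen nu \<le> plen lam"
    have "skewdet 1 F lam nu = 0"
      unfolding skewdet_def wdet_def
    proof (rule det_zero_row[of "plen nu - 1"])
      show "plen nu - 1 < max (plen lam) (plen nu)"
        using lt by simp
      fix j assume "j < max (plen lam) (plen nu)"
      then have j: "j < plen nu"
        using lt by simp
      then have "0 < pt nu (Suc j)"
        by (intro pt_pos) auto
      then have "bnum lam (plen nu - 1) < bnum nu j"
        using lt j by (subst bnum_beyond) (auto simp: bnum_def)
      then show "cz (F (plen nu - 1)) (1 * (bnum lam (plen nu - 1) - bnum nu j)) = 0"
        by (simp add: cz_neg)
    qed
    then show False
      using nz by simp
  qed
  show ?thesis
    using 1 2 by (simp add: Par_def)
qed

lemma skewdet_diag:
  assumes "\<And>i. fps_nth (F i) 0 = 1"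
  shows "skewdet (- 1) F nu nu = 1"
  unfolding skewdet_def wdet_def
proof (rule det_unitriangular)
  fix i j :: nat assume "i < j"
  then have "bnum nu j < bnum nu i"
    by (rule bnum_strict)
  then show "cz (F i) (- 1 * (bnum nu i - bnum nu j)) = 0"
    by (simp add: cz_neg)
qed (use assms in \<open>simp add: cz_def\<close>)

text \<open>A nonzero Leibniz term pairs the beta numbers by a permutation \<open>p\<close> with
  \<open>bnum mu i \<le> bnum nu (p i)\<close>. Summing over \<open>i\<close> compares the sizes,
  and equality of the sums forces equal beta sets.\<close>

lemma skewdet_triangular:
  assumes nz: "skewdet (- 1) F mu nu \<noteq> 0"
  shows "psize mu \<le> psize nu" "psize mu = psize nu \<Longrightarrow> mu = nu"
proof -
  define n where "n = max (plen mu) (plen nu)"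
  have "\<exists>p. p permutes {0..<n} \<and>
      signof p * (\<Prod>i<n. cz (F i) (- 1 * (bnum mu i - bnum nu (p i)))) \<noteq> 0"
  proof (rule ccontr)
    assume "\<not> ?thesis"
    then have "skewdet (- 1) F mu nu = 0"
      unfolding skewdet_def wdet_def det_Leibniz n_def[symmetric]
      by (intro sum.neutral) blast
    then show False
      using nz by simp
  qed
  then obtain p where p: "p permutes {0..<n}"
    and "signof p * (\<Prod>i<n. cz (F i) (- 1 * (bnum mu i - bnum nu (p i)))) \<noteq> 0"
    by blast
  then have nz': "(\<Prod>i<n. cz (F i) (- 1 * (bnum mu i - bnum nu (p i)))) \<noteq> 0"
    by (intro notI) simp
  have le: "bnum mu i \<le> bnum nu (p i)" if "i < n" for i
  proof (rule ccontr)
    assume "\<not> bnum mu i \<le> bnum nu (p i)"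
    then have "cz (F i) (- 1 * (bnum mu i - bnum nu (p i))) = 0"
      by (simp add: cz_neg)
    then show False
      using nz' that prod_zero[of "{..<n}" "\<lambda>i. cz (F i) (- 1 * (bnum mu i - bnum nu (p i)))"]
      by auto
  qed
  have len: "plen mu \<le> n" "plen nu \<le> n"
    by (simp_all add: n_def)
  have sum: "int (psize lam) = (\<Sum>i<n. bnum lam i) + (\<Sum>i<n. int (Suc i))" if "plen lam \<le> n" for lam
    unfolding sum.distrib[symmetric] by (simp add: psize_eq[OF that] bnum_def)
  have perm: "(\<Sum>i<n. bnum nu (p i)) = (\<Sum>i<n. bnum nu i)"
    using sum.permute[OF p, of "bnum nu"] by (simp add: o_def atLeast0LessThan)
  have *: "(\<Sum>i<n. bnum mu i) \<le> (\<Sum>i<n. bnum nu (p i))"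
    using le by (intro sum_mono) auto
  then show "psize mu \<le> psize nu"
    using sum[OF len(1)] sum[OF len(2)] perm by simp
  assume "psize mu = psize nu"
  then have eq: "(\<Sum>i<n. bnum mu i) = (\<Sum>i<n. bnum nu (p i))"
    using sum[OF len(1)] sum[OF len(2)] perm by simp
  have "bnum mu i = bnum nu (p i)" if "i < n" for i
  proof (rule ccontr)
    assume "bnum mu i \<noteq> bnum nu (p i)"
    then have "(\<Sum>i<n. bnum mu i) < (\<Sum>i<n. bnum nu (p i))"
      using le that by (intro sum_strict_mono_ex1) (auto intro!: bexI[of _ i] simp: order.strict_iff_order)
    then show False
      using eq by simp
  qed
  then have "bnum mu ` {..<n} = bnum nu ` p ` {..<n}"
    by (force simp: image_image)
  also have "p ` {..<n} = {..<n}"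
    by (rule permutes_image_lessThan[OF p])
  finally show "mu = nu"
    using len by (rule bnum_image_eqD)
qed

section \<open>The series \<open>1 + b t\<close>, its inverse, and the two transition matrices built
  from their powers\<close>

definition lin_fps :: "'a :: comm_ring_1 \<Rightarrow> 'a fps" where
  "lin_fps b = 1 + fps_const b * fps_X"

definition geo_fps :: "'a :: comm_ring_1 \<Rightarrow> 'a fps" where
  "geo_fps b = Abs_fps (\<lambda>n. (- b) ^ n)"

lemma lin_geo_fps: "lin_fps b * geo_fps b = 1"
proof (rule fps_ext)
  fix n show "fps_nth (lin_fps b * geo_fps b) n = fps_nth 1 n"
    by (cases n) (simp_all add: lin_fps_def geo_fps_def algebra_simps mult.assoc)
qed

lemma lin_fps_power_nth: "fps_nth (lin_fps b ^ m) l = of_nat (m choose l) * b ^ l"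
proof (induction m arbitrary: l)
  case 0
  then show ?case
    by (cases l) auto
next
  case (Suc m)
  then show ?case
    by (cases l) (simp_all add: lin_fps_def algebra_simps mult.assoc)
qed

lemma fps_nth_0_power_one: "fps_nth (F :: 'a :: comm_ring_1 fps) 0 = 1 \<Longrightarrow> fps_nth (F ^ i) 0 = 1"
  by (simp add: fps_nth_power_0)

lemma lin_fps_nth_0 [simp]: "fps_nth (lin_fps b ^ i) 0 = 1"
  by (simp add: lin_fps_power_nth)

lemma geo_fps_nth_0 [simp]: "fps_nth (geo_fps b ^ i) 0 = 1"
  by (rule fps_nth_0_power_one) (simp add: geo_fps_def)

lemma lin_geo_power:
  "lin_fps b ^ i * geo_fps b ^ j = (if i \<le> j then geo_fps b ^ (j - i) else lin_fps b ^ (i - j))"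
proof -
  have 1: "lin_fps b ^ k * geo_fps b ^ k = 1" for k
    by (simp add: lin_geo_fps flip: power_mult_distrib)
  show ?thesis
  proof (cases "i \<le> j")
    case True
    then have "geo_fps b ^ j = geo_fps b ^ i * geo_fps b ^ (j - i)"
      by (simp flip: power_add)
    then show ?thesis
      using True 1[of i] by (simp flip: mult.assoc)
  next
    case False
    then have "lin_fps b ^ i = lin_fps b ^ (i - j) * lin_fps b ^ j"
      by (simp flip: power_add)
    then show ?thesis
      using False 1[of j] by (simp add: mult.assoc)
  qed
qed

text \<open>With \<open>b\<close> in place of \<open>\<beta>\<close>, these will be the coefficients of \<open>s\<^sub>\<nu>\<close> in \<open>G\<^sub>\<mu>\<close> and in \<open>g\<^sub>\<lambda>\<close>.\<close>

definition gco :: "'a :: comm_ring_1 \<Rightarrow> part \<Rightarrow> part \<Rightarrow> 'a" where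
  "gco b = skewdet (- 1) (\<lambda>i. lin_fps b ^ i)"

definition dco :: "'a :: comm_ring_1 \<Rightarrow> part \<Rightarrow> part \<Rightarrow> 'a" where
  "dco b = skewdet 1 (\<lambda>i. geo_fps b ^ i)"

text \<open>Row \<open>i\<close> consists of coefficients of a polynomial of degree at most
  \<open>i\<close>, and a first part of \<open>nu\<close> that is too large pushes all indices in
  the first column beyond that. The length of \<open>nu\<close> has in general no such bound, which
  is why G lives in a completion.\<close>

lemma gco_nonzeroD:
  assumes "gco b mu nu \<noteq> 0"
  shows "pt nu 1 \<le> pt mu 1"
proof (rule ccontr)
  assume lt: "\<not> pt nu 1 \<le> pt mu 1"
  then have pos: "0 < plen nu"
    by (metis One_nat_def bot_nat_0.extremum bot_nat_0.not_eq_extremum lessI pt_zero)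
  have "gco b mu nu = 0"
    unfolding gco_def skewdet_def wdet_def
  proof (rule det_zero_col[of 0])
    show "0 < max (plen mu) (plen nu)"
      using pos by simp
    fix i
    have "pt mu (Suc i) \<le> pt mu 1"
      by (rule pt_antimono) auto
    then have "int i < bnum nu 0 - bnum mu i"
      using lt by (simp add: bnum_def)
    then have "i < nat (bnum nu 0 - bnum mu i)"
      by simp
    then show "cz (lin_fps b ^ i) (- 1 * (bnum mu i - bnum nu 0)) = 0"
      by (simp add: cz_def lin_fps_power_nth binomial_eq_0)
  qed
  then show False
    using assms by simp
qed

text \<open>For \<open>lam = mu\<close> the matrix is unitriangular. Otherwise take an index
  \<open>p\<close> where the parts differ. If \<open>lam\<close> is smaller there, entries with
  \<open>i \<le> p \<le> j\<close> have negative index; if it is larger, entries with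
  \<open>j \<le> p \<le> i\<close> lie beyond the degree of \<open>lin_fps b ^ (i - j)\<close>.
  Either zero block kills the determinant.\<close>

lemma det_lin_geo:
  assumes len: "plen lam \<le> N" "plen mu \<le> N"
  shows "Det N (\<lambda>i j. cz (lin_fps b ^ i * geo_fps b ^ j) (bnum lam j - bnum mu i)) =
    (if lam = mu then 1 else 0)"
proof (cases "lam = mu")
  case True
  have "Det N (\<lambda>i j. cz (lin_fps b ^ i * geo_fps b ^ j) (bnum lam j - bnum mu i)) = 1"
  proof (rule det_unitriangular)
    fix i j :: nat assume "i < j"
    then show "cz (lin_fps b ^ i * geo_fps b ^ j) (bnum lam j - bnum mu i) = 0"
      using True bnum_strict[of i j mu] by (simp add: cz_neg)
  qed (simp add: True lin_geo_power cz_def)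
  then show ?thesis
    using True by simp
next
  case False
  then obtain q where q: "1 \<le> q" "pt lam q \<noteq> pt mu q"
    using part_eqI by blast
  define p where "p = q - 1"
  have p: "p < N" "pt lam (Suc p) \<noteq> pt mu (Suc p)"
    using q len by (auto simp: p_def pt_def split: if_splits)
  show ?thesis
  proof (cases "pt lam (Suc p) < pt mu (Suc p)")
    case True
    have "Det N (\<lambda>i j. cz (lin_fps b ^ i * geo_fps b ^ j) (bnum lam j - bnum mu i)) = 0"
    proof (rule det_zero_block'[OF p(1)])
      fix i j assume ij: "i \<le> p" "p \<le> j"
      have "pt lam (Suc j) \<le> pt lam (Suc p)" "pt mu (Suc p) \<le> pt mu (Suc i)"
        using ij by (auto intro: pt_antimono)
      then show "cz (lin_fps b ^ i * geo_fps b ^ j) (bnum lam j - bnum mu i) = 0"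
        using True ij by (intro cz_neg) (simp add: bnum_def)
    qed
    then show ?thesis
      using False by simp
  next
    case lt: False
    have "Det N (\<lambda>i j. cz (lin_fps b ^ i * geo_fps b ^ j) (bnum lam j - bnum mu i)) = 0"
    proof (rule det_zero_block[OF p(1)])
      fix i j assume ij: "p \<le> i" "j \<le> p"
      have "pt lam (Suc p) \<le> pt lam (Suc j)" "pt mu (Suc i) \<le> pt mu (Suc p)"
        using ij by (auto intro: pt_antimono)
      then have "int (i - j) < bnum lam j - bnum mu i"
        using lt p(2) ij by (simp add: bnum_def)
      then have "i - j < nat (bnum lam j - bnum mu i)"
        by linarith
      moreover have "lin_fps b ^ i * geo_fps b ^ j = lin_fps b ^ (i - j)"
        using ij by (auto simp: lin_geo_power)
      ultimately show "cz (lin_fps b ^ i * geo_fps b ^ j) (bnum lam j - bnum mu i) = 0"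
        by (simp add: cz_def lin_fps_power_nth binomial_eq_0)
    qed
    then show ?thesis
      using False by simp
  qed
qed

text \<open>Cauchy-Binet turns the sum into one determinant whose entries are coefficients of
  \<open>(1 + b t) ^ i\<close> times the inverse of \<open>(1 + b t) ^ j\<close>.\<close>

lemma gco_dco:
  fixes b :: "'a :: comm_ring_1"
  assumes "finite S" "Par (plen lam) (pt lam 1) \<subseteq> S"
  shows "(\<Sum>nu\<in>S. gco b mu nu * dco b lam nu) = (if lam = mu then 1 else 0)"
proof -
  define N where "N = max (plen lam) (plen mu)"
  define M where "M = pt lam 1"
  have len: "plen lam \<le> N" "plen mu \<le> N"
    by (auto simp: N_def)
  have d0: "dco b lam nu = 0" if "nu \<notin> Par (plen lam) (pt lam 1)" for nu
    using skewdet_nonzeroD that unfolding dco_def by blast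
  have sub: "Par (plen lam) (pt lam 1) \<subseteq> Par N M"
    using len by (auto simp: Par_def M_def)
  have "(\<Sum>nu\<in>S. gco b mu nu * dco b lam nu) =
      (\<Sum>nu\<in>Par (plen lam) (pt lam 1). gco b mu nu * dco b lam nu)"
    using assms d0 by (intro sum.mono_neutral_right) auto
  also have "\<dots> = (\<Sum>nu\<in>Par N M. gco b mu nu * dco b lam nu)"
    using sub d0 by (intro sum.mono_neutral_left finite_Par) auto
  also have "\<dots> = (\<Sum>nu\<in>Par N M. Det N (\<lambda>i j. cz (lin_fps b ^ i) (bnum nu j - bnum mu i)) *
      Det N (\<lambda>i j. cz (geo_fps b ^ i) (bnum lam i - bnum nu j)))"
  proof (rule sum.cong[OF refl])
    fix nu assume "nu \<in> Par N M"
    then have nu: "plen nu \<le> N"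
      by (simp add: Par_def)
    have "gco b mu nu = wdet (- 1) (\<lambda>i. lin_fps b ^ i) N mu nu"
      unfolding gco_def using nu len by (subst wdet_eq_skewdet) auto
    moreover have "dco b lam nu = wdet 1 (\<lambda>i. geo_fps b ^ i) N lam nu"
      unfolding dco_def using nu len by (subst wdet_eq_skewdet) auto
    ultimately show "gco b mu nu * dco b lam nu =
      Det N (\<lambda>i j. cz (lin_fps b ^ i) (bnum nu j - bnum mu i)) *
      Det N (\<lambda>i j. cz (geo_fps b ^ i) (bnum lam i - bnum nu j))"
      by (simp add: wdet_def)
  qed
  also have "\<dots> = Det N (\<lambda>i j. \<Sum>k\<in>{- int N..<int M}.
      cz (lin_fps b ^ i) (k - bnum mu i) * cz (geo_fps b ^ j) (bnum lam j - k))"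
    by (rule cauchy_binet)
  also have "\<dots> = Det N (\<lambda>i j. cz (lin_fps b ^ i * geo_fps b ^ j) (bnum lam j - bnum mu i))"
    by (intro det_mat_cong cz_mult bnum_ge bnum_less) (auto simp: M_def)
  also have "\<dots> = (if lam = mu then 1 else 0)"
    by (rule det_lin_geo[OF len])
  finally show ?thesis .
qed

text \<open>Test against the row of a partition \<open>rho\<close> of maximal size in the support of
  \<open>x\<close>: by triangularity only the diagonal term \<open>x rho\<close> survives.\<close>

lemma gco_injective:
  fixes b :: "'a :: comm_ring_1"
  assumes S: "finite S" "\<And>nu. nu \<notin> S \<Longrightarrow> x nu = 0"
    and zero: "\<And>mu. (\<Sum>nu\<in>S. gco b mu nu * x nu) = 0"
  shows "x nu = 0"
proof (rule ccontr)
  assume "x nu \<noteq> 0"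
  define T where "T = {nu. x nu \<noteq> 0}"
  have T: "finite T" "nu \<in> T"
    using S \<open>x nu \<noteq> 0\<close> finite_subset[of T S] by (auto simp: T_def)
  have "Max (psize ` T) \<in> psize ` T"
    using T by (intro Max_in) auto
  then obtain rho where rho: "rho \<in> T" "psize rho = Max (psize ` T)"
    by auto
  have max: "psize nu \<le> psize rho" if "nu \<in> T" for nu
    using T that rho(2) by simp
  have "(\<Sum>nu\<in>S. gco b rho nu * x nu) = (\<Sum>nu\<in>{rho}. gco b rho nu * x nu)"
  proof (rule sum.mono_neutral_right)
    show "\<forall>nu\<in>S - {rho}. gco b rho nu * x nu = 0"
    proof (rule ballI, rule ccontr)
      fix nu assume nu: "nu \<in> S - {rho}" "gco b rho nu * x nu \<noteq> 0"
      then have "skewdet (- 1) (\<lambda>i. lin_fps b ^ i) rho nu \<noteq> 0" "nu \<in> T"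
        by (auto simp: T_def gco_def)
      from skewdet_triangular[OF this(1)] max[OF this(2)] show False
        using nu by auto
    qed
  qed (use S rho in \<open>auto simp: T_def\<close>)
  also have "\<dots> = x rho"
    by (simp add: gco_def skewdet_diag)
  finally show False
    using zero rho(1) by (simp add: T_def)
qed

lemma gco_finite: "finite {mu. gco b mu nu \<noteq> 0}"
  by (rule finite_subset[OF _ finite_psize_le[of "psize nu"]])
    (auto simp: gco_def dest: skewdet_triangular)

text \<open>For infinite matrices a one-sided inverse need not be two-sided. Here the defect
  \<open>x\<close> of the reversed product has finite support and is annihilated by
  \<open>gco\<close> thanks to \<open>gco_dco\<close>, so injectivity applies.\<close>

lemma gco_dco':
  fixes b :: "'a :: comm_ring_1"
  assumes T: "finite T" "{mu. gco b mu nu \<noteq> 0} \<subseteq> T"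
  shows "(\<Sum>mu\<in>T. gco b mu nu * dco b mu kap) = (if nu = kap then 1 else 0)"
proof -
  define S where "S = insert nu (\<Union>mu\<in>T. Par (plen mu) (pt mu 1))"
  define x where "x kap = (\<Sum>mu\<in>T. gco b mu nu * dco b mu kap) - (if nu = kap then 1 else 0)" for kap
  have S: "finite S" "nu \<in> S"
    using T by (auto simp: S_def finite_Par)
  have d0: "dco b mu kap = 0" if "kap \<notin> S" "mu \<in> T" for mu kap
    using skewdet_nonzeroD that unfolding dco_def S_def by blast
  have "x kap = 0"
  proof (rule gco_injective[OF S(1)])
    show "x kap = 0" if "kap \<notin> S" for kap
      using that d0 S(2) by (auto simp: x_def)
    fix rho
    have "(\<Sum>kap\<in>S. gco b rho kap * x kap) =
        (\<Sum>kap\<in>S. \<Sum>mu\<in>T. gco b mu nu * (gco b rho kap * dco b mu kap)) -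
        (\<Sum>kap\<in>S. gco b rho kap * (if nu = kap then 1 else 0))"
      by (simp add: x_def right_diff_distrib sum_subtractf sum_distrib_left ac_simps)
    also have "(\<Sum>kap\<in>S. gco b rho kap * (if nu = kap then 1 else 0)) = gco b rho nu"
      using S by (simp add: if_distrib cong: if_cong)
    also have "(\<Sum>kap\<in>S. \<Sum>mu\<in>T. gco b mu nu * (gco b rho kap * dco b mu kap)) =
        (\<Sum>mu\<in>T. gco b mu nu * (\<Sum>kap\<in>S. gco b rho kap * dco b mu kap))"
      by (subst sum.swap) (simp add: sum_distrib_left)
    also have "\<dots> = (\<Sum>mu\<in>T. gco b mu nu * (if mu = rho then 1 else 0))"
      by (intro sum.cong refl arg_cong2[where f = "(*)"] gco_dco S) (auto simp: S_def)
    also have "\<dots> = gco b rho nu"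
      using T by (auto simp: if_distrib cong: if_cong)
    finally show "(\<Sum>kap\<in>S. gco b rho kap * x kap) = 0"
      by simp
  qed
  then show ?thesis
    by (simp add: x_def)
qed

section \<open>Power series in infinitely many variables\<close>

abbreviation "lookup \<equiv> Poly_Mapping.lookup"
abbreviation "keys \<equiv> Poly_Mapping.keys"
abbreviation "single \<equiv> Poly_Mapping.single"
abbreviation "map_key \<equiv> Poly_Mapping.map_key"

lemma cf_Abs [simp]: "cf (Abs_mpser f) m = f m"
  by (simp add: Abs_mpser_inverse)

lemmas cf_simps [simp] = zero_mpser.rep_eq one_mpser.rep_eq plus_mpser.rep_eq uminus_mpser.rep_eq
  minus_mpser.rep_eq cst.rep_eq var.rep_eq restrict_vars.rep_eq

lemma cf_sum [simp]: "cf (sum f A) m = (\<Sum>a\<in>A. cf (f a) m)"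
  by (induction A rule: infinite_finite_induct) auto

lemma cf_cst_mult [simp]: "cf (cst c * f) m = c * cf f m"
proof -
  have "cf (cst c * f) m = (\<Sum>(a, b)\<in>{(0, m)}. cf (cst c) a * cf f b)"
    unfolding times_mpser.rep_eq
    by (rule sum.mono_neutral_right) (auto simp: finite_monom_splits split: if_splits)
  then show ?thesis
    by simp
qed

lemma cst_hom: "comm_ring_hom (cst :: 'a :: comm_ring_1 \<Rightarrow> _)"
proof
  show "cst (x * y) = cst x * cst y" for x y :: 'a
    by (rule mpser_eqI) simp
qed (auto intro!: mpser_eqI)

interpretation cst: comm_ring_hom "cst :: 'a :: comm_ring_1 \<Rightarrow> _"
  by (rule cst_hom)

subsection \<open>Substitutions of variables\<close>

text \<open>Substitutions of variables by variables or 0, described on coefficients, so that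
  multiplicativity is proved once for restriction, permutations and the two alphabets.\<close>

definition pull :: "monom set \<Rightarrow> (monom \<Rightarrow> monom) \<Rightarrow> 'a :: comm_ring_1 mpser \<Rightarrow> 'a mpser" where
  "pull A e f = Abs_mpser (\<lambda>m. if m \<in> A then cf f (e m) else 0)"

text \<open>The splittings of \<open>m\<close> and of \<open>e m\<close> correspond:
  \<open>split\<close> lifts them and injectivity makes the lift unique. A monomial outside
  \<open>A\<close> always has a factor outside \<open>A\<close>, so the product vanishes there as
  well.\<close>

lemma pull_hom:
  fixes e :: "monom \<Rightarrow> monom"
  assumes A: "\<And>a b. a + b \<in> A \<longleftrightarrow> a \<in> A \<and> b \<in> A" "0 \<in> A"
    and e: "\<And>a b. e (a + b) = e a + e b" "inj_on e A"
    and split: "\<And>m p q. m \<in> A \<Longrightarrow> p + q = e m \<Longrightarrow> \<exists>a b. a + b = m \<and> e a = p \<and> e b = q"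
  shows "comm_ring_hom (pull A e :: 'a :: comm_ring_1 mpser \<Rightarrow> 'a mpser)"
proof
  have e0: "e 0 = 0"
    using e(1)[of 0 0] by simp
  show "pull A e (1 :: 'a mpser) = 1"
  proof (rule mpser_eqI)
    fix m
    have "e m = 0 \<longleftrightarrow> m = 0" if "m \<in> A"
      using inj_onD[OF e(2), of m 0] that A(2) e0 by auto
    then show "cf (pull A e (1 :: 'a mpser)) m = cf 1 m"
      using A(2) by (auto simp: pull_def)
  qed
  fix f g :: "'a mpser"
  show "pull A e (f + g) = pull A e f + pull A e g"
    by (rule mpser_eqI) (simp add: pull_def)
  show "pull A e (f * g) = pull A e f * pull A e g"
  proof (rule mpser_eqI)
    fix m
    show "cf (pull A e (f * g)) m = cf (pull A e f * pull A e g) m"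
    proof (cases "m \<in> A")
      case True
      then have mem: "a \<in> A \<and> b \<in> A" if "a + b = m" for a b
        using A(1) that by blast
      have "cf (pull A e f * pull A e g) m =
          (\<Sum>(a, b)\<in>{(a, b). a + b = m}. cf f (e a) * cf g (e b))"
        unfolding times_mpser.rep_eq
      proof (rule sum.cong[OF refl])
        fix x assume "x \<in> {(a, b). a + b = m}"
        then show "(case x of (a, b) \<Rightarrow> cf (pull A e f) a * cf (pull A e g) b) =
            (case x of (a, b) \<Rightarrow> cf f (e a) * cf g (e b))"
          using mem[of "fst x" "snd x"] by (cases x) (simp add: pull_def)
      qed
      also have "\<dots> = (\<Sum>(p, q)\<in>(\<lambda>(a, b). (e a, e b)) ` {(a, b). a + b = m}. cf f p * cf g q)"
      proof (subst sum.reindex)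
        show "inj_on (\<lambda>(a, b). (e a, e b)) {(a, b). a + b = m}"
          using mem e(2) by (auto intro!: inj_onI dest: inj_onD)
      qed (auto intro!: sum.cong)
      also have "(\<lambda>(a, b). (e a, e b)) ` {(a, b). a + b = m} = {(p, q). p + q = e m}"
      proof (intro equalityI subsetI)
        fix x assume "x \<in> {(p, q). p + q = e m}"
        then obtain p q where x: "x = (p, q)" "p + q = e m"
          by auto
        from split[OF True x(2)] obtain a b where "a + b = m" "e a = p" "e b = q"
          by blast
        then show "x \<in> (\<lambda>(a, b). (e a, e b)) ` {(a, b). a + b = m}"
          using x by force
      qed (auto simp: e(1))
      finally show ?thesis
        using True by (simp add: pull_def times_mpser.rep_eq)
    next
      case False
      then have "cf (pull A e f) a * cf (pull A e g) b = 0" if "a + b = m" for a b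
        using A(1)[of a b] that by (auto simp: pull_def)
      then have "cf (pull A e f * pull A e g) m = 0"
        unfolding times_mpser.rep_eq by (intro sum.neutral) auto
      then show ?thesis
        using False by (simp add: pull_def)
    qed
  qed
qed (rule mpser_eqI, simp add: pull_def)

lemma keys_add_nat: "keys (a + b :: monom) = keys a \<union> keys b"
  by (auto simp: in_keys_iff lookup_add)

lemma restrict_vars_hom: "comm_ring_hom (restrict_vars n :: 'a :: comm_ring_1 mpser \<Rightarrow> _)"
proof -
  have "restrict_vars n = (pull {m. keys m \<subseteq> {..<n}} (\<lambda>m. m) :: 'a mpser \<Rightarrow> _)"
    by (rule ext, rule mpser_eqI) (simp add: pull_def)
  moreover have "comm_ring_hom (pull {m. keys m \<subseteq> {..<n}} (\<lambda>m. m) :: 'a mpser \<Rightarrow> _)"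
    by (rule pull_hom) (auto simp: keys_add_nat inj_on_def)
  ultimately show ?thesis
    by simp
qed

interpretation restrict_vars: comm_ring_hom "restrict_vars n :: 'a :: comm_ring_1 mpser \<Rightarrow> _"
  by (rule restrict_vars_hom)

lemma restrict_vars_cst [simp]: "restrict_vars n (cst c) = cst c"
  by (rule mpser_eqI) simp

definition perm :: "(nat \<Rightarrow> nat) \<Rightarrow> 'a :: comm_ring_1 mpser \<Rightarrow> 'a mpser" where
  "perm p = pull UNIV (map_key p)"

lemma cf_perm [simp]: "cf (perm p f) m = cf f (map_key p m)"
  by (simp add: perm_def pull_def)

lemma lookup_map_key: "inj p \<Longrightarrow> lookup (map_key p m) k = lookup m (p k)"
  by (simp add: map_key.rep_eq)

lemma map_key_inv:
  assumes "bij p"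
  shows "map_key p (map_key (Hilbert_Choice.inv p) m) = m"
    and "map_key (Hilbert_Choice.inv p) (map_key p m) = m"
  using assms
  by (auto intro!: poly_mapping_eqI simp: lookup_map_key bij_is_inj bij_imp_bij_inv
      inv_f_f surj_f_inv_f bij_is_surj)

lemma single_add_diff:
  "k \<le> lookup m i \<Longrightarrow> single i k + (m - single i k) = (m :: monom)"
  by (intro poly_mapping_eqI) (auto simp: lookup_add lookup_minus lookup_single when_def)

lemma perm_hom:
  assumes "bij p"
  shows "comm_ring_hom (perm p :: 'a :: comm_ring_1 mpser \<Rightarrow> _)"
  unfolding perm_def
proof (rule pull_hom)
  show "inj_on (map_key p :: monom \<Rightarrow> monom) UNIV"
    by (rule inj_on_inverseI[where g = "map_key (Hilbert_Choice.inv p)"]) (simp add: map_key_inv assms)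
  show plus: "map_key p (a + b) = map_key p a + map_key p b"
    for a b :: monom
    using assms by (simp add: map_key_plus bij_is_inj)
  fix m a b :: monom assume "a + b = map_key p m"
  then have "map_key (Hilbert_Choice.inv p) a + map_key (Hilbert_Choice.inv p) b = m"
    using assms by (metis bij_imp_bij_inv bij_is_inj map_key_inv(2) map_key_plus)
  then show "\<exists>a' b'. a' + b' = m \<and> map_key p a' = a \<and> map_key p b' = b"
    using map_key_inv(1)[OF assms] by blast
qed auto

lemma perm_var:
  assumes "bij p"
  shows "perm p (var i) = var (p i)"
proof (rule mpser_eqI)
  fix m
  have "map_key p m = single i 1 \<longleftrightarrow> m = single (p i) 1"
    for m :: monom
  proof
    assume "map_key p m = single i 1"
    then have "m = map_key (Hilbert_Choice.inv p) (single i 1)"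
      using map_key_inv(2)[OF assms] by metis
    also have "i = Hilbert_Choice.inv p (p i)"
      using assms by (simp add: bij_is_inj inv_f_f)
    also have "map_key (Hilbert_Choice.inv p) (single (Hilbert_Choice.inv p (p i)) 1) =
        (single (p i) 1 :: monom)"
      using assms by (intro map_key_single) (simp add: bij_imp_bij_inv bij_is_inj)
    finally show "m = single (p i) 1" .
  next
    assume "m = single (p i) 1"
    then show "map_key p m = single i 1"
      using assms by (simp add: bij_is_inj)
  qed
  then show "cf (perm p (var i)) m = cf (var (p i)) m"
    by simp
qed

text \<open>The substitutions \<open>f(x)\<close> and \<open>f(y)\<close> of the two alphabets into the alternating list of variables
  used for coproducts.\<close>

definition evm :: "monom \<Rightarrow> monom" where
  "evm = map_key (\<lambda>i. 2 * i)"

definition odm :: "monom \<Rightarrow> monom" where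
  "odm = map_key (\<lambda>i. 2 * i + 1)"

definition emb_x :: "'a :: comm_ring_1 mpser \<Rightarrow> 'a mpser" where
  "emb_x = pull {m. odm m = 0} evm"

definition emb_y :: "'a :: comm_ring_1 mpser \<Rightarrow> 'a mpser" where
  "emb_y = pull {m. evm m = 0} odm"

lemma lookup_evm: "lookup (evm m) k = lookup m (2 * k)"
  unfolding evm_def by (rule lookup_map_key) (auto intro: injI)

lemma lookup_odm: "lookup (odm m) k = lookup m (2 * k + 1)"
  unfolding odm_def by (rule lookup_map_key) (auto intro: injI)

lemma evm_interleave [simp]: "evm (interleave a b) = a"
  by (rule poly_mapping_eqI) (simp add: lookup_evm interleave.rep_eq)

lemma odm_interleave [simp]: "odm (interleave a b) = b"
  by (rule poly_mapping_eqI) (simp add: lookup_odm interleave.rep_eq)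

lemma interleave_evm_odm: "interleave (evm m) (odm m) = m"
  by (rule poly_mapping_eqI) (auto simp: lookup_evm lookup_odm interleave.rep_eq elim!: evenE oddE)

lemma interleave_add: "interleave a b + interleave a' b' = interleave (a + a') (b + b')"
  by (rule poly_mapping_eqI) (simp add: lookup_add interleave.rep_eq)

lemma evm_add: "evm (a + b) = evm a + evm b"
  by (rule poly_mapping_eqI) (simp add: lookup_add lookup_evm)

lemma odm_add: "odm (a + b) = odm a + odm b"
  by (rule poly_mapping_eqI) (simp add: lookup_add lookup_odm)

lemma monom_add_eq_0: "(a :: monom) + b = 0 \<longleftrightarrow> a = 0 \<and> b = 0"
  by (metis add_eq_0_iff_both_eq_0 lookup_add lookup_zero poly_mapping_eqI add.right_neutral)

lemma evm_0 [simp]: "evm 0 = 0" and odm_0 [simp]: "odm 0 = 0"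
  by (auto intro!: poly_mapping_eqI simp: lookup_evm lookup_odm)

lemma emb_x_hom: "comm_ring_hom (emb_x :: 'a :: comm_ring_1 mpser \<Rightarrow> _)"
  unfolding emb_x_def
proof (rule pull_hom)
  show "inj_on evm {m. odm m = 0}"
    by (rule inj_onI) (metis interleave_evm_odm mem_Collect_eq)
  fix m p q :: monom assume "m \<in> {m. odm m = 0}" "p + q = evm m"
  then have "interleave p 0 + interleave q 0 = m"
    using interleave_evm_odm[of m] by (simp add: interleave_add)
  then show "\<exists>a b. a + b = m \<and> evm a = p \<and> evm b = q"
    by (metis evm_interleave)
qed (auto simp: odm_add evm_add monom_add_eq_0)

lemma emb_y_hom: "comm_ring_hom (emb_y :: 'a :: comm_ring_1 mpser \<Rightarrow> _)"
  unfolding emb_y_def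
proof (rule pull_hom)
  show "inj_on odm {m. evm m = 0}"
    by (rule inj_onI) (metis interleave_evm_odm mem_Collect_eq)
  fix m p q :: monom assume "m \<in> {m. evm m = 0}" "p + q = odm m"
  then have "interleave 0 p + interleave 0 q = m"
    using interleave_evm_odm[of m] by (simp add: interleave_add)
  then show "\<exists>a b. a + b = m \<and> odm a = p \<and> odm b = q"
    by (metis odm_interleave)
qed (auto simp: odm_add evm_add monom_add_eq_0)

interpretation emb_x: comm_ring_hom "emb_x :: 'a :: comm_ring_1 mpser \<Rightarrow> _"
  by (rule emb_x_hom)

interpretation emb_y: comm_ring_hom "emb_y :: 'a :: comm_ring_1 mpser \<Rightarrow> _"
  by (rule emb_y_hom)

lemma cst_emb_y: "emb_y (cst c) = cst c"
proof (rule mpser_eqI)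
  fix m :: monom
  have "m = 0 \<longleftrightarrow> evm m = 0 \<and> odm m = 0"
    by (metis interleave_evm_odm evm_0 odm_0)
  then show "cf (emb_y (cst c)) m = cf (cst c) m"
    by (auto simp: emb_y_def pull_def)
qed

text \<open>Monomials of \<open>emb_x f\<close> use only variables of even index and those of
  \<open>emb_y g\<close> only variables of odd index, so a single splitting of \<open>m\<close>
  contributes. This identifies products over the two alphabets with tensors.\<close>

lemma cf_emb_mult: "cf (emb_x f * emb_y g) m = cf f (evm m) * cf g (odm m)"
proof -
  have "cf (emb_x f * emb_y g) m =
      (\<Sum>(a, b)\<in>{(interleave (evm m) 0, interleave 0 (odm m))}. cf (emb_x f) a * cf (emb_y g) b)"
    unfolding times_mpser.rep_eq
  proof (rule sum.mono_neutral_right)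
    show "finite {(a, b). a + b = m}"
      by (rule finite_monom_splits)
    show "{(interleave (evm m) 0, interleave 0 (odm m))} \<subseteq> {(a, b). a + b = m}"
      by (simp add: interleave_add interleave_evm_odm)
    show "\<forall>x\<in>{(a, b). a + b = m} - {(interleave (evm m) 0, interleave 0 (odm m))}.
        (case x of (a, b) \<Rightarrow> cf (emb_x f) a * cf (emb_y g) b) = 0"
    proof
      fix x assume "x \<in> {(a, b). a + b = m} - {(interleave (evm m) 0, interleave 0 (odm m))}"
      then obtain a b where x: "x = (a, b)" and m: "m = a + b"
        and ne: "\<not> (a = interleave (evm m) 0 \<and> b = interleave 0 (odm m))"
        by auto
      have "\<not> (odm a = 0 \<and> evm b = 0)"
      proof
        assume *: "odm a = 0 \<and> evm b = 0"
        then have "a = interleave (evm m) 0" "b = interleave 0 (odm m)"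
          using interleave_evm_odm[of a] interleave_evm_odm[of b] by (simp_all add: m evm_add odm_add)
        then show False
          using ne by blast
      qed
      then show "(case x of (a, b) \<Rightarrow> cf (emb_x f) a * cf (emb_y g) b) = 0"
        by (auto simp: x emb_x_def emb_y_def pull_def)
    qed
  qed
  then show ?thesis
    by (simp add: emb_x_def emb_y_def pull_def)
qed

subsection \<open>Degrees\<close>

lemma mdeg_eq:
  assumes "finite S" "keys m \<subseteq> S"
  shows "mdeg m = (\<Sum>i\<in>S. lookup m i)"
  unfolding mdeg_def using assms by (intro sum.mono_neutral_left) (auto simp: in_keys_iff)

lemma mdeg_0 [simp]: "mdeg 0 = 0"
  by (simp add: mdeg_def)

lemma mdeg_single [simp]: "mdeg (single i k) = k"
  by (simp add: mdeg_eq[of "{i}"])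

lemma mdeg_add: "mdeg (a + b) = mdeg a + mdeg b"
proof -
  let ?S = "keys a \<union> keys b"
  have "mdeg a = (\<Sum>i\<in>?S. lookup a i)" "mdeg b = (\<Sum>i\<in>?S. lookup b i)"
    "mdeg (a + b) = (\<Sum>i\<in>?S. lookup (a + b) i)"
    by (auto intro!: mdeg_eq simp: keys_add_nat)
  then show ?thesis
    by (simp add: lookup_add sum.distrib)
qed

lemma mdeg_sum: "mdeg (\<Sum>i\<in>A. f i) = (\<Sum>i\<in>A. mdeg (f i))"
  by (induction A rule: infinite_finite_induct) (auto simp: mdeg_add)

lemma mdeg_eq_0_iff: "mdeg m = 0 \<longleftrightarrow> m = 0"
  by (auto simp: mdeg_def in_keys_iff intro: poly_mapping_eqI)

lemma mdeg_map_key: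
  assumes "bij p"
  shows "mdeg (map_key p m) = mdeg m"
proof -
  have "bij_betw p (p -` keys m) (keys m)"
    using assms by (metis bij_betw_def bij_is_inj bij_is_surj inj_on_subset subset_UNIV surj_image_vimage_eq)
  then have "(\<Sum>i\<in>p -` keys m. lookup m (p i)) =
      (\<Sum>i\<in>keys m. lookup m i)"
    by (rule sum.reindex_bij_betw)
  then show ?thesis
    using assms by (simp add: mdeg_def lookup_map_key bij_is_inj keys_map_key)
qed

lemma mdeg_interleave: "mdeg m = mdeg (evm m) + mdeg (odm m)"
proof -
  define K where "K = keys m"
  have K: "finite K"
    by (simp add: K_def)
  obtain n where n: "K \<subseteq> {..<2 * n}"
    using K finite_nat_set_iff_bounded[of K] by (metis lessThan_iff less_le_trans mult_2 le_add1 subsetI)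
  have ev: "mdeg (evm m) = (\<Sum>k<n. lookup m (2 * k))"
  proof (subst mdeg_eq[of "{..<n}"])
    show "keys (evm m) \<subseteq> {..<n}"
    proof
      fix k assume "k \<in> keys (evm m)"
      then have "2 * k \<in> K"
        by (simp add: in_keys_iff lookup_evm K_def)
      then show "k \<in> {..<n}"
        using n by auto
    qed
  qed (simp_all add: lookup_evm)
  have od: "mdeg (odm m) = (\<Sum>k<n. lookup m (2 * k + 1))"
  proof (subst mdeg_eq[of "{..<n}"])
    show "keys (odm m) \<subseteq> {..<n}"
    proof
      fix k assume "k \<in> keys (odm m)"
      then have "2 * k + 1 \<in> K"
        by (simp add: in_keys_iff lookup_odm K_def)
      then show "k \<in> {..<n}"
        using n by auto
    qed
  qed (simp_all add: lookup_odm)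
  have "(\<Sum>i<2 * n. f i) = (\<Sum>k<n. f (2 * k)) + (\<Sum>k<n. f (2 * k + 1))" for f :: "nat \<Rightarrow> nat"
    by (induction n) auto
  then have "mdeg m = (\<Sum>k<n. lookup m (2 * k)) + (\<Sum>k<n. lookup m (2 * k + 1))"
    using n K by (subst mdeg_eq[of "{..<2 * n}"]) (auto simp: K_def)
  then show ?thesis
    using ev od by simp
qed

definition homog :: "int \<Rightarrow> 'a :: comm_ring_1 mpser \<Rightarrow> bool" where
  "homog d f \<longleftrightarrow> (\<forall>m. cf f m \<noteq> 0 \<longrightarrow> int (mdeg m) = d)"

lemma cf_mult_nonzeroD:
  assumes "cf (f * g) m \<noteq> 0"
  shows "\<exists>a b. a + b = m \<and> cf f a \<noteq> 0 \<and> cf g b \<noteq> 0"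
proof (rule ccontr)
  assume *: "\<not> ?thesis"
  have "cf (f * g) m = 0"
    unfolding times_mpser.rep_eq
  proof (intro sum.neutral ballI)
    fix x assume "x \<in> {(a, b). a + b = m}"
    then show "(case x of (a, b) \<Rightarrow> cf f a * cf g b) = 0"
      using *[unfolded not_ex, rule_format, of "fst x" "snd x"] by (cases x) auto
  qed
  then show False
    using assms by simp
qed

lemma homog_mult: "homog d f \<Longrightarrow> homog e g \<Longrightarrow> homog (d + e) (f * g)"
  unfolding homog_def
proof (intro allI impI)
  fix m
  assume *: "\<forall>m. cf f m \<noteq> 0 \<longrightarrow> int (mdeg m) = d" "\<forall>m. cf g m \<noteq> 0 \<longrightarrow> int (mdeg m) = e"
    and "cf (f * g) m \<noteq> 0"
  then obtain a b where "a + b = m" "cf f a \<noteq> 0" "cf g b \<noteq> 0"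
    using cf_mult_nonzeroD by blast
  then show "int (mdeg m) = d + e"
    using * by (auto simp: mdeg_add)
qed

lemma homog_1: "homog 0 1"
  by (simp add: homog_def)

lemma homog_sum: "(\<And>i. i \<in> A \<Longrightarrow> homog d (f i)) \<Longrightarrow> homog d (\<Sum>i\<in>A. f i)"
  unfolding homog_def by (metis (no_types, lifting) cf_sum sum.neutral)

lemma homog_prod: "(\<And>i. i \<in> A \<Longrightarrow> homog (d i) (f i)) \<Longrightarrow> homog (\<Sum>i\<in>A. d i) (\<Prod>i\<in>A. f i)"
  by (induction A rule: infinite_finite_induct) (auto simp: homog_1 homog_mult)

lemma homog_signof: "homog d f \<Longrightarrow> homog d (signof p * f)"
  by (auto simp: homog_def sign_def)

section \<open>The ring of symmetric functions\<close>

lemma Lam_iff: "f \<in> Lam \<longleftrightarrow> (\<forall>p. bij p \<longrightarrow> perm p f = f) \<and> (\<exists>d. \<forall>m. cf f m \<noteq> 0 \<longrightarrow> mdeg m \<le> d)"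
proof -
  have "perm p f = f \<longleftrightarrow> (\<forall>m. cf f (map_key p m) = cf f m)" for p
    by (metis cf_perm mpser_eqI)
  then show ?thesis
    by (auto simp: Lam_def)
qed

lemma Lam_cst [simp]: "cst c \<in> Lam"
proof -
  have "map_key p m = 0 \<longleftrightarrow> m = 0" if "bij p" for p :: "nat \<Rightarrow> nat" and m :: monom
    using mdeg_map_key[OF that, of m] by (simp flip: mdeg_eq_0_iff)
  then show ?thesis
    unfolding Lam_def by (auto intro!: exI[of _ 0])
qed

lemma Lam_0 [simp]: "0 \<in> Lam" and Lam_1 [simp]: "1 \<in> Lam"
  using Lam_cst[of 0] Lam_cst[of 1] by simp_all

lemma Lam_add: "f \<in> Lam \<Longrightarrow> g \<in> Lam \<Longrightarrow> f + g \<in> Lam"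
  unfolding Lam_iff
proof (intro conjI)
  assume *: "(\<forall>p. bij p \<longrightarrow> perm p f = f) \<and> (\<exists>d. \<forall>m. cf f m \<noteq> 0 \<longrightarrow> mdeg m \<le> d)"
    "(\<forall>p. bij p \<longrightarrow> perm p g = g) \<and> (\<exists>d. \<forall>m. cf g m \<noteq> 0 \<longrightarrow> mdeg m \<le> d)"
  then obtain d e where d: "\<And>m. cf f m \<noteq> 0 \<Longrightarrow> mdeg m \<le> d" "\<And>m. cf g m \<noteq> 0 \<Longrightarrow> mdeg m \<le> e"
    by auto
  show "\<exists>d. \<forall>m. cf (f + g) m \<noteq> 0 \<longrightarrow> mdeg m \<le> d"
  proof (intro exI[of _ "max d e"] allI impI)
    fix m assume "cf (f + g) m \<noteq> 0"
    then have "cf f m \<noteq> 0 \<or> cf g m \<noteq> 0"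
      by auto
    then show "mdeg m \<le> max d e"
      using d by (auto simp: le_max_iff_disj)
  qed
  show "\<forall>p. bij p \<longrightarrow> perm p (f + g) = f + g"
  proof (intro allI impI)
    fix p :: "nat \<Rightarrow> nat" assume p: "bij p"
    then interpret comm_ring_hom "perm p :: kfield mpser \<Rightarrow> _"
      by (rule perm_hom)
    show "perm p (f + g) = f + g"
      using * p by (simp add: hom_add)
  qed
qed

lemma Lam_mult: "f \<in> Lam \<Longrightarrow> g \<in> Lam \<Longrightarrow> f * g \<in> Lam"
  unfolding Lam_iff
proof (intro conjI)
  assume *: "(\<forall>p. bij p \<longrightarrow> perm p f = f) \<and> (\<exists>d. \<forall>m. cf f m \<noteq> 0 \<longrightarrow> mdeg m \<le> d)"
    "(\<forall>p. bij p \<longrightarrow> perm p g = g) \<and> (\<exists>d. \<forall>m. cf g m \<noteq> 0 \<longrightarrow> mdeg m \<le> d)"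
  then obtain d e where d: "\<And>m. cf f m \<noteq> 0 \<Longrightarrow> mdeg m \<le> d" "\<And>m. cf g m \<noteq> 0 \<Longrightarrow> mdeg m \<le> e"
    by auto
  show "\<exists>d. \<forall>m. cf (f * g) m \<noteq> 0 \<longrightarrow> mdeg m \<le> d"
  proof (intro exI[of _ "d + e"] allI impI)
    fix m assume "cf (f * g) m \<noteq> 0"
    then obtain a b where "a + b = m" "cf f a \<noteq> 0" "cf g b \<noteq> 0"
      using cf_mult_nonzeroD by blast
    then show "mdeg m \<le> d + e"
      using d(1)[of a] d(2)[of b] by (auto simp: mdeg_add)
  qed
  show "\<forall>p. bij p \<longrightarrow> perm p (f * g) = f * g"
  proof (intro allI impI)
    fix p :: "nat \<Rightarrow> nat" assume p: "bij p"
    then interpret comm_ring_hom "perm p :: kfield mpser \<Rightarrow> _"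
      by (rule perm_hom)
    show "perm p (f * g) = f * g"
      using * p by (simp add: hom_mult)
  qed
qed

lemma Lam_uminus: "f \<in> Lam \<Longrightarrow> - f \<in> Lam"
  by (auto simp: Lam_def)

lemma Lam_minus: "f \<in> Lam \<Longrightarrow> g \<in> Lam \<Longrightarrow> f - g \<in> Lam"
  using Lam_add[of f "- g"] Lam_uminus[of g] by simp

lemma Lam_sum: "(\<And>i. i \<in> A \<Longrightarrow> f i \<in> Lam) \<Longrightarrow> (\<Sum>i\<in>A. f i) \<in> Lam"
  by (induction A rule: infinite_finite_induct) (auto intro: Lam_add)

lemma Lam_prod: "(\<And>i. i \<in> A \<Longrightarrow> f i \<in> Lam) \<Longrightarrow> (\<Prod>i\<in>A. f i) \<in> Lam"
  by (induction A rule: infinite_finite_induct) (auto intro: Lam_mult)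

lemma signof_Lam: "signof p \<in> Lam"
  by (auto simp: sign_def Lam_uminus)

lemma Lam_det:
  assumes "\<And>i j. i < n \<Longrightarrow> j < n \<Longrightarrow> A i j \<in> Lam"
  shows "Det n (\<lambda>i j. A i j) \<in> Lam"
  unfolding det_Leibniz
proof (intro Lam_sum Lam_mult Lam_prod signof_Lam)
  fix p i assume *: "p \<in> {p. p permutes {0..<n}}" "i \<in> {..<n}"
  then have "p permutes {0..<n}"
    by simp
  from permutes_less[OF this, of i] show "A i (p i) \<in> Lam"
    using * assms by auto
qed

lemma cf_h_sym [simp]: "cf (h_sym d) m = (if int (mdeg m) = d then 1 else 0)"
  by (simp add: h_sym_def)

lemma h_sym_Lam [simp]: "h_sym d \<in> Lam"
  unfolding Lam_def by (auto simp: mdeg_map_key intro!: exI[of _ "nat d"])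

lemma homog_h_sym: "homog d (h_sym d)"
  by (simp add: homog_def)

lemma h_sym_neg: "d < 0 \<Longrightarrow> h_sym d = 0"
  by (rule mpser_eqI) auto

lemma h_sym_0: "h_sym 0 = 1"
  by (rule mpser_eqI) (simp add: mdeg_eq_0_iff)

definition h_fps :: "kfield mpser fps" where
  "h_fps = Abs_fps (\<lambda>m. h_sym (int m))"

lemma cz_h_fps: "cz h_fps z = h_sym z"
  by (simp add: cz_def h_fps_def h_sym_neg)

lemma kfield_of_nat_neq_0: "n \<noteq> 0 \<Longrightarrow> (of_nat n :: kfield) \<noteq> 0"
  by (simp add: of_nat_fract Zero_fract_def eq_fract)

lemma kfield_of_nat_eq_0_iff: "(of_nat n :: kfield) = 0 \<longleftrightarrow> n = 0"
  using kfield_of_nat_neq_0 by (cases "n = 0") auto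

lemma cst_of_nat_inverse: "n \<noteq> 0 \<Longrightarrow> of_nat n * cst (1 / of_nat n :: kfield) = 1"
  by (simp add: kfield_of_nat_eq_0_iff flip: cst.hom_of_nat cst.hom_mult)

lemma cf_p_sym_mult:
  assumes "0 < n"
  shows "cf (p_sym n * f) m =
    (\<Sum>i | i \<in> keys m \<and> n \<le> lookup m i. cf f (m - single i n))"
proof -
  let ?I = "{i \<in> keys m. n \<le> lookup m i}"
  let ?s = "\<lambda>i. (single i n, m - single i n)"
  have "cf (p_sym n * f) m = (\<Sum>(a, b)\<in>?s ` ?I. cf (p_sym n) a * cf f b)"
    unfolding times_mpser.rep_eq
  proof (rule sum.mono_neutral_right)
    show "?s ` ?I \<subseteq> {(a, b). a + b = m}"
      by (auto simp: single_add_diff)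
    show "\<forall>x\<in>{(a, b). a + b = m} - ?s ` ?I. (case x of (a, b) \<Rightarrow> cf (p_sym n) a * cf f b) = 0"
    proof
      fix x assume "x \<in> {(a, b). a + b = m} - ?s ` ?I"
      then obtain a b where x: "x = (a, b)" and ab: "(a, b) \<notin> ?s ` ?I" "m = a + b"
        by auto
      have "cf (p_sym n) a = 0"
      proof (rule ccontr)
        assume "cf (p_sym n) a \<noteq> 0"
        then obtain i where a: "a = single i n"
          by (auto simp: p_sym_def split: if_splits)
        then have "i \<in> ?I" "b = m - single i n"
          using assms by (auto simp: ab(2) keys_add_nat lookup_add)
        then show False
          using ab a by blast
      qed
      then show "(case x of (a, b) \<Rightarrow> cf (p_sym n) a * cf f b) = 0"
        by (simp add: x)
    qed
  qed (rule finite_monom_splits)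
  also have "\<dots> = (\<Sum>i\<in>?I. cf f (m - single i n))"
  proof (subst sum.reindex)
    show "inj_on ?s ?I"
      using assms by (auto intro!: inj_onI dest!: arg_cong[where f = keys])
  qed (auto intro!: sum.cong simp: p_sym_def)
  finally show ?thesis .
qed

text \<open>At a monomial of degree \<open>n + 1\<close> the right side counts pairs of a variable
  and a number from 1 to its exponent; there are \<open>n + 1\<close> of them.\<close>

lemma newton_identity: "of_nat (Suc n) * h_sym (int (Suc n)) = (\<Sum>i\<le>n. p_sym (Suc i) * h_sym (int (n - i)))"
proof (rule mpser_eqI)
  fix m :: monom
  let ?K = "keys m" and ?l = "lookup m"
  let ?c = "\<Sum>i\<le>n. card {v \<in> ?K. Suc i \<le> ?l v}"
  have deg: "mdeg m = mdeg (m - single v k) + k" if "k \<le> ?l v" for v k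
    using mdeg_add[of "single v k" "m - single v k"] single_add_diff[OF that]
    by simp
  have "cf (\<Sum>i\<le>n. p_sym (Suc i) * h_sym (int (n - i))) m =
      (\<Sum>i\<le>n. \<Sum>v | v \<in> ?K \<and> Suc i \<le> ?l v. if mdeg m = Suc n then 1 else 0)"
    unfolding cf_sum
  proof (rule sum.cong[OF refl])
    fix i assume i: "i \<in> {..n}"
    show "cf (p_sym (Suc i) * h_sym (int (n - i))) m =
        (\<Sum>v | v \<in> ?K \<and> Suc i \<le> ?l v. if mdeg m = Suc n then 1 else 0)"
    proof (subst cf_p_sym_mult, simp, rule sum.cong[OF refl])
      fix v assume "v \<in> {v. v \<in> ?K \<and> Suc i \<le> ?l v}"
      then have "mdeg m = mdeg (m - single v (Suc i)) + Suc i"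
        by (intro deg) simp
      then show "cf (h_sym (int (n - i))) (m - single v (Suc i)) =
          (if mdeg m = Suc n then 1 else 0)"
        using i by auto
    qed
  qed
  also have "\<dots> = (if mdeg m = Suc n then of_nat ?c else 0)"
    by simp
  also have "\<dots> = (if mdeg m = Suc n then of_nat (Suc n) else 0)"
  proof (rule if_cong[OF refl _ refl], rule arg_cong[where f = of_nat])
    assume that: "mdeg m = Suc n"
    have "?c = (\<Sum>i\<le>n. \<Sum>v\<in>?K. if Suc i \<le> ?l v then 1 else 0)"
      by (simp add: sum.If_cases Int_def)
    also have "\<dots> = (\<Sum>v\<in>?K. \<Sum>i\<le>n. if Suc i \<le> ?l v then 1 else 0)"
      by (rule sum.swap)
    also have "\<dots> = (\<Sum>v\<in>?K. ?l v)"
    proof (rule sum.cong[OF refl])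
      fix v
      have "?l v \<le> Suc n"
        using deg[of "?l v" v] that by simp
      then have "{i \<in> {..n}. Suc i \<le> ?l v} = {..<?l v}"
        by auto
      then show "(\<Sum>i\<le>n. if Suc i \<le> ?l v then 1 else 0) = ?l v"
        by (simp add: sum.If_cases Int_def)
    qed
    finally show "?c = Suc n"
      using that by (simp add: mdeg_def)
  qed
  also have "(if mdeg m = Suc n then of_nat (Suc n) else 0) = cf (of_nat (Suc n) * h_sym (int (Suc n))) m"
    by (simp only: cst.hom_of_nat[symmetric] cf_cst_mult) simp
  finally show "cf (of_nat (Suc n) * h_sym (int (Suc n))) m =
      cf (\<Sum>i\<le>n. p_sym (Suc i) * h_sym (int (n - i))) m"
    by (rule sym)
qed

section \<open>Alternants\<close>

definition xm :: "monom \<Rightarrow> 'a :: comm_ring_1 mpser" where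
  "xm a = Abs_mpser (\<lambda>m. if m = a then 1 else 0)"

lemma cf_xm [simp]: "cf (xm a) m = (if m = a then 1 else 0)"
  by (simp add: xm_def)

lemma cf_xm_mult: "cf (xm a * f) (a + b) = cf f b"
proof -
  have "cf (xm a * f) (a + b) = (\<Sum>(p, q)\<in>{(a, b)}. cf (xm a) p * cf f q)"
    unfolding times_mpser.rep_eq
    by (rule sum.mono_neutral_right) (auto simp: finite_monom_splits split: if_splits)
  then show ?thesis
    by simp
qed

lemma cf_xm_mult_0: "(\<And>b. m \<noteq> a + b) \<Longrightarrow> cf (xm a * f) m = 0"
  unfolding times_mpser.rep_eq by (rule sum.neutral) auto

lemma xm_mult: "xm a * xm b = xm (a + b)"
proof (rule mpser_eqI)
  fix m :: monom show "cf (xm a * xm b) m = cf (xm (a + b)) m"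
  proof (cases "\<exists>c. m = a + c")
    case True
    then show ?thesis
      by (auto simp: cf_xm_mult)
  next
    case False
    then show ?thesis
      by (subst cf_xm_mult_0) auto
  qed
qed

lemma xm_0: "xm 0 = 1"
  by (rule mpser_eqI) simp

lemma var_xm: "var i = xm (single i 1)"
  by (rule mpser_eqI) simp

lemma var_power: "var i ^ k = xm (single i k)"
  by (induction k) (simp_all add: xm_0 var_xm xm_mult flip: single_add)

lemma xm_prod: "(\<Prod>i\<in>A. xm (f i)) = xm (\<Sum>i\<in>A. f i)"
  by (induction A rule: infinite_finite_induct) (auto simp: xm_0 xm_mult)

lemma cf_var_mult:
  "cf (var i * f) m =
    (if 1 \<le> lookup m i then cf f (m - single i 1) else 0)"
proof (cases "1 \<le> lookup m i")
  case True
  then show ?thesis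
    using cf_xm_mult[of "single i 1" f "m - single i 1"]
    unfolding single_add_diff[OF True] by (simp add: var_xm)
next
  case False
  then show ?thesis
    unfolding var_xm by (subst cf_xm_mult_0) (auto simp: lookup_add)
qed

lemma cf_signof_mult: "cf (signof p * f) m = signof p * cf f m"
  by (simp add: sign_def)

definition vmon :: "nat \<Rightarrow> (nat \<Rightarrow> nat) \<Rightarrow> monom" where
  "vmon n e = (\<Sum>i<n. single i (e i))"

lemma lookup_vmon: "lookup (vmon n e) i = (if i < n then e i else 0)"
proof -
  have "lookup (vmon n e) i = (\<Sum>j<n. lookup (single j (e j)) i)"
    unfolding vmon_def by (induction n) (auto simp: lookup_add)
  also have "\<dots> = (if i < n then e i else 0)"
    by (simp add: lookup_single when_def)
  finally show ?thesis .
qed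

lemma mdeg_vmon: "mdeg (vmon n e) = (\<Sum>i<n. e i)"
  by (simp add: vmon_def mdeg_sum)

definition expo :: "nat \<Rightarrow> part \<Rightarrow> nat \<Rightarrow> nat" where
  "expo n nu i = nat (bnum nu i + int n)"

lemma int_expo: "i < n \<Longrightarrow> int (expo n nu i) = bnum nu i + int n"
  using bnum_ge[of i n nu] by (simp add: expo_def)

lemma expo_eq: "i < n \<Longrightarrow> expo n nu i = pt nu (Suc i) + (n - Suc i)"
  using int_expo[of i n nu] by (simp add: bnum_def)

lemma sum_expo:
  assumes "plen nu \<le> n"
  shows "(\<Sum>i<n. expo n nu i) = psize nu + (\<Sum>i<n. n - Suc i)"
  unfolding psize_eq[OF assms] sum.distrib[symmetric] by (intro sum.cong refl) (simp add: expo_eq)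

definition alt :: "nat \<Rightarrow> part \<Rightarrow> 'a :: comm_ring_1 mpser" where
  "alt n nu = Det n (\<lambda>i j. var i ^ expo n nu j)"

definition vand :: "nat \<Rightarrow> 'a :: comm_ring_1 mpser" where
  "vand n = (\<Prod>(i, j)\<in>{(i, j). i < j \<and> j < n}. var i - var j)"

text \<open>Its alternant is the Vandermonde product (\<open>alt_empty\<close>), so that facts on
  alternants apply to \<open>vand\<close>.\<close>

definition empty_part :: part where
  "empty_part = Abs_part []"

lemma plen_empty [simp]: "plen empty_part = 0"
  by (simp add: plen_def empty_part_def Abs_part_inverse)

lemma expo_empty: "i < n \<Longrightarrow> expo n empty_part i = n - Suc i"
  by (simp add: expo_eq pt_zero)

lemma psize_empty [simp]: "psize empty_part = 0"
  by (simp add: psize_def)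

lemma alt_empty: "alt n empty_part = vand n"
  unfolding alt_def vand_def det_vandermonde[symmetric]
  by (rule det_mat_cong) (simp add: expo_empty)

lemma alt_expand:
  "alt n nu = (\<Sum>p | p permutes {0..<n}. signof p * xm (vmon n (\<lambda>i. expo n nu (p i))))"
  unfolding alt_def det_Leibniz by (simp add: var_power xm_prod vmon_def)

text \<open>The exponents of \<open>kap\<close> decrease strictly, so a permuted exponent vector of
  \<open>nu\<close> matches them only for the identity and \<open>nu = kap\<close>. A single
  monomial thus detects an alternant.\<close>

lemma cf_alt:
  assumes len: "plen nu \<le> n" "plen kap \<le> n"
  shows "cf (alt n nu) (vmon n (expo n kap)) = (if nu = kap then 1 else 0)"
proof -
  let ?P = "{p. p permutes {0..<n}}"
  have eq: "vmon n (expo n kap) = vmon n (\<lambda>i. expo n nu (p i)) \<longleftrightarrow> nu = kap \<and> p = id"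
    if p: "p permutes {0..<n}" for p
  proof
    assume eq: "vmon n (expo n kap) = vmon n (\<lambda>i. expo n nu (p i))"
    have b: "bnum kap i = bnum nu (p i)" if i: "i < n" for i
    proof -
      have "expo n kap i = expo n nu (p i)"
        using arg_cong[OF eq, of "\<lambda>m. lookup m i"] i by (simp add: lookup_vmon)
      then show ?thesis
        using int_expo[OF i, of kap] int_expo[OF permutes_less[OF p i], of nu] by simp
    qed
    have "bnum kap ` {..<n} = bnum nu ` p ` {..<n}"
      using b by (force simp: image_image)
    also have "p ` {..<n} = {..<n}"
      by (rule permutes_image_lessThan[OF p])
    finally have "kap = nu"
      using len by (intro bnum_image_eqD) auto
    moreover have "p i = i" for i
    proof (cases "i < n")
      case True
      then show ?thesis
        using b[OF True] \<open>kap = nu\<close> by simp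
    next
      case False
      then show ?thesis
        using p by (simp add: permutes_def)
    qed
    ultimately show "nu = kap \<and> p = id"
      by auto
  qed auto
  have "cf (alt n nu) (vmon n (expo n kap)) = (\<Sum>p\<in>?P. if p = id \<and> nu = kap then 1 else 0)"
    unfolding alt_expand cf_sum
    by (intro sum.cong refl) (auto simp: cf_signof_mult eq)
  also have "\<dots> = (\<Sum>p\<in>{id :: nat \<Rightarrow> nat}. if p = id \<and> nu = kap then 1 else 0)"
    by (rule sum.mono_neutral_right) (auto intro: permutes_id finite_permutations)
  finally show ?thesis
    by simp
qed

lemma homog_alt: "homog (int (\<Sum>i<n. expo n nu i)) (alt n nu)"
  unfolding alt_expand
proof (intro homog_sum homog_signof)
  fix p assume "p \<in> {p. p permutes {0..<n}}"
  then have "(\<Sum>i<n. expo n nu (p i)) = (\<Sum>i<n. expo n nu i)"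
    using sum.permute[of p "{..<n}" "expo n nu"] by (simp add: o_def atLeast0LessThan)
  then show "homog (int (\<Sum>i<n. expo n nu i)) (xm (vmon n (\<lambda>i. expo n nu (p i))))"
    by (simp add: homog_def mdeg_vmon)
qed

lemma perm_vand:
  assumes p: "p permutes {0..<n}"
  shows "perm p (vand n) = signof p * (vand n :: 'a :: comm_ring_1 mpser)"
proof -
  have b: "bij p"
    by (rule permutes_bij[OF p])
  interpret comm_ring_hom "perm p :: 'a mpser \<Rightarrow> _"
    by (rule perm_hom[OF b])
  have "perm p (alt n empty_part :: 'a mpser) = Det n (\<lambda>i j. var (p i) ^ expo n empty_part j)"
    unfolding alt_def hom_det[symmetric]
    by (rule arg_cong[of _ _ det]) (auto intro!: eq_matI simp: hom_power perm_var[OF b])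
  also have "\<dots> = signof p * alt n empty_part"
    unfolding alt_def by (rule det_mat_permute_rows[OF p])
  finally show ?thesis
    by (simp add: alt_empty)
qed

lemma restrict_vars_vand: "restrict_vars n (vand n :: 'a :: comm_ring_1 mpser) = vand n"
proof -
  have "restrict_vars n (var i :: 'a mpser) = var i" if "i < n" for i
    using that by (intro mpser_eqI) auto
  then show ?thesis
    unfolding vand_def restrict_vars.hom_prod
    by (intro prod.cong refl) (auto simp: restrict_vars.hom_minus)
qed

text \<open>Comparing coefficients in \<open>var i * f = var j * f\<close> trades one
  \<open>x_j\<close> for one \<open>x_i\<close> without changing the coefficient of
  \<open>f\<close>. Once no \<open>x_j\<close> is left, the next comparison gives 0.\<close>

lemma var_minus_cancel:
  fixes f :: "'a :: comm_ring_1 mpser"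
  assumes "i \<noteq> j" "(var i - var j) * f = 0"
  shows "f = 0"
proof -
  have eq: "cf (var i * f) m = cf (var j * f) m" for m
    using arg_cong[OF assms(2), of "\<lambda>f. cf f m"] by (simp add: left_diff_distrib)
  have "cf f a = 0" for a
  proof (induction "lookup a j" arbitrary: a rule: less_induct)
    case less
    let ?m = "single i 1 + a"
    have "cf f a = cf (var i * f) ?m"
      unfolding var_xm by (simp only: cf_xm_mult)
    also have "\<dots> = cf (var j * f) ?m"
      by (rule eq)
    also have "\<dots> = 0"
    proof (cases "1 \<le> lookup ?m j")
      case True
      then have "cf f (?m - single j 1) = 0"
        using assms(1) by (intro less) (auto simp: lookup_add lookup_minus lookup_single when_def)
      then show ?thesis
        by (simp add: cf_var_mult)
    qed (simp only: cf_var_mult if_False)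
    finally show ?case .
  qed
  then show ?thesis
    by (intro mpser_eqI) simp
qed

lemma vand_cancel:
  fixes f :: "'a :: comm_ring_1 mpser"
  assumes "f * vand n = 0"
  shows "f = 0"
proof -
  have gen: "f = 0" if "finite A" "\<And>i j. (i, j) \<in> A \<Longrightarrow> i \<noteq> j" "(\<Prod>(i, j)\<in>A. var i - var j) * f = 0"
    for A :: "(nat \<times> nat) set" and f :: "'a mpser"
    using that
  proof (induction A arbitrary: f rule: finite_induct)
    case (insert x A)
    obtain i j where x: "x = (i, j)"
      by fastforce
    have "(var i - var j) * ((\<Prod>(i, j)\<in>A. var i - var j) * f) = 0"
      using insert by (simp add: x mult.assoc)
    moreover have "i \<noteq> j"
      using insert.prems(1) x by blast
    ultimately have "(\<Prod>(i, j)\<in>A. var i - var j) * f = 0"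
      using var_minus_cancel by blast
    then show ?case
      using insert.IH insert.prems(1) by blast
  qed simp
  show ?thesis
  proof (rule gen[of "{(i, j). i < j \<and> j < n}"])
    show "finite {(i, j). i < j \<and> j < n}"
      by (rule finite_subset[of _ "{..<n} \<times> {..<n}"]) auto
    show "(\<Prod>(i, j)\<in>{(i, j). i < j \<and> j < n}. var i - var j) * f = 0"
      using assms unfolding vand_def by (simp only: mult.commute)
  qed auto
qed

section \<open>Schur functions\<close>

text \<open>The \<open>+ 1\<close> makes up for the 1-based shift inside \<open>bnum\<close>. A row
  beyond the length has 1 on the diagonal and complete functions of negative degree to its
  left.\<close>

lemma schur_eq:
  assumes "plen nu \<le> n"
  shows "schur nu = Det n (\<lambda>i j. h_sym (bnum nu i + 1 + int j))"
  using assms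
proof (induction n rule: dec_induct)
  case base
  show ?case
    unfolding schur_def by (rule det_mat_cong) (simp add: bnum_def)
next
  case (step n)
  have "Det (Suc n) (\<lambda>i j. h_sym (bnum nu i + 1 + int j)) =
      Det n (\<lambda>i j. h_sym (bnum nu i + 1 + int j))"
    using step by (intro det_border_row) (auto simp: bnum_beyond h_sym_neg h_sym_0)
  then show ?case
    using step by simp
qed

lemma schur_Lam [simp]: "schur nu \<in> Lam"
  unfolding schur_def by (intro Lam_det) simp

lemma homog_schur: "homog (int (psize nu)) (schur nu)"
proof -
  let ?n = "plen nu"
  have "homog (int (psize nu)) (\<Prod>i<?n. h_sym (bnum nu i + 1 + int (p i)))" if p: "p permutes {0..<?n}" for p
  proof -
    have "(\<Sum>i<?n. p i) = (\<Sum>i<?n. i)"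
      using sum.permute[OF p, of id] by (simp add: o_def atLeast0LessThan)
    then have "(\<Sum>i<?n. int (p i)) = (\<Sum>i<?n. int i)"
      unfolding of_nat_sum[symmetric] by simp
    then have "int (psize nu) = (\<Sum>i<?n. bnum nu i + 1 + int (p i))"
      by (simp add: sum.distrib psize_def bnum_def sum_subtractf)
    then show ?thesis
      by (simp only: homog_prod homog_h_sym)
  qed
  then show ?thesis
    unfolding schur_eq[OF order_refl] det_Leibniz by (intro homog_sum homog_signof) simp
qed

definition hn_fps :: "nat \<Rightarrow> kfield mpser fps" where
  "hn_fps n = Abs_fps (\<lambda>m. restrict_vars n (h_sym (int m)))"

abbreviation one_minus :: "'a :: comm_ring_1 \<Rightarrow> 'a fps" where
  "one_minus x \<equiv> 1 - fps_const x * fps_X"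

lemma one_minus_nth: "fps_nth (F * one_minus x) m =
    fps_nth F m - (if m = 0 then 0 else x * fps_nth F (m - 1))"
proof -
  have "F * one_minus x = F - fps_const x * (fps_X * F)"
    by (simp add: algebra_simps)
  then show ?thesis
    by simp
qed

lemma hn_fps_0: "hn_fps 0 = 1"
proof (rule fps_ext, rule mpser_eqI)
  fix m a show "cf (fps_nth (hn_fps 0) m) a = cf (fps_nth 1 m) a"
    by (cases m) (auto simp: hn_fps_def mdeg_eq_0_iff)
qed

text \<open>Monomials divisible by \<open>x_n\<close> are \<open>x_n\<close> times a monomial of one
  degree less, so the subtraction leaves exactly those free of \<open>x_n\<close>.\<close>

lemma hn_fps_Suc: "hn_fps (Suc n) * one_minus (var n) = hn_fps n"
proof (rule fps_ext, rule mpser_eqI)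
  fix m :: nat and a :: monom
  have low: "keys a \<subseteq> {..<n} \<longleftrightarrow>
      keys a \<subseteq> {..<Suc n} \<and> lookup a n = 0"
    by (auto simp: in_keys_iff subset_iff less_Suc_eq) (metis less_irrefl)
  show "cf (fps_nth (hn_fps (Suc n) * one_minus (var n)) m) a = cf (fps_nth (hn_fps n) m) a"
  proof (cases "1 \<le> lookup a n")
    case True
    let ?b = "a - single n 1"
    have a: "a = single n 1 + ?b"
      using single_add_diff[OF True] by (rule sym)
    have "mdeg a = Suc (mdeg ?b)"
      by (subst a) (simp add: mdeg_add)
    moreover have "keys a \<subseteq> {..<Suc n} \<longleftrightarrow> keys ?b \<subseteq> {..<Suc n}"
      by (subst a) (simp only: keys_add_nat, auto)
    moreover have "\<not> keys a \<subseteq> {..<n}"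
      using True low by auto
    ultimately show ?thesis
      using True unfolding one_minus_nth by (auto simp: hn_fps_def cf_var_mult)
  next
    case False
    then show ?thesis
      unfolding one_minus_nth by (simp add: hn_fps_def cf_var_mult low)
  qed
qed

lemma hn_fps_prod: "hn_fps n * (\<Prod>i<n. one_minus (var i)) = 1"
proof (induction n)
  case (Suc n)
  have "hn_fps (Suc n) * (\<Prod>i<Suc n. one_minus (var i)) =
      (hn_fps (Suc n) * one_minus (var n)) * (\<Prod>i<n. one_minus (var i))"
    by (simp add: ac_simps)
  then show ?case
    using Suc by (simp only: hn_fps_Suc)
qed (simp add: hn_fps_0)

lemma prod_one_minus_degree:
  assumes "finite A"
  shows "card A < l \<Longrightarrow> fps_nth (\<Prod>i\<in>A. one_minus (x i)) l = 0"
  using assms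
proof (induction A arbitrary: l rule: finite_induct)
  case (insert i A)
  have "(\<Prod>i\<in>insert i A. one_minus (x i)) = (\<Prod>i\<in>A. one_minus (x i)) * one_minus (x i)"
    using insert by (simp add: ac_simps)
  then show ?case
    using insert by (simp only: one_minus_nth) simp
qed simp

text \<open>Its coefficients are, up to sign, the elementary symmetric polynomials in the first
  \<open>n\<close> variables other than \<open>x_k\<close>.\<close>

definition ek_fps :: "nat \<Rightarrow> nat \<Rightarrow> kfield mpser fps" where
  "ek_fps n k = (\<Prod>i\<in>{..<n} - {k}. one_minus (var i))"

text \<open>The product \<open>hn_fps n * ek_fps n k\<close> cancels to the geometric series of
  \<open>x_k\<close>. Since \<open>ek_fps n k\<close> has degree below \<open>n\<close>, a
  combination of \<open>n\<close> complete functions is enough for every exponent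
  \<open>a\<close>.\<close>

lemma var_power_expand:
  assumes k: "k < n" and a: "0 \<le> a"
  shows "var k ^ nat a = (\<Sum>j<n. cz (hn_fps n) (a - int n + 1 + int j) * fps_nth (ek_fps n k) (n - Suc j))"
proof -
  define geo :: "kfield mpser fps" where "geo = Abs_fps (\<lambda>m. var k ^ m)"
  have geo: "geo * one_minus (var k) = 1"
  proof (rule fps_ext)
    fix m show "fps_nth (geo * one_minus (var k)) m = fps_nth 1 m"
      unfolding one_minus_nth by (cases m) (simp_all add: geo_def)
  qed
  have "(\<Prod>i<n. one_minus (var i)) = ek_fps n k * one_minus (var k)"
    using k unfolding ek_fps_def by (subst prod.remove[of _ k]) (auto simp: ac_simps)
  then have 1: "hn_fps n * ek_fps n k * one_minus (var k) = 1"
    using hn_fps_prod[of n] by (simp only: mult.assoc)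
  have "one_minus (var k) * geo = 1"
    using geo by (simp only: mult.commute)
  then have "hn_fps n * ek_fps n k = hn_fps n * ek_fps n k * (one_minus (var k) * geo)"
    by (simp only: mult_1_right)
  also have "\<dots> = geo"
    using 1 by (simp only: mult.assoc[symmetric] mult_1_left)
  finally have eq: "hn_fps n * ek_fps n k = geo" .
  have deg: "fps_nth (ek_fps n k) l = 0" if "n \<le> l" for l
    unfolding ek_fps_def using that k by (intro prod_one_minus_degree) auto
  \<comment> \<open>\<open>a + 1\<close> suffices for the convolution, and \<open>int n\<close> lets
    the sum be cut to \<open>n\<close> terms afterwards.\<close>
  define hi where "hi = max (int n) (a + 1)"
  have "var k ^ nat a = cz (ek_fps n k * hn_fps n) (a - 0)"
    using a eq by (simp add: cz_def geo_def mult.commute)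
  also have "\<dots> = (\<Sum>l\<in>{0..<hi}. cz (ek_fps n k) (l - 0) * cz (hn_fps n) (a - l))"
    by (rule cz_mult[symmetric]) (auto simp: hi_def)
  also have "\<dots> = (\<Sum>l\<in>{0..<int n}. cz (ek_fps n k) l * cz (hn_fps n) (a - l))"
    by (rule sum.mono_neutral_cong_right) (auto simp: hi_def cz_def deg)
  also have "\<dots> = (\<Sum>l<n. cz (hn_fps n) (a - int l) * fps_nth (ek_fps n k) l)"
    by (rule sum.reindex_bij_witness[where i = int and j = nat]) (auto simp: cz_def)
  also have "\<dots> = (\<Sum>j<n. cz (hn_fps n) (a - int (n - Suc j)) * fps_nth (ek_fps n k) (n - Suc j))"
    by (rule sum.nat_diff_reindex[symmetric])
  also have "\<dots> = (\<Sum>j<n. cz (hn_fps n) (a - int n + 1 + int j) * fps_nth (ek_fps n k) (n - Suc j))"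
    by (intro sum.cong refl arg_cong2[where f = "(*)"] arg_cong[where f = "cz (hn_fps n)"]) auto
  finally show ?thesis .
qed

lemma cz_hn_fps: "cz (hn_fps n) z = restrict_vars n (h_sym z)"
  by (simp add: cz_def hn_fps_def h_sym_neg)

text \<open>The matrix of the \<open>x\<^sub>k\<close>-powers is the Jacobi--Trudi matrix times a matrix that does not depend
  on the partition; the empty partition shows that the latter has determinant \<open>vand n\<close>.\<close>

theorem schur_bialternant:
  assumes "plen nu \<le> n"
  shows "restrict_vars n (schur nu) * vand n = alt n nu"
proof -
  let ?M = "\<lambda>j k. fps_nth (ek_fps n k) (n - Suc j)"
  let ?H = "\<lambda>nu i j. cz (hn_fps n) (bnum nu i + 1 + int j)"
  have H: "Det n (\<lambda>i j. ?H nu i j) = restrict_vars n (schur nu)" if "plen nu \<le> n" for nu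
    unfolding schur_eq[OF that] restrict_vars.hom_det[symmetric]
    by (rule arg_cong[of _ _ det]) (auto intro!: eq_matI simp: cz_hn_fps)
  have fact: "alt n nu = Det n (\<lambda>i j. ?H nu i j) * Det n (\<lambda>j k. ?M j k)" for nu
  proof -
    have "alt n nu = Det n (\<lambda>i k. var k ^ expo n nu i)"
      unfolding alt_def by (rule det_mat_transpose)
    also have "\<dots> = Det n (\<lambda>i k. \<Sum>j<n. ?H nu i j * ?M j k)"
    proof (rule det_mat_cong)
      fix i k assume "i < n" "k < n"
      then show "var k ^ expo n nu i = (\<Sum>j<n. ?H nu i j * ?M j k)"
        using bnum_ge[of i n nu] unfolding expo_def by (subst var_power_expand) (auto simp: algebra_simps)
    qed
    also have "\<dots> = Det n (\<lambda>i j. ?H nu i j) * Det n (\<lambda>j k. ?M j k)"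
      by (rule det_mat_mult)
    finally show ?thesis .
  qed
  have "schur empty_part = 1"
    by (simp add: schur_def)
  then have "Det n (\<lambda>j k. ?M j k) = vand n"
    using fact[of empty_part] by (simp add: H alt_empty)
  then show ?thesis
    using fact[of nu] by (simp add: H assms)
qed

text \<open>After multiplication by \<open>vand n\<close> the Schur functions become alternants, so
  each coefficient of a Schur expansion is the coefficient of one monomial.\<close>

lemma cf_schur_sum:
  assumes "finite T" "\<And>nu. nu \<in> T \<Longrightarrow> plen nu \<le> n" "plen kap \<le> n"
  shows "cf (restrict_vars n (\<Sum>nu\<in>T. cst (d nu) * schur nu) * vand n) (vmon n (expo n kap)) =
    (if kap \<in> T then d kap else 0)"
proof -
  have "restrict_vars n (\<Sum>nu\<in>T. cst (d nu) * schur nu) * vand n = (\<Sum>nu\<in>T. cst (d nu) * alt n nu)"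
    unfolding restrict_vars.hom_sum restrict_vars.hom_mult restrict_vars_cst sum_distrib_right mult.assoc
    by (intro sum.cong refl) (simp add: schur_bialternant assms)
  then have "cf (restrict_vars n (\<Sum>nu\<in>T. cst (d nu) * schur nu) * vand n) (vmon n (expo n kap)) =
      (\<Sum>nu\<in>T. d nu * (if nu = kap then 1 else 0))"
    using assms by (simp add: cf_alt)
  also have "\<dots> = (if kap \<in> T then d kap else 0)"
    using assms(1) by (simp add: if_distrib cong: if_cong)
  finally show ?thesis .
qed

lemma schur_sum_unique:
  assumes "finite {nu. d nu \<noteq> 0}" "finite T" "(\<Sum>nu\<in>T. cst (d nu) * schur nu) = (\<Sum>nu\<in>T. cst (e nu) * schur nu)"
    and "\<And>nu. nu \<notin> T \<Longrightarrow> d nu = 0 \<and> e nu = 0"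
  shows "d = e"
proof
  fix kap
  show "d kap = e kap"
  proof (cases "kap \<in> T")
    case True
    define n where "n = Max (plen ` T)"
    have n: "plen nu \<le> n" if "nu \<in> T" for nu
      using assms(2) that by (simp add: n_def)
    show ?thesis
      using cf_schur_sum[of T n kap d, OF assms(2) n n[OF True]]
        cf_schur_sum[of T n kap e, OF assms(2) n n[OF True]] True assms(3) by simp
  qed (use assms in simp)
qed

lemma schur_coeff_sum:
  assumes T: "finite T" and d: "\<And>nu. nu \<notin> T \<Longrightarrow> d nu = 0"
  shows "schur_coeff (\<Sum>nu\<in>T. cst (d nu) * schur nu) = d"
  unfolding schur_coeff_def
proof (rule the_equality)
  have sub: "{nu. d nu \<noteq> 0} \<subseteq> T"
    using d by auto
  show "finite {nu. d nu \<noteq> 0} \<and>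
      (\<Sum>nu\<in>T. cst (d nu) * schur nu) = (\<Sum>nu | d nu \<noteq> 0. cst (d nu) * schur nu)"
    using T sub by (intro conjI finite_subset[OF sub] sum.mono_neutral_right) auto
  fix e assume e: "finite {nu. e nu \<noteq> 0} \<and>
      (\<Sum>nu\<in>T. cst (d nu) * schur nu) = (\<Sum>nu | e nu \<noteq> 0. cst (e nu) * schur nu)"
  let ?S = "T \<union> {nu. e nu \<noteq> 0}"
  have "(\<Sum>nu | e nu \<noteq> 0. cst (e nu) * schur nu) = (\<Sum>nu\<in>?S. cst (e nu) * schur nu)"
    using e T by (intro sum.mono_neutral_left) auto
  moreover have "(\<Sum>nu\<in>T. cst (d nu) * schur nu) = (\<Sum>nu\<in>?S. cst (d nu) * schur nu)"
    using e T d by (intro sum.mono_neutral_left) auto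
  ultimately show "e = d"
    using e T d by (intro schur_sum_unique[of e ?S d]) auto
qed

lemma perm_restrict_Lam:
  assumes f: "f \<in> Lam" and p: "p permutes {0..<n}"
  shows "perm p (restrict_vars n f) = restrict_vars n f"
proof (rule mpser_eqI)
  fix m :: monom
  have b: "bij p"
    by (rule permutes_bij[OF p])
  have "keys (map_key p m) = p -` keys m"
    using b by (simp add: keys_map_key bij_is_inj)
  moreover have "p -` keys m \<subseteq> {..<n} \<longleftrightarrow> keys m \<subseteq> {..<n}"
    using permutes_in_image[OF p] bij_is_surj[OF b] unfolding subset_iff vimage_eq lessThan_iff
    by (metis atLeast0LessThan lessThan_iff surjD)
  moreover have "cf f (map_key p m) = cf f m"
    using f b by (simp add: Lam_def)
  ultimately show "cf (perm p (restrict_vars n f)) m = cf (restrict_vars n f) m"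
    by simp
qed

text \<open>List the elements of \<open>K\<close> first; their positions are then below
  \<open>card K\<close>.\<close>

lemma ex_permutation_image:
  fixes K :: "nat set"
  assumes "finite K" "card K \<le> n"
  shows "\<exists>p. bij p \<and> p -` K \<subseteq> {..<n :: nat}"
proof -
  obtain N where N: "K \<subseteq> {..<N}"
    using assms(1) finite_nat_set_iff_bounded by auto
  define xs where "xs = sorted_list_of_set K @ sorted_list_of_set ({..<N} - K)"
  have xs: "distinct xs" "set xs = {..<N}"
    using assms(1) N by (auto simp: xs_def)
  have len: "length xs = N"
    using distinct_card[OF xs(1)] xs(2) by simp
  have "inj_on ((!) xs) {..<N}" "(!) xs ` {..<N} = id ` {..<N}"
    using xs len by (auto simp: inj_on_nth set_conv_nth)
  then obtain p where p: "p permutes {0..<N}" "\<And>i. i < N \<Longrightarrow> p i = xs ! i"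
    using ex_permutes_of_image_eq[of "(!) xs" N id] by auto
  have "i < n" if i: "p i \<in> K" for i
  proof (rule ccontr)
    assume "\<not> i < n"
    moreover have "i < N"
      using i N permutes_in_image[OF p(1), of i] by auto
    ultimately have "xs ! i \<in> set (sorted_list_of_set ({..<N} - K))"
      using assms(2) len by (auto simp: xs_def nth_append simp del: set_sorted_list_of_set intro!: nth_mem)
    then show False
      using i p(2)[OF \<open>i < N\<close>] by simp
  qed
  then show ?thesis
    using permutes_bij[OF p(1)] by auto
qed

text \<open>A monomial with two equal exponents is fixed by a transposition, so its coefficient is
  its own negative and vanishes because 2 is nonzero in \<open>kfield\<close>. Distinct exponents
  can be sorted into those of a partition.\<close>

lemma antisymmetric_eq_0:
  fixes P :: "kfield mpser"
  assumes keys: "\<And>m. cf P m \<noteq> 0 \<Longrightarrow> keys m \<subseteq> {..<n}"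
    and anti: "\<And>p m. p permutes {0..<n} \<Longrightarrow> cf P (map_key p m) = signof p * cf P m"
    and zero: "\<And>kap. plen kap \<le> n \<Longrightarrow> cf P (vmon n (expo n kap)) = 0"
  shows "P = 0"
proof (rule mpser_eqI, rule ccontr)
  fix m :: monom assume "cf P m \<noteq> cf 0 m"
  then have nz: "cf P m \<noteq> 0"
    by simp
  then have km: "keys m \<subseteq> {..<n}"
    by (rule keys)
  have inj: "inj_on (lookup m) {..<n}"
  proof (rule inj_onI, rule ccontr)
    fix a b assume ab: "a \<in> {..<n}" "b \<in> {..<n}" "lookup m a = lookup m b" "a \<noteq> b"
    let ?p = "Transposition.transpose a b"
    have p: "?p permutes {0..<n}"
      using ab by (intro permutes_swap_id) auto
    have "map_key ?p m = m"
      using ab by (intro poly_mapping_eqI) (simp add: lookup_map_key Transposition.transpose_def)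
    then have "cf P m = - cf P m"
      using anti[OF p, of m] ab by (simp add: sign_swap_id)
    then have "of_nat 2 * cf P m = 0"
      by (simp add: algebra_simps)
    then show False
      using nz kfield_of_nat_neq_0[of 2] by simp
  qed
  define A where "A = (\<lambda>i. int (lookup m i) - int n) ` {..<n}"
  have injA: "inj_on (\<lambda>i. int (lookup m i) - int n) {..<n}"
    using inj by (auto intro!: inj_onI dest: inj_onD)
  then have card: "card A = n"
    unfolding A_def by (simp add: card_image)
  define M where "M = Suc (\<Sum>i<n. lookup m i)"
  have "A \<subseteq> {- int n..<int M}"
  proof
    fix x assume "x \<in> A"
    then obtain i where "i < n" and x: "x = int (lookup m i) - int n"
      by (auto simp: A_def)
    then have "lookup m i \<le> (\<Sum>i<n. lookup m i)"
      by (intro member_le_sum) auto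
    then show "x \<in> {- int n..<int M}"
      by (simp add: x M_def del: of_nat_sum)
  qed
  from part_of_beta_set[OF this card] obtain kap where kap: "plen kap \<le> n" "bnum kap ` {..<n} = A"
    by (auto simp: Par_def)
  have "inj_on (bnum kap) {..<n}"
    using bnum_inj by (rule inj_on_subset) simp
  then obtain p where perm: "p permutes {0..<n}"
    and p: "\<And>i. i < n \<Longrightarrow> int (lookup m (p i)) - int n = bnum kap i"
    using ex_permutes_of_image_eq[of "bnum kap" n] kap(2) unfolding A_def by blast
  have "map_key p m = vmon n (expo n kap)"
  proof (rule poly_mapping_eqI)
    fix i
    have "lookup (map_key p m) i = lookup m (p i)"
      using permutes_inj[OF perm] by (rule lookup_map_key)
    also have "\<dots> = (if i < n then expo n kap i else 0)"
    proof (cases "i < n")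
      case True
      then show ?thesis
        using p[OF True] by (simp add: expo_def)
    next
      case False
      then have "p i = i"
        using perm by (simp add: permutes_def)
      then show ?thesis
        using km False by (auto simp: in_keys_iff)
    qed
    finally show "lookup (map_key p m) i = lookup (vmon n (expo n kap)) i"
      by (simp add: lookup_vmon)
  qed
  then have "signof p * cf P m = 0"
    using anti[OF perm, of m] zero[OF kap(1)] by simp
  then show False
    using nz by (auto simp: sign_def split: if_splits)
qed

text \<open>The coefficient of \<open>s\<^sub>\<nu>\<close> is read off from \<open>f\<close> times the Vandermonde product. What remains after
  subtraction is antisymmetric without strictly decreasing exponents, hence \<open>0\<close>.\<close>

theorem Lam_schur_span:
  assumes f: "f \<in> Lam"
  shows "\<exists>T c. finite T \<and> (\<forall>nu. nu \<notin> T \<longrightarrow> c nu = 0) \<and> f = (\<Sum>nu\<in>T. cst (c nu) * schur nu)"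
proof -
  \<comment> \<open>The degree bound also serves as the number of variables: a monomial of degree at
    most \<open>n\<close> involves at most \<open>n\<close> variables, so a symmetric function of
    this degree is determined by its restriction.\<close>
  obtain n where deg: "\<And>m. cf f m \<noteq> 0 \<Longrightarrow> mdeg m \<le> n"
    using f by (auto simp: Lam_def)
  define T where "T = {nu. plen nu \<le> n \<and> psize nu \<le> n}"
  have T: "finite T"
    by (rule finite_subset[OF _ finite_psize_le[of n]]) (auto simp: T_def)
  define c where "c nu = (if nu \<in> T then cf (restrict_vars n f * vand n) (vmon n (expo n nu)) else 0)" for nu
  define g where "g = f - (\<Sum>nu\<in>T. cst (c nu) * schur nu)"
  have g: "g \<in> Lam"
    unfolding g_def using f by (intro Lam_minus Lam_sum Lam_mult) auto
  have gdeg: "mdeg m \<le> n" if "cf g m \<noteq> 0" for m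
  proof (rule ccontr)
    assume m: "\<not> mdeg m \<le> n"
    then have "cf (schur nu) m = 0" if "nu \<in> T" for nu
      using homog_schur[of nu] that by (auto simp: homog_def T_def)
    then have "cf g m = 0"
      using m deg by (auto simp: g_def)
    then show False
      using that by simp
  qed
  \<comment> \<open>Multiplication by \<open>f\<close> raises the degree of the Vandermonde product
    by at most \<open>n\<close>, which is too little to reach a \<open>kap\<close> with
    \<open>psize kap > n\<close>.\<close>
  have top: "cf (restrict_vars n f * vand n) (vmon n (expo n kap)) = 0"
    if kap: "plen kap \<le> n" "kap \<notin> T" for kap
  proof (rule ccontr)
    assume "cf (restrict_vars n f * vand n) (vmon n (expo n kap)) \<noteq> 0"
    then obtain a b where ab: "a + b = vmon n (expo n kap)" "cf (restrict_vars n f) a \<noteq> 0"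
        "cf (vand n :: kfield mpser) b \<noteq> 0"
      using cf_mult_nonzeroD by blast
    then have "mdeg a \<le> n"
      using deg by (auto split: if_splits)
    moreover have "mdeg b = (\<Sum>i<n. n - Suc i)"
      using homog_alt[where 'a = kfield, of n empty_part] ab(3) sum_expo[of empty_part n]
      by (simp add: alt_empty homog_def del: of_nat_sum)
    moreover have "mdeg a + mdeg b = psize kap + (\<Sum>i<n. n - Suc i)"
      using sum_expo[OF kap(1)] ab(1) by (metis mdeg_add mdeg_vmon)
    ultimately show False
      using kap by (simp add: T_def)
  qed
  have "restrict_vars n g * vand n = 0"
  proof (rule antisymmetric_eq_0[where n = n])
    fix m :: monom assume nz: "cf (restrict_vars n g * vand n) m \<noteq> 0"
    have "restrict_vars n g * vand n = restrict_vars n (g * vand n)"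
      by (simp add: restrict_vars.hom_mult restrict_vars_vand)
    then show "keys m \<subseteq> {..<n}"
      using nz by (auto split: if_splits)
  next
    fix p m assume p: "p permutes {0..<n}"
    interpret comm_ring_hom "perm p :: kfield mpser \<Rightarrow> _"
      by (rule perm_hom[OF permutes_bij[OF p]])
    have "perm p (restrict_vars n g * vand n) = signof p * (restrict_vars n g * vand n)"
      by (simp add: hom_mult perm_restrict_Lam[OF g p] perm_vand[OF p] ac_simps)
    then show "cf (restrict_vars n g * vand n) (map_key p m) =
        signof p * cf (restrict_vars n g * vand n) m"
      by (metis cf_perm cf_signof_mult)
  next
    fix kap assume kap: "plen kap \<le> n"
    have "cf (restrict_vars n g * vand n) (vmon n (expo n kap)) =
        cf (restrict_vars n f * vand n) (vmon n (expo n kap)) - (if kap \<in> T then c kap else 0)"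
      using cf_schur_sum[of T n kap c, OF T _ kap]
      by (simp add: g_def restrict_vars.hom_minus left_diff_distrib T_def)
    then show "cf (restrict_vars n g * vand n) (vmon n (expo n kap)) = 0"
      using top[OF kap] by (auto simp: c_def)
  qed
  then have r: "restrict_vars n g = 0"
    by (rule vand_cancel)
  have "g = 0"
  proof (rule mpser_eqI, rule ccontr)
    fix m :: monom assume "cf g m \<noteq> cf 0 m"
    then have nz: "cf g m \<noteq> 0"
      by simp
    have "card (keys m) = (\<Sum>i\<in>keys m. 1)"
      by simp
    also have "\<dots> \<le> mdeg m"
      unfolding mdeg_def by (intro sum_mono) (simp add: in_keys_iff Suc_leI)
    also have "\<dots> \<le> n"
      by (rule gdeg[OF nz])
    finally obtain p where p: "bij p" "p -` keys m \<subseteq> {..<n}"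
      using ex_permutation_image[of "keys m" n] by auto
    have "cf g m = cf g (map_key p m)"
      using g p by (simp add: Lam_def)
    also have "\<dots> = cf (restrict_vars n g) (map_key p m)"
      using p by (simp add: keys_map_key bij_is_inj)
    also have "\<dots> = 0"
      by (simp only: r zero_mpser.rep_eq)
    finally show False
      using nz by simp
  qed
  then show ?thesis
    using T by (intro exI[of _ T] exI[of _ c]) (auto simp: g_def c_def)
qed

section \<open>Grothendieck polynomials\<close>

text \<open>The binomial theorem; the window has to contain the whole range from \<open>c\<close> to
  \<open>c + int i\<close> where \<open>lin_fps b ^ i\<close> has coefficients.\<close>

lemma lin_fps_eval:
  fixes b x :: "'a :: comm_ring_1"
  assumes "lo \<le> c" "c + int i < hi"
  shows "(\<Sum>k\<in>{lo..<hi}. cz (lin_fps b ^ i) (k - c) * x ^ nat (k - lo)) = x ^ nat (c - lo) * (1 + b * x) ^ i"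
proof -
  have "(\<Sum>k\<in>{lo..<hi}. cz (lin_fps b ^ i) (k - c) * x ^ nat (k - lo)) =
      (\<Sum>k\<in>{c..c + int i}. cz (lin_fps b ^ i) (k - c) * x ^ nat (k - lo))"
    using assms by (intro sum.mono_neutral_right) (auto simp: cz_def lin_fps_power_nth binomial_eq_0)
  also have "\<dots> = (\<Sum>l\<le>i. x ^ nat (c - lo) * (of_nat (i choose l) * (b * x) ^ l * 1 ^ (i - l)))"
  proof (rule sum.reindex_bij_witness[where i = "\<lambda>l. c + int l" and j = "\<lambda>k. nat (k - c)"])
    fix k assume k: "k \<in> {c..c + int i}"
    then have "nat (k - lo) = nat (c - lo) + nat (k - c)"
      using assms by (simp flip: nat_add_distrib)
    then show "x ^ nat (c - lo) * (of_nat (i choose nat (k - c)) * (b * x) ^ nat (k - c) * 1 ^ (i - nat (k - c))) =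
        cz (lin_fps b ^ i) (k - c) * x ^ nat (k - lo)"
      using k by (simp add: cz_def lin_fps_power_nth power_add power_mult_distrib ac_simps)
  qed auto
  also have "\<dots> = x ^ nat (c - lo) * (b * x + 1) ^ i"
    by (simp only: binomial_ring sum_distrib_left)
  finally show ?thesis
    by (simp only: add.commute)
qed

lemma cst_gco: "cst (gco b mu nu) = gco (cst b) mu nu"
  unfolding gco_def
  by (rule skewdet_hom[OF cst_hom, symmetric])
    (simp add: lin_fps_power_nth cst.hom_mult cst.hom_power cst.hom_of_nat)

lemma cf_hat_restrict:
  assumes "c \<in> Lam_hat" "plen kap \<le> n"
  shows "cf (hat_restrict n c * vand n) (vmon n (expo n kap)) = c kap"
proof -
  have "hat_restrict n c = restrict_vars n (\<Sum>nu | plen nu \<le> n \<and> c nu \<noteq> 0. cst (c nu) * schur nu)"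
    by (simp add: hat_restrict_def restrict_vars.hom_sum restrict_vars.hom_mult)
  moreover have "finite {nu. plen nu \<le> n \<and> c nu \<noteq> 0}"
    using assms by (simp add: Lam_hat_def)
  from cf_schur_sum[OF this _ assms(2), of c]
  have "cf (restrict_vars n (\<Sum>nu | plen nu \<le> n \<and> c nu \<noteq> 0. cst (c nu) * schur nu) * vand n)
      (vmon n (expo n kap)) = c kap"
    using assms(2) by auto
  ultimately show ?thesis
    by (simp only:)
qed

text \<open>Existence is Cauchy-Binet for \<open>gco\<close> against alternants, row
  \<open>i\<close> of \<open>gco\<close> evaluating to the factor \<open>(1 + beta x) ^ i\<close> of
  the numerator. Uniqueness holds because each coefficient can be read off in sufficiently many
  variables.\<close>

lemma stable_grothendieck_eq: "stable_grothendieck mu = gco beta mu"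
  unfolding stable_grothendieck_def
proof (rule the_equality)
  let ?num = "\<lambda>n. Det n (\<lambda>i j. var i ^ (pt mu (Suc j) + (n - Suc j)) * (1 + cst beta * var i) ^ j)"
  let ?M = "pt mu 1"
  have hat: "gco beta mu \<in> Lam_hat"
    unfolding Lam_hat_def
  proof (intro CollectI allI)
    fix n show "finite {nu. plen nu \<le> n \<and> gco beta mu nu \<noteq> 0}"
      by (rule finite_subset[OF _ finite_Par[of n ?M]]) (auto simp: Par_def dest: gco_nonzeroD)
  qed
  have "hat_restrict n (gco beta mu) * vand n = ?num n" if n: "plen mu \<le> n" for n
  proof -
    have "hat_restrict n (gco beta mu) * vand n =
        (\<Sum>nu | plen nu \<le> n \<and> gco beta mu nu \<noteq> 0. cst (gco beta mu nu) * alt n nu)"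
      unfolding hat_restrict_def sum_distrib_right mult.assoc
      by (intro sum.cong refl) (simp add: schur_bialternant)
    also have "\<dots> = (\<Sum>nu\<in>Par n ?M. cst (gco beta mu nu) * alt n nu)"
      by (rule sum.mono_neutral_left[OF finite_Par]) (auto simp: Par_def dest: gco_nonzeroD)
    also have "\<dots> = (\<Sum>nu\<in>Par n ?M.
        Det n (\<lambda>i j. cz (lin_fps (cst beta) ^ i) (bnum nu j - bnum mu i)) *
        Det n (\<lambda>i j. var i ^ nat (bnum nu j + int n)))"
    proof (rule sum.cong[OF refl])
      fix nu assume "nu \<in> Par n ?M"
      then have nu: "plen nu \<le> n"
        by (simp add: Par_def)
      have "cst (gco beta mu nu) = wdet (- 1) (\<lambda>i. lin_fps (cst beta) ^ i) n mu nu"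
        unfolding cst_gco unfolding gco_def using nu n by (subst wdet_eq_skewdet) auto
      then show "cst (gco beta mu nu) * alt n nu =
          Det n (\<lambda>i j. cz (lin_fps (cst beta) ^ i) (bnum nu j - bnum mu i)) *
          Det n (\<lambda>i j. var i ^ nat (bnum nu j + int n))"
        by (simp add: wdet_def alt_def expo_def)
    qed
    also have "\<dots> = Det n (\<lambda>i j. \<Sum>k\<in>{- int n..<int ?M}.
        cz (lin_fps (cst beta) ^ i) (k - bnum mu i) * var j ^ nat (k + int n))"
      by (rule cauchy_binet)
    also have "\<dots> = Det n (\<lambda>i j. var j ^ (pt mu (Suc i) + (n - Suc i)) * (1 + cst beta * var j) ^ i)"
    proof (rule det_mat_cong)
      fix i j assume i: "i < n" "j < n"
      have "pt mu (Suc i) \<le> ?M"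
        by (rule pt_antimono) auto
      \<comment> \<open>The shift by \<open>- int (Suc i)\<close> in \<open>bnum mu i\<close>
        compensates the degree \<open>i\<close> of the row series, so a window ending at
        \<open>pt mu 1\<close> contains all exponents.\<close>
      then have "bnum mu i + int i < int ?M"
        by (simp add: bnum_def)
      then show "(\<Sum>k\<in>{- int n..<int ?M}.
          cz (lin_fps (cst beta) ^ i) (k - bnum mu i) * var j ^ nat (k + int n)) =
          var j ^ (pt mu (Suc i) + (n - Suc i)) * (1 + cst beta * var j) ^ i"
        using lin_fps_eval[of "- int n" "bnum mu i" i "int ?M" "cst beta" "var j", OF bnum_ge[OF i(1)]]
          expo_eq[OF i(1), of mu]
        by (simp add: expo_def)
    qed
    also have "\<dots> = ?num n"
      by (rule det_mat_transpose)
    finally show ?thesis .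
  qed
  then show main: "gco beta mu \<in> Lam_hat \<and> (\<forall>n\<ge>plen mu.
      hat_restrict n (gco beta mu) * (\<Prod>(i, j)\<in>{(i, j). i < j \<and> j < n}. var i - var j) = ?num n)"
    using hat by (simp add: vand_def)
  fix c assume c: "c \<in> Lam_hat \<and> (\<forall>n\<ge>plen mu.
      hat_restrict n c * (\<Prod>(i, j)\<in>{(i, j). i < j \<and> j < n}. var i - var j) = ?num n)"
  show "c = gco beta mu"
  proof
    fix kap
    \<comment> \<open>Large enough for the defining identity to apply and for
      \<open>schur kap\<close> to survive the restriction.\<close>
    let ?n = "max (plen mu) (plen kap)"
    have "hat_restrict ?n c * vand ?n = hat_restrict ?n (gco beta mu) * vand ?n"
      using c main by (simp add: vand_def)
    then show "c kap = gco beta mu kap"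
      using cf_hat_restrict[of c kap ?n] cf_hat_restrict[of "gco beta mu" kap ?n] c main by simp
  qed
qed

section \<open>The Hall pairing and the Schur expansion of the dual Grothendieck polynomials\<close>

lemma hall_hat_sum:
  assumes "finite T" "\<And>nu. nu \<notin> T \<Longrightarrow> d nu = 0"
  shows "hall_hat c (\<Sum>nu\<in>T. cst (d nu) * schur nu) = (\<Sum>nu\<in>T. c nu * d nu)"
proof -
  have s: "schur_coeff (schur nu) = (\<lambda>kap. if kap = nu then 1 else 0)" for nu
    using schur_coeff_sum[of "{nu}" "\<lambda>kap. if kap = nu then 1 else 0"] by simp
  have "hall (schur nu) (\<Sum>nu\<in>T. cst (d nu) * schur nu) = d nu" for nu
  proof -
    have sc: "schur_coeff (\<Sum>nu\<in>T. cst (d nu) * schur nu) = d"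
      using assms by (rule schur_coeff_sum)
    have "hall (schur nu) (\<Sum>nu\<in>T. cst (d nu) * schur nu) = Sum_any (\<lambda>kap. d kap when kap = nu)"
      unfolding hall_def by (rule arg_cong[where f = Sum_any]) (auto simp: s sc when_def)
    then show ?thesis
      by (simp only: Sum_any_when_equal)
  qed
  then have "hall_hat c (\<Sum>nu\<in>T. cst (d nu) * schur nu) = Sum_any (\<lambda>nu. c nu * d nu)"
    by (simp add: hall_hat_def)
  also have "\<dots> = (\<Sum>nu\<in>T. c nu * d nu)"
  proof (rule Sum_any.expand_superset[OF assms(1)], rule subsetI, rule ccontr)
    fix a assume "a \<in> {a. c a * d a \<noteq> 0}" "a \<notin> T"
    then show False
      using assms(2)[of a] by simp
  qed
  finally show ?thesis .
qed

lemma dco_eq_0: "nu \<notin> Par (plen lam) (pt lam 1) \<Longrightarrow> dco b lam nu = 0"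
  using skewdet_nonzeroD unfolding dco_def by blast

text \<open>Duality is \<open>gco_dco\<close>. Any other solution is a finite Schur combination
  since Schur functions span \<open>Lam\<close>, and the difference of the coefficients is
  annihilated by all rows of \<open>gco\<close>.\<close>

lemma dual_grothendieck_eq:
  "dual_grothendieck lam = (\<Sum>nu\<in>Par (plen lam) (pt lam 1). cst (dco beta lam nu) * schur nu)"
  (is "_ = ?g")
  unfolding dual_grothendieck_def
proof (rule the_equality)
  have g: "?g \<in> Lam"
    by (intro Lam_sum Lam_mult) auto
  show main: "?g \<in> Lam \<and> (\<forall>mu. hall_hat (stable_grothendieck mu) ?g = (if mu = lam then 1 else 0))"
    unfolding stable_grothendieck_eq
    using g by (simp add: hall_hat_sum finite_Par dco_eq_0 gco_dco)
  fix f assume f: "f \<in> Lam \<and> (\<forall>mu. hall_hat (stable_grothendieck mu) f = (if mu = lam then 1 else 0))"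
  then obtain T c where T: "finite T" "\<And>nu. nu \<notin> T \<Longrightarrow> c nu = 0" "f = (\<Sum>nu\<in>T. cst (c nu) * schur nu)"
    using Lam_schur_span by metis
  define S where "S = T \<union> Par (plen lam) (pt lam 1)"
  have S: "finite S" "T \<subseteq> S" "Par (plen lam) (pt lam 1) \<subseteq> S"
    using T by (auto simp: S_def finite_Par)
  have fS: "f = (\<Sum>nu\<in>S. cst (c nu) * schur nu)"
    unfolding T(3) using T S by (intro sum.mono_neutral_left) auto
  have gS: "?g = (\<Sum>nu\<in>S. cst (dco beta lam nu) * schur nu)"
    using S dco_eq_0[of _ lam beta] by (intro sum.mono_neutral_left) auto
  have "c nu - dco beta lam nu = 0" for nu
  proof (rule gco_injective[OF S(1), where b = beta])
    show "c nu - dco beta lam nu = 0" if "nu \<notin> S" for nu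
      using that T(2) dco_eq_0 S by (metis diff_zero subset_iff)
    fix mu
    have "(\<Sum>nu\<in>S. gco beta mu nu * c nu) = (if mu = lam then 1 else 0)"
      using f T(2) S unfolding stable_grothendieck_eq fS by (subst (asm) hall_hat_sum) auto
    then show "(\<Sum>nu\<in>S. gco beta mu nu * (c nu - dco beta lam nu)) = 0"
      using gco_dco[OF S(1) S(3), of beta mu] by (simp add: right_diff_distrib sum_subtractf)
  qed
  then show "f = ?g"
    unfolding gS fS by simp
qed

section \<open>Exponentials of bosons\<close>

text \<open>Only the modes in \<^term>\<open>{- int N..<int M}\<close> are kept, which makes all sums finite. For lowering
  operators this is harmless on kets supported on finitely many states, and for raising ones as long
  as only the coefficients of the states below with modes in this window are considered.\<close>

abbreviation win :: "nat \<Rightarrow> nat \<Rightarrow> int set" where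
  "win N M \<equiv> {- int N..<int M}"

lemma psi_sum: "psi n (\<lambda>S. \<Sum>a\<in>A. g a S) = (\<lambda>S. \<Sum>a\<in>A. psi n (g a) S)"
  by (rule ext) (auto simp: psi_def sum_distrib_left)

lemma psi_star_sum: "psi_star n (\<lambda>S. \<Sum>a\<in>A. g a S) = (\<lambda>S. \<Sum>a\<in>A. psi_star n (g a) S)"
  by (rule ext) (auto simp: psi_star_def sum_distrib_left)

lemma psi_add: "psi n (\<lambda>S. v S + w S) = (\<lambda>S. psi n v S + psi n w S)"
  by (rule ext) (auto simp: psi_def distrib_left)

lemma psi_zero: "psi n (\<lambda>S. 0) = (\<lambda>S. 0)"
  by (rule ext) (simp add: psi_def)

lemma psi_twice: "psi n (psi n v) = (\<lambda>S. 0)"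
  by (rule ext) (simp add: psi_def del_state.rep_eq)

text \<open>Two anticommutations. Summed over \<open>j\<close> with \<open>l = j + m\<close> this
  becomes \<open>[a_m, psi_k] = psi_(k - m)\<close>.\<close>

lemma boson_term:
  fixes v :: "'r :: comm_ring_1 ket"
  shows "psi j (psi_star l (psi k v)) S =
    (if k = l then psi j v S else 0) + psi k (psi j (psi_star l v)) S"
proof -
  have "psi_star l (psi k v) = (\<lambda>T. (if k = l then v T else 0) + - 1 * psi k (psi_star l v) T)"
    using psi_psi_star[of k l v] by (auto simp: eq_diff_eq' algebra_simps)
  then have "psi j (psi_star l (psi k v)) S =
      psi j (\<lambda>T. if k = l then v T else 0) S + - 1 * psi j (psi k (psi_star l v)) S"
    by (simp only: psi_add psi_scale)
  also have "- 1 * psi j (psi k (psi_star l v)) S = psi k (psi j (psi_star l v)) S"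
    using psi_psi[of j k "psi_star l v" S] by (simp add: add_eq_0_iff)
  finally show ?thesis
    by (simp add: psi_zero split: if_splits)
qed

definition wboson :: "nat \<Rightarrow> nat \<Rightarrow> int \<Rightarrow> 'r :: comm_ring_1 ket \<Rightarrow> 'r ket" where
  "wboson N M m v = (\<lambda>S. \<Sum>j | j \<in> win N M \<and> j + m \<in> win N M. psi j (psi_star (j + m) v) S)"

text \<open>The window has \<open>N + M\<close> modes, so larger shifts leave it and the sum over
  \<open>n\<close> may stop there.\<close>

definition wop :: "nat \<Rightarrow> nat \<Rightarrow> int \<Rightarrow> 'r :: comm_ring_1 fps \<Rightarrow> 'r ket \<Rightarrow> 'r ket" where
  "wop N M eps c v = (\<lambda>S. \<Sum>n\<in>{1..N + M}. fps_nth c n * wboson N M (eps * int n) v S)"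

definition psif :: "nat \<Rightarrow> nat \<Rightarrow> (int \<Rightarrow> 'r :: comm_ring_1) \<Rightarrow> 'r ket \<Rightarrow> 'r ket" where
  "psif N M f v = (\<lambda>S. \<Sum>k\<in>win N M. f k * psi k v S)"

text \<open>What the commutator with \<open>wop\<close> does to the coefficient function of
  \<open>psif\<close>, see \<open>wop_psif\<close>.\<close>

definition wshift :: "nat \<Rightarrow> nat \<Rightarrow> int \<Rightarrow> 'r :: comm_ring_1 fps \<Rightarrow> (int \<Rightarrow> 'r) \<Rightarrow> int \<Rightarrow> 'r" where
  "wshift N M eps c f k =
    (\<Sum>n\<in>{1..N + M}. fps_nth c n * (if k + eps * int n \<in> win N M then f (k + eps * int n) else 0))"

lemma psif_cong: "(\<And>k. k \<in> win N M \<Longrightarrow> f k = g k) \<Longrightarrow> psif N M f v = psif N M g v"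
  unfolding psif_def by (rule ext) (auto intro!: sum.cong)

lemma psif_sum: "psif N M f (\<lambda>S. \<Sum>a\<in>A. g a S) S = (\<Sum>a\<in>A. psif N M f (g a) S)"
  unfolding psif_def psi_sum sum_distrib_left by (rule sum.swap)

lemma psif_scale: "psif N M f (\<lambda>S. b * v S) S = b * psif N M f v S"
  unfolding psif_def psi_scale sum_distrib_left by (simp add: ac_simps)

lemma psif_scale_left: "psif N M (\<lambda>k. b * f k) v S = b * psif N M f v S"
  unfolding psif_def sum_distrib_left by (simp add: ac_simps)

lemma psif_sum_left: "psif N M (\<lambda>k. \<Sum>a\<in>A. f a k) v S = (\<Sum>a\<in>A. psif N M (f a) v S)"
  unfolding psif_def sum_distrib_right by (rule sum.swap)

lemma wop_sum: "wop N M eps c (\<lambda>S. \<Sum>a\<in>A. g a S) S = (\<Sum>a\<in>A. wop N M eps c (g a) S)"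
proof -
  have "wboson N M m (\<lambda>S. \<Sum>a\<in>A. g a S) S = (\<Sum>a\<in>A. wboson N M m (g a) S)" for m
    unfolding wboson_def psi_star_sum psi_sum by (rule sum.swap)
  then show ?thesis
    unfolding wop_def by (simp only: sum_distrib_left) (rule sum.swap)
qed

lemma wop_scale: "wop N M eps c (\<lambda>S. b * v S) S = b * wop N M eps c v S"
  unfolding wop_def wboson_def psi_star_scale psi_scale sum_distrib_left
  by (simp add: ac_simps)

lemma wboson_psif:
  "wboson N M m (psif N M f v) S = psif N M f (wboson N M m v) S +
    (\<Sum>j | j \<in> win N M \<and> j + m \<in> win N M. f (j + m) * psi j v S)"
proof -
  let ?J = "{j. j \<in> win N M \<and> j + m \<in> win N M}"
  have "wboson N M m (psif N M f v) S =
      (\<Sum>j\<in>?J. \<Sum>k\<in>win N M. f k * psi j (psi_star (j + m) (psi k v)) S)"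
    unfolding wboson_def psif_def psi_star_sum psi_sum psi_star_scale psi_scale ..
  also have "\<dots> = (\<Sum>j\<in>?J. (\<Sum>k\<in>win N M. if k = j + m then f k * psi j v S else 0) +
      (\<Sum>k\<in>win N M. f k * psi k (psi j (psi_star (j + m) v)) S))"
    unfolding boson_term distrib_left sum.distrib
    by (intro sum.cong refl arg_cong2[where f = "(+)"]) auto
  also have "\<dots> = (\<Sum>j\<in>?J. f (j + m) * psi j v S) +
      (\<Sum>j\<in>?J. \<Sum>k\<in>win N M. f k * psi k (psi j (psi_star (j + m) v)) S)"
    unfolding sum.distrib by (intro sum.cong refl arg_cong2[where f = "(+)"]) simp
  also have "(\<Sum>j\<in>?J. \<Sum>k\<in>win N M. f k * psi k (psi j (psi_star (j + m) v)) S) =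
      psif N M f (wboson N M m v) S"
    unfolding wboson_def psif_def psi_sum sum_distrib_left by (rule sum.swap)
  finally show ?thesis
    by simp
qed

lemma wop_psif:
  "wop N M eps c (psif N M f v) S =
    psif N M f (wop N M eps c v) S + psif N M (wshift N M eps c f) v S"
proof -
  have "wop N M eps c (psif N M f v) S =
      (\<Sum>n\<in>{1..N + M}. fps_nth c n * psif N M f (wboson N M (eps * int n) v) S) +
      (\<Sum>n\<in>{1..N + M}. fps_nth c n * (\<Sum>j | j \<in> win N M \<and> j + eps * int n \<in> win N M.
          f (j + eps * int n) * psi j v S))"
    unfolding wop_def wboson_psif distrib_left sum.distrib ..
  also have "(\<Sum>n\<in>{1..N + M}. fps_nth c n * psif N M f (wboson N M (eps * int n) v) S) =
      psif N M f (wop N M eps c v) S"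
    unfolding wop_def psif_sum psif_scale ..
  also have "(\<Sum>n\<in>{1..N + M}. fps_nth c n * (\<Sum>j | j \<in> win N M \<and> j + eps * int n \<in> win N M.
          f (j + eps * int n) * psi j v S)) = psif N M (wshift N M eps c f) v S"
  proof -
    have "(\<Sum>j | j \<in> win N M \<and> j + eps * int n \<in> win N M. f (j + eps * int n) * psi j v S) =
        (\<Sum>j\<in>win N M. (if j + eps * int n \<in> win N M then f (j + eps * int n) else 0) * psi j v S)" for n
      by (rule sum.mono_neutral_cong_left) auto
    then show ?thesis
      unfolding psif_def wshift_def sum_distrib_right
      by (simp only: sum_distrib_left mult.assoc) (rule sum.swap)
  qed
  finally show ?thesis .
qed

definition inv_fact :: "nat \<Rightarrow> kfield mpser" where
  "inv_fact i = cst (1 / of_nat (fact i))"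

lemma inv_fact_0 [simp]: "inv_fact 0 = 1"
  by (simp add: inv_fact_def)

lemma inv_fact_Suc: "of_nat (Suc i) * inv_fact (Suc i) = inv_fact i"
proof -
  have "of_nat (Suc i) * inv_fact (Suc i) = cst (of_nat (Suc i) * (1 / (of_nat (Suc i) * of_nat (fact i))))"
    unfolding inv_fact_def cst.hom_mult cst.hom_of_nat fact_Suc of_nat_mult by simp
  also have "of_nat (Suc i) * (1 / (of_nat (Suc i) * of_nat (fact i))) = (1 / of_nat (fact i) :: kfield)"
    using kfield_of_nat_neq_0[of "Suc i"] by (simp del: of_nat_Suc)
  finally show ?thesis
    by (simp add: inv_fact_def)
qed

lemma of_nat_Suc_cancel:
  fixes a b :: "kfield mpser"
  assumes "of_nat (Suc i) * a = of_nat (Suc i) * b"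
  shows "a = b"
proof -
  have "cst (1 / of_nat (Suc i)) * of_nat (Suc i) * a = cst (1 / of_nat (Suc i)) * of_nat (Suc i) * b"
    using assms by (simp only: mult.assoc)
  moreover have "cst (1 / of_nat (Suc i)) * of_nat (Suc i) = (1 :: kfield mpser)"
    using cst_of_nat_inverse[of "Suc i"] by (simp add: mult.commute del: of_nat_Suc)
  ultimately show ?thesis
    by simp
qed

text \<open>Divided powers, which keep binomial coefficients out of the Leibniz rule
  \<open>wpow_psif\<close>.\<close>

definition wpow :: "nat \<Rightarrow> nat \<Rightarrow> int \<Rightarrow> kfield mpser fps \<Rightarrow> nat \<Rightarrow> kfield mpser ket \<Rightarrow> kfield mpser ket" where
  "wpow N M eps c i v = (\<lambda>S. inv_fact i * (wop N M eps c ^^ i) v S)"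

lemma wpow_0 [simp]: "wpow N M eps c 0 v = v"
  by (simp add: wpow_def)

lemma wpow_Suc: "of_nat (Suc i) * wpow N M eps c (Suc i) v S = wop N M eps c (wpow N M eps c i v) S"
proof -
  have "of_nat (Suc i) * wpow N M eps c (Suc i) v S =
      (of_nat (Suc i) * inv_fact (Suc i)) * wop N M eps c ((wop N M eps c ^^ i) v) S"
    by (simp only: wpow_def mult.assoc funpow.simps o_apply)
  then show ?thesis
    by (simp only: inv_fact_Suc wpow_def wop_scale)
qed

text \<open>The series \<open>F\<close> placed at mode \<open>a\<close>: each power of
  \<open>t\<close> moves the mode down by one for \<open>eps = 1\<close> and up by one for
  \<open>eps = - 1\<close>.\<close>

definition czf :: "int \<Rightarrow> int \<Rightarrow> 'r :: zero fps \<Rightarrow> int \<Rightarrow> 'r" where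
  "czf eps a F k = cz F (eps * (a - k))"

definition exp_fps :: "kfield mpser fps \<Rightarrow> kfield mpser fps" where
  "exp_fps c = Abs_fps (\<lambda>m. \<Sum>l\<le>m. inv_fact l * fps_nth (c ^ l) m)"

lemma power_nth_0:
  "fps_nth (c :: 'a :: comm_ring_1 fps) 0 = 0 \<Longrightarrow> m < l \<Longrightarrow> fps_nth (c ^ l) m = 0"
  using startsby_zero_power_prefix by blast

lemma exp_fps_nth:
  assumes "fps_nth c 0 = 0" "m < K"
  shows "fps_nth (exp_fps c) m = (\<Sum>l<K. inv_fact l * fps_nth (c ^ l) m)"
  unfolding exp_fps_def using assms
  by (simp, intro sum.mono_neutral_left) (auto simp: power_nth_0)

text \<open>Both series solve \<open>y' = c' y\<close> with constant term 1, and the equation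
  determines the coefficients recursively because positive integers can be cancelled.\<close>

lemma exp_fps_unique:
  assumes c: "fps_nth c 0 = 0" and P: "fps_nth P 0 = 1" "fps_deriv P = fps_deriv c * P"
  shows "exp_fps c = P"
proof -
  have E: "fps_deriv (exp_fps c) = fps_deriv c * exp_fps c"
  proof (rule fps_ext)
    fix m
    let ?E = "\<Sum>l\<le>m. fps_const (inv_fact l) * c ^ l"
    have "fps_nth (fps_deriv (exp_fps c)) m =
        (\<Sum>l<Suc (Suc m). inv_fact l * fps_nth (fps_deriv (c ^ l)) m)"
      by (simp add: exp_fps_nth[OF c, of "Suc m" "Suc (Suc m)"] sum_distrib_left mult.left_commute
          del: sum.lessThan_Suc of_nat_Suc)
    also have "\<dots> = (\<Sum>l<Suc m. inv_fact (Suc l) * fps_nth (fps_deriv (c ^ Suc l)) m)"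
      by (subst sum.lessThan_Suc_shift) simp
    also have "\<dots> = (\<Sum>l<Suc m. inv_fact l * fps_nth (fps_deriv c * c ^ l) m)"
    proof (rule sum.cong[OF refl])
      fix l
      have deriv: "fps_deriv (c ^ Suc l) = fps_const (of_nat (Suc l)) * (fps_deriv c * c ^ l)"
        using fps_deriv_power'[of c "Suc l"] by (simp del: of_nat_Suc add: fps_of_nat ac_simps)
      have "inv_fact (Suc l) * fps_nth (fps_deriv (c ^ Suc l)) m =
          (of_nat (Suc l) * inv_fact (Suc l)) * fps_nth (fps_deriv c * c ^ l) m"
        unfolding deriv fps_mult_left_const_nth by (simp only: mult.assoc mult.left_commute)
      then show "inv_fact (Suc l) * fps_nth (fps_deriv (c ^ Suc l)) m = inv_fact l * fps_nth (fps_deriv c * c ^ l) m"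
        by (simp only: inv_fact_Suc)
    qed
    also have "\<dots> = fps_nth (fps_deriv c * (\<Sum>l<Suc m. fps_const (inv_fact l) * c ^ l)) m"
      unfolding sum_distrib_left fps_sum_nth
      by (intro sum.cong refl) (metis fps_mult_left_const_nth mult.left_commute)
    also have "\<dots> = fps_nth (fps_deriv c * exp_fps c) m"
    proof -
      have "fps_nth (\<Sum>l<Suc m. fps_const (inv_fact l) * c ^ l) i = fps_nth (exp_fps c) i" if "i \<le> m" for i
        using that by (simp add: exp_fps_nth[OF c, of i "Suc m"] fps_sum_nth del: sum.lessThan_Suc)
      then show ?thesis
        unfolding fps_mult_nth by (intro sum.cong refl) auto
    qed
    finally show "fps_nth (fps_deriv (exp_fps c)) m = fps_nth (fps_deriv c * exp_fps c) m" .
  qed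
  have "fps_nth (exp_fps c) m = fps_nth P m" for m
  proof (induction m rule: less_induct)
    case (less m)
    show ?case
    proof (cases m)
      case 0
      then show ?thesis
        using P by (simp add: exp_fps_def)
    next
      case (Suc k)
      have "of_nat (Suc k) * fps_nth (exp_fps c) (Suc k) = fps_nth (fps_deriv c * exp_fps c) k"
        unfolding E[symmetric] by simp
      also have "\<dots> = fps_nth (fps_deriv c * P) k"
        unfolding fps_mult_nth using Suc less by (intro sum.cong refl) auto
      also have "\<dots> = of_nat (Suc k) * fps_nth P (Suc k)"
        unfolding P(2)[symmetric] by simp
      finally show ?thesis
        unfolding Suc by (rule of_nat_Suc_cancel)
    qed
  qed
  then show ?thesis
    by (rule fps_ext)
qed

lemma cz_shift_mult:
  fixes c F :: "'a :: comm_ring_1 fps"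
  assumes "fps_nth c 0 = 0" "z \<le> int L"
  shows "(\<Sum>n\<in>{1..L}. fps_nth c n * cz F (z - int n)) = cz (c * F) z"
proof -
  have "cz (c * F) (z - 0) = (\<Sum>k\<in>{0..<int L + 1}. cz c (k - 0) * cz F (z - k))"
    using assms by (intro cz_mult[symmetric]) auto
  also have "\<dots> = (\<Sum>k\<in>{1..<int L + 1}. cz c k * cz F (z - k))"
    using assms by (intro sum.mono_neutral_cong_right) (auto simp: cz_def)
  also have "\<dots> = (\<Sum>n\<in>{1..L}. fps_nth c n * cz F (z - int n))"
    by (rule sum.reindex_bij_witness[where i = int and j = nat]) (auto simp: cz_def)
  finally show ?thesis
    by simp
qed

locale window =
  fixes N M :: nat and eps :: int and c :: "kfield mpser fps"
  assumes eps: "eps = 1 \<or> eps = - 1" and c0: "fps_nth c 0 = 0"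
begin

text \<open>The commutator multiplies the series by \<open>c\<close>. A mode
  \<open>k + eps * int n\<close> outside the window would call for a coefficient of \<open>F\<close>
  of negative index, so the truncation loses nothing.\<close>

lemma wshift_czf:
  assumes a: "a \<in> win N M" and k: "k \<in> win N M"
    and f: "\<And>k. k \<in> win N M \<Longrightarrow> f k = czf eps a F k"
  shows "wshift N M eps c f k = czf eps a (c * F) k"
proof -
  have "eps * (a - k) \<le> int (N + M)"
    using a k eps by auto
  from cz_shift_mult[OF c0 this, of F]
  have "czf eps a (c * F) k = (\<Sum>n\<in>{1..N + M}. fps_nth c n * cz F (eps * (a - k) - int n))"
    by (simp add: czf_def)
  also have "\<dots> = wshift N M eps c f k"
    unfolding wshift_def
  proof (intro sum.cong refl arg_cong2[where f = "(*)"])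
    fix n assume n: "n \<in> {1..N + M}"
    show "cz F (eps * (a - k) - int n) = (if k + eps * int n \<in> win N M then f (k + eps * int n) else 0)"
    proof (cases "k + eps * int n \<in> win N M")
      case True
      have "eps * (a - (k + eps * int n)) = eps * (a - k) - int n"
        using eps by auto
      then show ?thesis
        using True f by (simp add: czf_def)
    next
      case False
      then have "eps * (a - k) - int n < 0"
        using eps a k by auto
      then show ?thesis
        using False by (simp only: cz_neg if_False)
    qed
  qed
  finally show ?thesis
    by simp
qed

definition spow :: "nat \<Rightarrow> kfield mpser fps \<Rightarrow> kfield mpser fps" where
  "spow l F = fps_const (inv_fact l) * c ^ l * F"

lemma spow_0 [simp]: "spow 0 F = F"
  by (simp add: spow_def)

lemma spow_Suc: "fps_const (of_nat (Suc l)) * spow (Suc l) F = c * spow l F"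
proof -
  have "fps_const (of_nat (Suc l)) * spow (Suc l) F =
      fps_const (of_nat (Suc l) * inv_fact (Suc l)) * (c * c ^ l * F)"
    by (simp only: spow_def power_Suc mult.assoc fps_const_mult[symmetric])
  then show ?thesis
    by (simp only: inv_fact_Suc spow_def ac_simps)
qed

lemma wop_psif_czf:
  assumes a: "a \<in> win N M"
  shows "wop N M eps c (psif N M (czf eps a F) v) S =
    psif N M (czf eps a F) (wop N M eps c v) S + psif N M (czf eps a (c * F)) v S"
  unfolding wop_psif by (simp only: psif_cong[OF wshift_czf[OF a _ refl]])

text \<open>Leibniz rule, by induction on \<open>i\<close>: after multiplication by
  \<open>i + 1\<close> the terms from \<open>v\<close> and from the fermion carry the weights
  \<open>i + 1 - l\<close> and \<open>l\<close>, which add up to \<open>i + 1\<close>.\<close>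

lemma wpow_psif:
  assumes a: "a \<in> win N M"
  shows "wpow N M eps c i (psif N M (czf eps a F) v) S =
    (\<Sum>l\<le>i. psif N M (czf eps a (spow l F)) (wpow N M eps c (i - l) v) S)"
proof (induction i arbitrary: S)
  case (Suc i)
  define T where "T l m = psif N M (czf eps a (spow l F)) (wpow N M eps c m v) S" for l m
  have T1: "psif N M (czf eps a (spow l F)) (wop N M eps c (wpow N M eps c m v)) S = of_nat (Suc m) * T l (Suc m)" for l m
    unfolding T_def psif_scale[symmetric] wpow_Suc ..
  have "czf eps a (c * spow l F) = (\<lambda>k. of_nat (Suc l) * czf eps a (spow (Suc l) F) k)" for l
    unfolding spow_Suc[symmetric] by (rule ext) (simp add: czf_def cz_def)
  then have T2: "psif N M (czf eps a (c * spow l F)) (wpow N M eps c m v) S = of_nat (Suc l) * T (Suc l) m" for l m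
    by (simp only: T_def psif_scale_left)
  have "of_nat (Suc i) * wpow N M eps c (Suc i) (psif N M (czf eps a F) v) S =
      wop N M eps c (\<lambda>S. \<Sum>l\<le>i. psif N M (czf eps a (spow l F)) (wpow N M eps c (i - l) v) S) S"
    unfolding wpow_Suc using Suc.IH by presburger
  also have "\<dots> = (\<Sum>l\<le>i. of_nat (Suc (i - l)) * T l (Suc (i - l))) + (\<Sum>l\<le>i. of_nat (Suc l) * T (Suc l) (i - l))"
    unfolding wop_sum wop_psif_czf[OF a] sum.distrib T1 T2 ..
  also have "(\<Sum>l\<le>i. of_nat (Suc (i - l)) * T l (Suc (i - l))) = (\<Sum>l\<le>Suc i. of_nat (Suc i - l) * T l (Suc i - l))"
  proof -
    have "(\<Sum>l\<le>i. of_nat (Suc (i - l)) * T l (Suc (i - l))) = (\<Sum>l\<le>i. of_nat (Suc i - l) * T l (Suc i - l))"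
      by (intro sum.cong refl) (simp only: Suc_diff_le atMost_iff)
    then show ?thesis
      by (simp only: sum.atMost_Suc diff_self_eq_0 of_nat_0 mult_zero_left add_0_right)
  qed
  also have "(\<Sum>l\<le>i. of_nat (Suc l) * T (Suc l) (i - l)) = (\<Sum>l\<le>Suc i. of_nat l * T l (Suc i - l))"
    by (subst sum.atMost_Suc_shift) simp
  also have "(\<Sum>l\<le>Suc i. of_nat (Suc i - l) * T l (Suc i - l)) + (\<Sum>l\<le>Suc i. of_nat l * T l (Suc i - l)) =
      (\<Sum>l\<le>Suc i. of_nat (Suc i) * T l (Suc i - l))"
    unfolding sum.distrib[symmetric] distrib_right[symmetric] of_nat_add[symmetric]
    by (intro sum.cong refl) simp
  also have "\<dots> = of_nat (Suc i) * (\<Sum>l\<le>Suc i. T l (Suc i - l))"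
    by (rule sum_distrib_left[symmetric])
  finally show ?case
    unfolding T_def by (rule of_nat_Suc_cancel)
qed simp

lemma spow_nth_0: "m < l \<Longrightarrow> fps_nth (spow l F) m = 0"
  unfolding spow_def mult.assoc fps_mult_left_const_nth
  by (auto simp: fps_mult_nth power_nth_0[OF c0])

text \<open>The series \<open>c ^ l\<close> starts at order \<open>l\<close>, while two modes of the
  window differ by less than \<open>N + M\<close>.\<close>

lemma czf_spow_0:
  assumes "a \<in> win N M" "k \<in> win N M" "N + M \<le> l"
  shows "czf eps a (spow l F) k = 0"
proof -
  have "eps * (a - k) < int (N + M)"
    using assms eps by auto
  then have "nat (eps * (a - k)) < l \<or> eps * (a - k) < 0"
    using assms by linarith
  then show ?thesis
    by (auto simp: czf_def cz_def spow_nth_0)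
qed

lemma sum_czf_spow:
  assumes "a \<in> win N M" "k \<in> win N M" "N + M \<le> K"
  shows "(\<Sum>l<K. czf eps a (spow l F) k) = czf eps a (exp_fps c * F) k"
proof (cases "0 \<le> eps * (a - k)")
  case True
  define z where "z = nat (eps * (a - k))"
  have "eps * (a - k) < int K"
    using assms eps by auto
  then have z: "z < K"
    using True by (simp add: z_def)
  have "(\<Sum>l<K. fps_nth (spow l F) z) =
      (\<Sum>i=0..z. (\<Sum>l<K. inv_fact l * fps_nth (c ^ l) i) * fps_nth F (z - i))"
    unfolding spow_def mult.assoc fps_mult_left_const_nth
    unfolding fps_mult_nth sum_distrib_left sum_distrib_right
    by (subst sum.swap) (simp add: mult.assoc)
  also have "\<dots> = (\<Sum>i=0..z. fps_nth (exp_fps c) i * fps_nth F (z - i))"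
    using z by (intro sum.cong refl arg_cong2[where f = "(*)"] exp_fps_nth[symmetric] c0) auto
  finally show ?thesis
    using True by (simp add: czf_def cz_def z_def[symmetric] fps_mult_nth[of "exp_fps c"])
qed (simp add: czf_def cz_neg)

text \<open>A uniform bound on the nonzero divided powers, which guarantees that the
  \<open>Sum_any\<close> in \<open>exp_op\<close> has its intended value.\<close>

definition nilp :: "kfield mpser ket \<Rightarrow> bool" where
  "nilp v \<longleftrightarrow> (\<exists>K. \<forall>m\<ge>K. \<forall>S. wpow N M eps c m v S = 0)"

lemma exp_op_eq:
  assumes "\<And>m S. K \<le> m \<Longrightarrow> wpow N M eps c m v S = 0"
  shows "exp_op (wop N M eps c) v S = (\<Sum>m<K. wpow N M eps c m v S)"
proof -
  have "exp_op (wop N M eps c) v S = Sum_any (\<lambda>m. wpow N M eps c m v S)"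
    by (simp add: exp_op_def wpow_def inv_fact_def)
  also have "\<dots> = (\<Sum>m<K. wpow N M eps c m v S)"
  proof (rule Sum_any.expand_superset)
    show "{m. wpow N M eps c m v S \<noteq> 0} \<subseteq> {..<K}"
    proof
      fix m assume "m \<in> {m. wpow N M eps c m v S \<noteq> 0}"
      then have "\<not> K \<le> m"
        using assms[of m S] by auto
      then show "m \<in> {..<K}"
        by simp
    qed
  qed simp
  finally show ?thesis .
qed

text \<open>The rule \<open>e^X psi(F) = psi(e^c F) e^X\<close>, that is the exponentiated form of
  the commutation relation \<open>wop_psif\<close>.\<close>

lemma exp_psif:
  assumes v: "nilp v" and a: "a \<in> win N M"
  shows "nilp (psif N M (czf eps a F) v)"
    and "exp_op (wop N M eps c) (psif N M (czf eps a F) v) =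
      psif N M (czf eps a (exp_fps c * F)) (exp_op (wop N M eps c) v)"
proof -
  obtain K0 where K0: "\<And>m S. K0 \<le> m \<Longrightarrow> wpow N M eps c m v S = 0"
    using v by (auto simp: nilp_def)
  define K where "K = max K0 (N + M)"
  have K: "wpow N M eps c m v S = 0" if "K \<le> m" for m S
    using that K0 by (simp add: K_def)
  define T where "T S l m = psif N M (czf eps a (spow l F)) (wpow N M eps c m v) S" for S l m
  have T1: "T S l m = 0" if "K \<le> l" for S l m
  proof -
    have "czf eps a (spow l F) k = 0" if "k \<in> win N M" for k
      using czf_spow_0[OF a that] \<open>K \<le> l\<close> by (simp add: K_def)
    then show ?thesis
      unfolding T_def psif_def by simp
  qed
  have T2: "T S l m = 0" if "K \<le> m" for S l m
  proof -
    have "wpow N M eps c m v = (\<lambda>S. 0)"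
      using K[OF that] by auto
    then show ?thesis
      unfolding T_def psif_def by (simp add: psi_zero)
  qed
  have pow: "wpow N M eps c i (psif N M (czf eps a F) v) S = (\<Sum>l\<le>i. T S l (i - l))" for i S
    unfolding T_def by (rule wpow_psif[OF a])
  have pow0: "wpow N M eps c i (psif N M (czf eps a F) v) S = 0" if "2 * K \<le> i" for i S
    unfolding pow
  proof (rule sum.neutral, rule ballI)
    fix l assume "l \<in> {..i}"
    then show "T S l (i - l) = 0"
      using that T1[of l S "i - l"] T2[of "i - l" S l] by (cases "K \<le> l") auto
  qed
  then show "nilp (psif N M (czf eps a F) v)"
    unfolding nilp_def by blast
  show "exp_op (wop N M eps c) (psif N M (czf eps a F) v) =
      psif N M (czf eps a (exp_fps c * F)) (exp_op (wop N M eps c) v)"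
  proof
    fix S
    have "exp_op (wop N M eps c) (psif N M (czf eps a F) v) S = (\<Sum>i<2 * K. \<Sum>l\<le>i. T S l (i - l))"
      unfolding pow[symmetric] by (rule exp_op_eq) (rule pow0)
    also have "\<dots> = (\<Sum>(l, m)\<in>{(l, m). l + m < 2 * K}. T S l m)"
      by (rule sum.triangle_reindex[symmetric])
    \<comment> \<open>Terms with \<open>l\<close> or \<open>m\<close> at least \<open>K\<close>
      vanish, so the triangle may be replaced by the square, over which the double sum
      factors.\<close>
    also have "\<dots> = (\<Sum>(l, m)\<in>{..<K} \<times> {..<K}. T S l m)"
    proof (rule sum.mono_neutral_right)
      show "finite {(l, m). l + m < 2 * K}"
        by (rule finite_subset[of _ "{..<2 * K} \<times> {..<2 * K}"]) auto
      show "\<forall>x\<in>{(l, m). l + m < 2 * K} - {..<K} \<times> {..<K}. (case x of (l, m) \<Rightarrow> T S l m) = 0"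
      proof
        fix x assume "x \<in> {(l, m). l + m < 2 * K} - {..<K} \<times> {..<K}"
        then obtain l m where "x = (l, m)" "K \<le> l \<or> K \<le> m"
          by (cases x) (auto simp: not_less)
        then show "(case x of (l, m) \<Rightarrow> T S l m) = 0"
          using T1 T2 by auto
      qed
    qed auto
    also have "\<dots> = (\<Sum>l<K. \<Sum>m<K. T S l m)"
      by (rule sum.cartesian_product[symmetric])
    also have "\<dots> = (\<Sum>l<K. psif N M (czf eps a (spow l F)) (\<lambda>S. \<Sum>m<K. wpow N M eps c m v S) S)"
      unfolding T_def psif_sum ..
    also have "(\<lambda>S. \<Sum>m<K. wpow N M eps c m v S) = exp_op (wop N M eps c) v"
      using exp_op_eq[of K v] K by auto
    also have "(\<Sum>l<K. psif N M (czf eps a (spow l F)) (exp_op (wop N M eps c) v) S) =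
        psif N M (\<lambda>k. \<Sum>l<K. czf eps a (spow l F) k) (exp_op (wop N M eps c) v) S"
      by (rule psif_sum_left[symmetric])
    also have "\<dots> = psif N M (czf eps a (exp_fps c * F)) (exp_op (wop N M eps c) v) S"
      by (intro fun_cong[OF psif_cong] sum_czf_spow a) (simp_all add: K_def)
    finally show "exp_op (wop N M eps c) (psif N M (czf eps a F) v) S =
        psif N M (czf eps a (exp_fps c * F)) (exp_op (wop N M eps c) v) S" .
  qed
qed

end

section \<open>Wedge products\<close>

lift_definition sea :: "nat \<Rightarrow> maya" is "\<lambda>N. {..<- int N}"
proof -
  fix N
  have "{n. n \<notin> {..<- int N} \<and> n < 0} \<subseteq> {- int N..<0}" "{n \<in> {..<- int N}. 0 \<le> n} = {}"
    by auto
  then show "finite {n \<in> {..<- int N}. 0 \<le> n} \<and> finite {n. n \<notin> {..<- int N} \<and> n < 0}"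
    by (metis finite.emptyI finite_atLeastLessThan_int finite_subset)
qed

lemma shifted_vacuum_eq: "shifted_vacuum N = basis_ket (sea N)"
proof (induction N)
  case 0
  have "vac_state = sea 0"
    by (rule occ_eqI) (simp add: vac_state.rep_eq sea.rep_eq)
  then show ?case
    by (simp add: vacuum_def)
next
  case (Suc N)
  have "fsign (- int (Suc N)) (sea N) = (1 :: 'a)"
  proof -
    have "{i \<in> occ (sea N). - int (Suc N) < i} = {}"
      by (auto simp: sea.rep_eq)
    then show ?thesis
      unfolding fsign_def by (simp only: card.empty power_0)
  qed
  moreover have "del_state (- int (Suc N)) (sea N) = sea (Suc N)"
    by (rule occ_eqI) (auto simp: del_state.rep_eq sea.rep_eq)
  ultimately show ?case
    using Suc by (auto simp: psi_star_basis_ket sea.rep_eq)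
qed

lemma psi_shifted_vacuum: "psi (- int (Suc N)) (shifted_vacuum (Suc N)) = shifted_vacuum N"
proof -
  have "fsign (- int (Suc N)) (sea (Suc N)) = (1 :: 'a)"
  proof -
    have "{i \<in> occ (sea (Suc N)). - int (Suc N) < i} = {}"
      by (auto simp: sea.rep_eq)
    then show ?thesis
      unfolding fsign_def by (simp only: card.empty power_0)
  qed
  moreover have "add_state (- int (Suc N)) (sea (Suc N)) = sea N"
    by (rule occ_eqI) (auto simp: add_state.rep_eq sea.rep_eq)
  ultimately show ?thesis
    unfolding shifted_vacuum_eq psi_basis_ket by (auto simp: sea.rep_eq)
qed

lemma psi_star_shifted_vacuum: "- int N \<le> k \<Longrightarrow> psi_star k (shifted_vacuum N) = (\<lambda>S. 0)"
  unfolding shifted_vacuum_eq psi_star_basis_ket by (auto simp: sea.rep_eq)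

definition wedge :: "nat \<Rightarrow> nat \<Rightarrow> (int \<Rightarrow> 'r) list \<Rightarrow> 'r :: comm_ring_1 ket" where
  "wedge N M fs = foldr (psif N M) fs (shifted_vacuum N)"

lemma wedge_Nil [simp]: "wedge N M [] = shifted_vacuum N"
  and wedge_Cons [simp]: "wedge N M (f # fs) = psif N M f (wedge N M fs)"
  by (simp_all add: wedge_def)

lemma wedge_support:
  assumes "wedge N M fs S \<noteq> 0"
  shows "\<exists>A. A \<subseteq> win N M \<and> card A = length fs \<and> occ S = {..<- int N} \<union> A"
  using assms
proof (induction fs arbitrary: S)
  case Nil
  then show ?case
    by (auto simp: shifted_vacuum_eq basis_ket_def sea.rep_eq split: if_splits)
next
  case (Cons f fs)
  then obtain k where k: "k \<in> win N M" "f k * psi k (wedge N M fs) S \<noteq> 0"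
    unfolding wedge_Cons psif_def by (meson sum.not_neutral_contains_not_neutral)
  then have kS: "k \<in> occ S" "wedge N M fs (del_state k S) \<noteq> 0"
    by (auto simp: psi_def split: if_splits)
  from Cons.IH[OF this(2)] obtain A where A: "A \<subseteq> win N M" "card A = length fs"
    "occ S - {k} = {..<- int N} \<union> A"
    by (auto simp: del_state.rep_eq)
  have "k \<notin> A"
    using A(3) by auto
  moreover have "finite A"
    using A(1) finite_subset by blast
  moreover have "occ S = {..<- int N} \<union> insert k A"
    using A(3) kS(1) by auto
  ultimately show ?case
    using A k(1) by (intro exI[of _ "insert k A"]) auto
qed

text \<open>Laplace expansion along the first row: removing the mode \<open>s j\<close> deletes
  column \<open>j\<close>, and the fermionic sign is that of the cofactor because exactly
  \<open>j\<close> occupied modes lie above \<open>s j\<close>.\<close>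

lemma wedge_coeff:
  assumes "\<And>i j. i < j \<Longrightarrow> j < length fs \<Longrightarrow> s j < s i" "\<And>i. i < length fs \<Longrightarrow> s i \<in> win N M"
    and "occ S = {..<- int N} \<union> s ` {..<length fs}"
  shows "wedge N M fs S = Det (length fs) (\<lambda>i j. (fs ! i) (s j))"
  using assms
proof (induction fs arbitrary: s S)
  case Nil
  then have "S = sea N"
    by (intro occ_eqI) (simp add: sea.rep_eq)
  then show ?case
    by (simp add: shifted_vacuum_eq basis_ket_def)
next
  case (Cons f fs)
  define n where "n = length fs"
  let ?A = "mat (Suc n) (Suc n) (\<lambda>(i, j). ((f # fs) ! i) (s j))"
  have s: "\<And>i j. i < j \<Longrightarrow> j < Suc n \<Longrightarrow> s j < s i" "\<And>i. i < Suc n \<Longrightarrow> s i \<in> win N M"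
    and S: "occ S = {..<- int N} \<union> s ` {..<Suc n}"
    using Cons.prems by (simp_all add: n_def)
  have inj: "s i = s j \<longleftrightarrow> i = j" if "i < Suc n" "j < Suc n" for i j
    using s(1)[of i j] s(1)[of j i] that by (cases i j rule: linorder_cases) auto
  have minor: "fsign (s j) S * wedge N M fs (del_state (s j) S) = cofactor ?A 0 j" if j: "j < Suc n" for j
  proof -
    define s' where "s' i = (if i < j then s i else s (Suc i))" for i
    have "wedge N M fs (del_state (s j) S) = Det n (\<lambda>i j. (fs ! i) (s' j))"
      unfolding n_def
    proof (rule Cons.IH)
      show "s' i' < s' i" if "i < i'" "i' < length fs" for i i'
        using that j unfolding s'_def by (auto intro!: s(1) simp: n_def)
      show "s' i \<in> win N M" if "i < length fs" for i
        using that s(2)[of i] s(2)[of "Suc i"] by (auto simp: s'_def n_def)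
      have "s' ` {..<n} = s ` ({..<Suc n} - {j})"
      proof (intro equalityI subsetI)
        fix x assume "x \<in> s' ` {..<n}"
        then obtain i where "i < n" "x = s' i"
          by auto
        then show "x \<in> s ` ({..<Suc n} - {j})"
          unfolding s'_def by (cases "i < j") auto
      next
        fix x assume "x \<in> s ` ({..<Suc n} - {j})"
        then obtain i where i: "i < Suc n" "i \<noteq> j" "x = s i"
          by auto
        show "x \<in> s' ` {..<n}"
        proof (cases "i < j")
          case True
          then show ?thesis
            using i j by (intro image_eqI[of _ _ i]) (auto simp: s'_def)
        next
          case False
          then show ?thesis
            using i j by (intro image_eqI[of _ _ "i - 1"]) (auto simp: s'_def)
        qed
      qed
      also have "\<dots> = s ` {..<Suc n} - {s j}"
        using inj j by (auto simp: image_iff)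
      finally show "occ (del_state (s j) S) = {..<- int N} \<union> s' ` {..<length fs}"
        using s(2)[OF j] by (auto simp: del_state.rep_eq S n_def)
    qed
    also have "mat n n (\<lambda>(i, j). (fs ! i) (s' j)) = mat_delete ?A 0 j"
      using j by (intro eq_matI) (auto simp: mat_delete_def s'_def)
    finally have w: "wedge N M fs (del_state (s j) S) = det (mat_delete ?A 0 j)" .
    have "{i \<in> occ S. s j < i} = {x \<in> s ` {..<Suc n}. s j < x}"
      using s(2)[OF j] by (auto simp: S)
    then have "card {i \<in> occ S. s j < i} = j"
      using strict_dec_above[of "Suc n" s j] s(1) j by simp
    then show ?thesis
      using w by (simp add: fsign_def cofactor_def)
  qed
  have "wedge N M (f # fs) S = (\<Sum>k\<in>s ` {..<Suc n}. f k * psi k (wedge N M fs) S)"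
    unfolding wedge_Cons psif_def
    by (rule sum.mono_neutral_right) (use s(2) S in \<open>auto simp: psi_def\<close>)
  also have "\<dots> = (\<Sum>j<Suc n. f (s j) * psi (s j) (wedge N M fs) S)"
    by (subst sum.reindex) (auto intro!: inj_onI simp: inj)
  also have "\<dots> = (\<Sum>j<Suc n. ?A $$ (0, j) * cofactor ?A 0 j)"
    by (intro sum.cong refl) (simp add: minor[symmetric] psi_def S)
  also have "\<dots> = det ?A"
    by (rule laplace_expansion_row[symmetric]) auto
  finally show ?case
    by (simp add: n_def)
qed

text \<open>No hole below the window and no particle above it: the states at which windowed and full
  operators can be compared.\<close>

definition states :: "nat \<Rightarrow> nat \<Rightarrow> maya set" where
  "states N M = {S. {..<- int N} \<subseteq> occ S \<and> occ S \<subseteq> {..<int M}}"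

lemma wedge_states:
  assumes "wedge N M fs S \<noteq> 0"
  shows "S \<in> states N M"
proof -
  obtain A where A: "A \<subseteq> win N M" "occ S = {..<- int N} \<union> A"
    using wedge_support[OF assms] by blast
  have "x < int M" if "x \<in> A" for x
    using A(1) that by auto
  then show ?thesis
    by (auto simp: states_def A(2))
qed

lemma ex_states: "\<exists>N\<ge>n. \<exists>M\<ge>m. S \<in> states N M"
proof -
  have fin: "finite ({k \<in> occ S. 0 \<le> k} \<union> {k. k \<notin> occ S \<and> k < 0})"
    using occ[of S] by auto
  define b where "b = Max (abs ` ({k \<in> occ S. 0 \<le> k} \<union> {k. k \<notin> occ S \<and> k < 0}))"
  have b: "\<bar>k\<bar> \<le> b" if "k \<in> {k \<in> occ S. 0 \<le> k} \<union> {k. k \<notin> occ S \<and> k < 0}" for k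
    unfolding b_def by (rule Max_ge[OF finite_imageI[OF fin] imageI[OF that]])
  define K where "K = max (max n m) (Suc (nat b))"
  have "S \<in> states K K"
    unfolding states_def
  proof (intro CollectI conjI subsetI)
    fix k assume k: "k \<in> {..<- int K}"
    show "k \<in> occ S"
    proof (rule ccontr)
      assume "k \<notin> occ S"
      then have "\<bar>k\<bar> \<le> b"
        using k by (intro b) auto
      then show False
        using k by (simp add: K_def)
    qed
  next
    fix k assume k: "k \<in> occ S"
    show "k \<in> {..<int K}"
    proof (rule ccontr)
      assume "k \<notin> {..<int K}"
      moreover from this have "\<bar>k\<bar> \<le> b"
        using k by (intro b) auto
      ultimately show False
        by (simp add: K_def)
    qed
  qed
  then show ?thesis
    by (intro exI[of _ K] conjI) (auto simp: K_def)
qed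

section \<open>The Grothendieck states\<close>

text \<open>A common form of \<open>Theta_op\<close>, \<open>- theta_op\<close> and
  \<open>H_op\<close>; \<open>c\<close> is the logarithm of the series by which fermions get
  multiplied.\<close>

definition bop :: "int \<Rightarrow> 'r :: comm_ring_1 fps \<Rightarrow> 'r ket \<Rightarrow> 'r ket" where
  "bop eps c v = (\<lambda>S. Sum_any (\<lambda>n. if 1 \<le> n then fps_nth c n * boson (eps * int n) v S else 0))"

lemma wboson_0: "N + M \<le> n \<Longrightarrow> eps = 1 \<or> eps = - 1 \<Longrightarrow> wboson N M (eps * int n) v S = 0"
  unfolding wboson_def by (rule sum.neutral) auto

lemma finite_win: "finite {j. j \<in> win N M \<and> j + m \<in> win N M}"
  by (rule finite_subset[of _ "win N M"]) auto

lemma boson_nonzeroD: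
  assumes "psi j (psi_star l v) S \<noteq> 0" "j \<noteq> l"
  shows "j \<in> occ S" "l \<notin> occ S" "v (add_state l (del_state j S)) \<noteq> 0"
  using assms by (auto simp: psi_def psi_star_def del_state.rep_eq split: if_splits)

definition supported :: "nat \<Rightarrow> nat \<Rightarrow> 'r :: comm_ring_1 ket \<Rightarrow> bool" where
  "supported N M v \<longleftrightarrow> (\<forall>S. v S \<noteq> 0 \<longrightarrow> S \<in> states N M)"

text \<open>For \<open>m > 0\<close> look at the state before the move, which lies in the support of
  \<open>v\<close>: it has a hole at \<open>j\<close> and a particle at \<open>j + m\<close>, so
  membership in \<open>states N M\<close> puts both into the window.\<close>

lemma boson_eq_wboson:
  assumes v: "supported N M v" and m: "0 < m"
  shows "boson m v S = wboson N M m v S"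
  unfolding boson_def wboson_def
proof (rule Sum_any.expand_superset[OF finite_win], clarify)
  fix j assume "psi j (psi_star (j + m) v) S \<noteq> 0"
  from boson_nonzeroD[OF this] m
  have j: "j \<in> occ S" "j + m \<notin> occ S" "add_state (j + m) (del_state j S) \<in> states N M"
    using v by (auto simp: supported_def)
  then have "j \<notin> occ (add_state (j + m) (del_state j S))" "j + m \<in> occ (add_state (j + m) (del_state j S))"
    using m by (auto simp: add_state.rep_eq del_state.rep_eq)
  then have "\<not> j < - int N" "j + m < int M"
    using j(3) by (auto simp: states_def)
  then show "j \<in> win N M \<and> j + m \<in> win N M"
    using m by auto
qed

text \<open>For \<open>m < 0\<close> look at the state \<open>S\<close> after the move: it has a
  particle at \<open>j\<close> and a hole at \<open>j + m\<close>. Thus the comparison also covers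
  kets of infinite support.\<close>

lemma boson_eq_wboson':
  assumes S: "S \<in> states N M" and m: "m < 0"
  shows "boson m v S = wboson N M m v S"
  unfolding boson_def wboson_def
proof (rule Sum_any.expand_superset[OF finite_win], clarify)
  fix j assume "psi j (psi_star (j + m) v) S \<noteq> 0"
  from boson_nonzeroD(1,2)[OF this] m
  have "j \<in> occ S" "j + m \<notin> occ S"
    by auto
  then have "j < int M" "\<not> j + m < - int N"
    using S by (auto simp: states_def)
  then show "j \<in> win N M \<and> j + m \<in> win N M"
    using m by auto
qed

lemma states_move_iff:
  assumes "j \<in> win N M" "l \<in> win N M" "j \<in> occ S" "l \<notin> occ S"
  shows "add_state l (del_state j S) \<in> states N M \<longleftrightarrow> S \<in> states N M"
  using assms by (auto simp: states_def add_state.rep_eq del_state.rep_eq)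

lemma wboson_supported:
  assumes v: "supported N M v" and m: "m \<noteq> 0"
  shows "supported N M (wboson N M m v)"
  unfolding supported_def
proof (intro allI impI)
  fix S assume "wboson N M m v S \<noteq> 0"
  then obtain j where j: "j \<in> win N M" "j + m \<in> win N M" "psi j (psi_star (j + m) v) S \<noteq> 0"
    unfolding wboson_def by (metis (no_types, lifting) mem_Collect_eq sum.not_neutral_contains_not_neutral)
  from boson_nonzeroD[OF j(3)] m have "j \<in> occ S" "j + m \<notin> occ S" "v (add_state (j + m) (del_state j S)) \<noteq> 0"
    by auto
  with v j states_move_iff show "S \<in> states N M"
    by (metis supported_def)
qed

lemma wboson_cong:
  assumes "\<And>S. S \<in> states N M \<Longrightarrow> v S = w S" "S \<in> states N M" "m \<noteq> 0"
  shows "wboson N M m v S = wboson N M m w S"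
  unfolding wboson_def
proof (rule sum.cong[OF refl])
  fix j assume j: "j \<in> {j. j \<in> win N M \<and> j + m \<in> win N M}"
  show "psi j (psi_star (j + m) v) S = psi j (psi_star (j + m) w) S"
  proof (cases "j \<in> occ S \<and> j + m \<notin> occ S")
    case True
    then have "add_state (j + m) (del_state j S) \<in> states N M"
      using j assms(2) states_move_iff by blast
    then show ?thesis
      using assms(1) by (simp add: psi_def psi_star_def)
  next
    case False
    then show ?thesis
      using assms(3) by (auto simp: psi_def psi_star_def del_state.rep_eq)
  qed
qed

lemma bop_eq:
  assumes eps: "eps = 1 \<or> eps = - 1" and b: "\<And>m. eps * m > 0 \<Longrightarrow> boson m v S = wboson N M m w S"
  shows "bop eps c v S = wop N M eps c w S"
proof -
  have eq: "boson (eps * int n) v S = wboson N M (eps * int n) w S" if "1 \<le> n" for n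
    using eps that by (intro b) auto
  have "bop eps c v S = (\<Sum>n\<in>{1..N + M}. if 1 \<le> n then fps_nth c n * boson (eps * int n) v S else 0)"
    unfolding bop_def
  proof (rule Sum_any.expand_superset)
    show "{n. (if 1 \<le> n then fps_nth c n * boson (eps * int n) v S else 0) \<noteq> 0} \<subseteq> {1..N + M}"
    proof
      fix n assume n: "n \<in> {n. (if 1 \<le> n then fps_nth c n * boson (eps * int n) v S else 0) \<noteq> 0}"
      then have "1 \<le> n" "wboson N M (eps * int n) w S \<noteq> 0"
        using eq[of n] by (auto split: if_splits)
      then show "n \<in> {1..N + M}"
        using wboson_0[OF _ eps, of N M n w S] by (cases "N + M \<le> n") auto
    qed
  qed simp
  also have "\<dots> = wop N M eps c w S"
    unfolding wop_def by (intro sum.cong refl) (auto simp: eq)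
  finally show ?thesis .
qed

lemma bop_supported:
  assumes v: "supported N M v"
  shows "bop 1 c v = wop N M 1 c v" "supported N M (wop N M 1 c v)"
proof -
  show "bop 1 c v = wop N M 1 c v"
    by (rule ext, rule bop_eq) (auto intro: boson_eq_wboson[OF v])
  show "supported N M (wop N M 1 c v)"
    unfolding supported_def
  proof (intro allI impI)
    fix S assume "wop N M 1 c v S \<noteq> 0"
    then obtain n where n: "n \<in> {1..N + M}" "fps_nth c n * wboson N M (1 * int n) v S \<noteq> 0"
      unfolding wop_def by (meson sum.not_neutral_contains_not_neutral)
    then have "wboson N M (int n) v S \<noteq> 0"
      by auto
    then show "S \<in> states N M"
      using wboson_supported[OF v, of "int n"] n(1) by (auto simp: supported_def)
  qed
qed

lemma exp_bop_supported:
  assumes v: "supported N M v"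
  shows "exp_op (bop 1 c) v = exp_op (wop N M 1 c) v"
proof -
  have "(bop 1 c ^^ i) v = (wop N M 1 c ^^ i) v \<and> supported N M ((wop N M 1 c ^^ i) v)" for i
    by (induction i) (use v in \<open>auto simp: bop_supported\<close>)
  then show ?thesis
    unfolding exp_op_def by simp
qed

text \<open>Moves inside the window neither enter nor leave \<open>states N M\<close>, so the
  coefficients there form a closed system even though raising operators destroy finite
  support.\<close>

lemma exp_bop_cong:
  assumes v: "\<And>S. S \<in> states N M \<Longrightarrow> v S = w S" and S: "S \<in> states N M"
  shows "exp_op (bop (- 1) c) v S = exp_op (wop N M (- 1) c) w S"
proof -
  have "(bop (- 1) c ^^ i) v S = (wop N M (- 1) c ^^ i) w S" if "S \<in> states N M" for i S
    using that
  proof (induction i arbitrary: S)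
    case (Suc i)
    have "boson m ((bop (- 1) c ^^ i) v) S = wboson N M m ((wop N M (- 1) c ^^ i) w) S" if "- 1 * m > 0" for m
    proof -
      have "boson m ((bop (- 1) c ^^ i) v) S = wboson N M m ((bop (- 1) c ^^ i) v) S"
        using Suc.prems that by (intro boson_eq_wboson') auto
      also have "\<dots> = wboson N M m ((wop N M (- 1) c ^^ i) w) S"
        using Suc that by (intro wboson_cong) auto
      finally show ?thesis .
    qed
    then show ?case
      by (simp, intro bop_eq) auto
  qed (use v in simp)
  then show ?thesis
    unfolding exp_op_def using S by simp
qed

lemma psi_cong:
  assumes v: "\<And>S. S \<in> states N M \<Longrightarrow> v S = w S" and S: "S \<in> states N M" and k: "- int N \<le> k"
  shows "psi k v S = psi k w S"
proof (cases "k \<in> occ S")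
  case True
  then have "del_state k S \<in> states N M"
    using S k by (auto simp: states_def del_state.rep_eq)
  then show ?thesis
    using v by (simp add: psi_def)
qed (simp add: psi_def)

lemma psif_czf_1:
  assumes eps: "eps = 1 \<or> eps = - 1" and a: "a \<in> win N M"
  shows "psif N M (czf eps a 1) v = psi a v"
proof
  fix S
  have cz: "czf eps a 1 k = (if k = a then 1 else 0)" for k
    using eps by (auto simp: czf_def cz_def)
  have "psif N M (czf eps a 1) v S = (\<Sum>k\<in>{a}. czf eps a 1 k * psi k v S)"
    unfolding psif_def using a by (intro sum.mono_neutral_right) (auto simp: cz)
  then show "psif N M (czf eps a 1) v S = psi a v S"
    by (simp add: cz)
qed

abbreviation cwedge :: "nat \<Rightarrow> nat \<Rightarrow> int \<Rightarrow> (int \<times> kfield mpser fps) list \<Rightarrow> kfield mpser ket" where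
  "cwedge N M eps fs \<equiv> wedge N M (map (\<lambda>(a, F). czf eps a F) fs)"

lemma cwedge_supported: "supported N M (cwedge N M eps fs)"
  unfolding supported_def using wedge_states by blast

context window
begin

text \<open>All modes of the window are empty in this vacuum, so every contraction within the window
  kills it. The full raising operators would also lift modes from below.\<close>

lemma wop_shifted_vacuum: "wop N M eps c (shifted_vacuum N) = (\<lambda>S. 0)"
  by (rule ext) (simp add: wop_def wboson_def psi_star_shifted_vacuum psi_zero)

lemma wpow_shifted_vacuum: "1 \<le> m \<Longrightarrow> wpow N M eps c m (shifted_vacuum N) S = 0"
proof -
  have z: "wop N M eps c (\<lambda>S. 0) = (\<lambda>S. 0)"
    using wop_scale[of N M eps c 0 "\<lambda>S. 0"] by auto
  have "(wop N M eps c ^^ Suc m) (shifted_vacuum N) = (\<lambda>S. 0)" for m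
    by (induction m) (simp_all add: wop_shifted_vacuum z)
  then show "1 \<le> m \<Longrightarrow> wpow N M eps c m (shifted_vacuum N) S = 0"
    by (cases m) (simp_all add: wpow_def del: funpow.simps)
qed

lemma exp_cwedge:
  assumes "\<And>a F. (a, F) \<in> set fs \<Longrightarrow> a \<in> win N M"
  shows "nilp (cwedge N M eps fs) \<and>
    exp_op (wop N M eps c) (cwedge N M eps fs) = cwedge N M eps (map (\<lambda>(a, F). (a, exp_fps c * F)) fs)"
  using assms
proof (induction fs)
  case Nil
  have "exp_op (wop N M eps c) (shifted_vacuum N) = shifted_vacuum N"
    using exp_op_eq[of 1 "shifted_vacuum N"] wpow_shifted_vacuum by auto
  then show ?case
    using wpow_shifted_vacuum by (auto simp: nilp_def)
next
  case (Cons x fs)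
  obtain a F where x: "x = (a, F)"
    by fastforce
  have a: "a \<in> win N M"
    using Cons.prems[of a F] by (simp add: x)
  have "nilp (cwedge N M eps fs)" "exp_op (wop N M eps c) (cwedge N M eps fs) =
      cwedge N M eps (map (\<lambda>(a, F). (a, exp_fps c * F)) fs)"
    using Cons.IH Cons.prems by auto
  then show ?case
    using exp_psif[OF _ a, of "cwedge N M eps fs" F] by (simp add: x)
qed

text \<open>The relation \<open>R\<close> is equality for the lowering operators, and agreement on
  \<^term>\<open>states N M\<close> for the raising ones, which do not preserve finite support.\<close>

lemma foldr_exp_cwedge:
  assumes base: "R (shifted_vacuum N) (shifted_vacuum N)"
    and psi: "\<And>k v w. k \<in> win N M \<Longrightarrow> R v w \<Longrightarrow> R (psi k v) (psi k w)"
    and exp: "\<And>v fs. R v (cwedge N M eps fs) \<Longrightarrow> R (E v) (exp_op (wop N M eps c) (cwedge N M eps fs))"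
    and kappa: "\<And>i. i \<in> set is \<Longrightarrow> kappa i \<in> win N M"
  shows "R (foldr (\<lambda>i v. psi (kappa i) (E v)) is (shifted_vacuum N))
    (cwedge N M eps (map (\<lambda>j. (kappa (is ! j), exp_fps c ^ j)) [0..<length is]))"
  using kappa
proof (induction "is")
  case Nil
  then show ?case
    using base by simp
next
  case (Cons i "is")
  let ?fs = "map (\<lambda>j. (kappa (is ! j), exp_fps c ^ j)) [0..<length is]"
  have k: "kappa i \<in> win N M"
    using Cons.prems by simp
  have "R (foldr (\<lambda>i v. psi (kappa i) (E v)) is (shifted_vacuum N)) (cwedge N M eps ?fs)"
    using Cons by simp
  from psi[OF k exp[OF this]]
  have "R (foldr (\<lambda>i v. psi (kappa i) (E v)) (i # is) (shifted_vacuum N))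
      (psi (kappa i) (exp_op (wop N M eps c) (cwedge N M eps ?fs)))"
    by simp
  also have "exp_op (wop N M eps c) (cwedge N M eps ?fs) =
      cwedge N M eps (map (\<lambda>(a, F). (a, exp_fps c * F)) ?fs)"
    using Cons.prems by (intro conjunct2[OF exp_cwedge]) auto
  \<comment> \<open>The new fermion starts with the series 1 while the older ones have just gained a
    factor, so the power at each position is the number of exponentials to its left.\<close>
  also have "psi (kappa i) \<dots> = cwedge N M eps ((kappa i, 1) # map (\<lambda>(a, F). (a, exp_fps c * F)) ?fs)"
    by (simp add: psif_czf_1[OF eps k])
  also have "(kappa i, 1) # map (\<lambda>(a, F). (a, exp_fps c * F)) ?fs =
      map (\<lambda>j. (kappa ((i # is) ! j), exp_fps c ^ j)) [0..<length (i # is)]"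
    by (simp only: length_Cons upt_conv_Cons[of 0 "Suc _"] map_Suc_upt[symmetric]) (simp add: o_def)
  finally show ?case .
qed

end

text \<open>The Taylor series of \<open>log (1 + beta t)\<close>, see \<open>exp_theta_fps\<close>;
  \<open>H_fps\<close> is likewise the logarithm of \<open>h_fps\<close>.\<close>

definition theta_fps :: "kfield mpser fps" where
  "theta_fps = Abs_fps (\<lambda>n. if n = 0 then 0 else cst ((- 1) ^ (n - 1) * beta ^ n / of_nat n))"

definition H_fps :: "kfield mpser fps" where
  "H_fps = Abs_fps (\<lambda>n. if n = 0 then 0 else cst (1 / of_nat n) * p_sym n)"

lemma Theta_op_eq: "Theta_op = bop (- 1) theta_fps"
proof (intro ext)
  fix v S
  have "Theta_op v S = Sum_any (\<lambda>n. if 1 \<le> n then fps_nth theta_fps n * boson (- 1 * int n) v S else 0)"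
    unfolding Theta_op_def by (rule arg_cong[where f = Sum_any]) (auto simp: theta_fps_def)
  then show "Theta_op v S = bop (- 1) theta_fps v S"
    by (simp only: bop_def)
qed

lemma H_op_eq: "H_op = bop 1 H_fps"
proof (intro ext)
  fix v S
  have "H_op v S = Sum_any (\<lambda>n. if 1 \<le> n then fps_nth H_fps n * boson (1 * int n) v S else 0)"
    unfolding H_op_def by (rule arg_cong[where f = Sum_any]) (auto simp: H_fps_def)
  then show "H_op v S = bop 1 H_fps v S"
    by (simp only: bop_def)
qed

lemma Sum_any_uminus: "- Sum_any f = Sum_any (\<lambda>n. - f n :: 'a :: ab_group_add)"
  by (simp add: Sum_any.expand_set sum_negf)

lemma theta_op_eq: "(\<lambda>w S. - theta_op w S) = bop 1 (- theta_fps)"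
proof (intro ext)
  fix v S
  have "- theta_op v S = Sum_any (\<lambda>n. if 1 \<le> n then fps_nth (- theta_fps) n * boson (1 * int n) v S else 0)"
    unfolding theta_op_def Sum_any_uminus
    by (rule arg_cong[where f = Sum_any]) (auto simp: theta_fps_def)
  then show "- theta_op v S = bop 1 (- theta_fps) v S"
    by (simp only: bop_def)
qed

lemma of_nat_Suc_cst: "of_nat (Suc m) * cst (a / of_nat (Suc m) :: kfield) = cst a"
  using kfield_of_nat_neq_0[of "Suc m"]
  by (simp del: of_nat_Suc flip: cst.hom_of_nat cst.hom_mult)

lemma theta_fps_0: "fps_nth theta_fps 0 = 0"
  by (simp add: theta_fps_def)

lemma H_fps_0: "fps_nth H_fps 0 = 0"
  by (simp add: H_fps_def)

lemma deriv_theta_fps: "fps_deriv theta_fps = fps_const (cst beta) * geo_fps (cst beta)"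
proof (rule fps_ext)
  fix m
  have "fps_nth (fps_deriv theta_fps) m = of_nat (Suc m) * cst ((- 1) ^ m * beta ^ Suc m / of_nat (Suc m))"
    by (simp add: theta_fps_def del: of_nat_Suc)
  also have "\<dots> = cst ((- 1) ^ m * beta ^ Suc m)"
    by (rule of_nat_Suc_cst)
  also have "\<dots> = fps_nth (fps_const (cst beta) * geo_fps (cst beta)) m"
    by (simp add: geo_fps_def cst.hom_mult cst.hom_power cst.hom_uminus power_minus[of "cst beta"])
  finally show "fps_nth (fps_deriv theta_fps) m = fps_nth (fps_const (cst beta) * geo_fps (cst beta)) m" .
qed

lemma exp_theta_fps: "exp_fps theta_fps = lin_fps (cst beta)"
proof (rule exp_fps_unique[OF theta_fps_0])
  show "fps_nth (lin_fps (cst beta)) 0 = 1"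
    by (simp add: lin_fps_def)
  have "fps_deriv (lin_fps (cst beta)) = fps_const (cst beta)"
    by (simp add: lin_fps_def)
  also have "\<dots> = fps_const (cst beta) * (lin_fps (cst beta) * geo_fps (cst beta))"
    by (simp add: lin_geo_fps)
  finally show "fps_deriv (lin_fps (cst beta)) = fps_deriv theta_fps * lin_fps (cst beta)"
    by (simp only: deriv_theta_fps ac_simps)
qed

text \<open>The derivative of the inverse series comes from differentiating
  \<open>lin_fps b * geo_fps b = 1\<close>.\<close>

lemma exp_neg_theta_fps: "exp_fps (- theta_fps) = geo_fps (cst beta)"
proof (rule exp_fps_unique)
  let ?G = "geo_fps (cst beta)" and ?L = "lin_fps (cst beta)" and ?b = "fps_const (cst beta)"
  have "fps_deriv (?L * ?G) = 0"
    by (simp add: lin_geo_fps)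
  then have "?L * fps_deriv ?G + ?b * ?G = 0"
    by (simp add: lin_fps_def)
  then have "?L * fps_deriv ?G = - (?b * ?G)"
    by (simp only: eq_neg_iff_add_eq_0)
  then have "?G * ?L * fps_deriv ?G = ?G * - (?b * ?G)"
    by (simp only: mult.assoc)
  moreover have "?G * ?L = 1"
    using lin_geo_fps[of "cst beta"] by (simp only: mult.commute)
  ultimately have "fps_deriv ?G = - (?b * ?G) * ?G"
    by (simp add: mult.commute)
  then show "fps_deriv ?G = fps_deriv (- theta_fps) * ?G"
    by (simp add: deriv_theta_fps)
qed (simp_all add: theta_fps_0 geo_fps_def)

lemma exp_H_fps: "exp_fps H_fps = h_fps"
proof (rule exp_fps_unique[OF H_fps_0])
  show "fps_nth h_fps 0 = 1"
    by (simp add: h_fps_def h_sym_0)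
  have d: "fps_nth (fps_deriv H_fps) i = p_sym (Suc i)" for i
    using of_nat_Suc_cst[of i 1] by (simp add: H_fps_def mult.assoc[symmetric] del: of_nat_Suc)
  show "fps_deriv h_fps = fps_deriv H_fps * h_fps"
  proof (rule fps_ext)
    fix m
    have "fps_nth (fps_deriv h_fps) m = of_nat (Suc m) * h_sym (int (Suc m))"
      by (simp add: h_fps_def del: of_nat_Suc)
    also have "\<dots> = (\<Sum>i\<le>m. p_sym (Suc i) * h_sym (int (m - i)))"
      by (rule newton_identity)
    also have "\<dots> = fps_nth (fps_deriv H_fps * h_fps) m"
      unfolding fps_mult_nth by (simp only: d h_fps_def fps_nth_Abs_fps atLeast0AtMost)
    finally show "fps_nth (fps_deriv h_fps) m = fps_nth (fps_deriv H_fps * h_fps) m" .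
  qed
qed

subsection \<open>Partitions as states of charge zero\<close>

lemma maya_setI:
  assumes "finite A"
  shows "{..<- int N} \<union> A \<in> {S. finite {n \<in> S. 0 \<le> n} \<and> finite {n. n \<notin> S \<and> n < 0}}"
proof -
  have sub: "{n \<in> {..<- int N} \<union> A. 0 \<le> n} \<subseteq> A" "{n. n \<notin> {..<- int N} \<union> A \<and> n < 0} \<subseteq> {- int N..<0}"
    by auto
  show ?thesis
    using finite_subset[OF sub(1) assms] finite_subset[OF sub(2) finite_atLeastLessThan_int]
    unfolding mem_Collect_eq by (rule conjI)
qed

definition part_state :: "part \<Rightarrow> maya" where
  "part_state nu = Abs_maya ({..<- int (plen nu)} \<union> bnum nu ` {..<plen nu})"

lemma occ_part_state:
  assumes "plen nu \<le> N"
  shows "occ (part_state nu) = {..<- int N} \<union> bnum nu ` {..<N}"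
  using assms
proof (induction N rule: dec_induct)
  case base
  show ?case
    unfolding part_state_def by (rule Abs_maya_inverse) (rule maya_setI, simp)
next
  case (step N)
  have "{..<- int N} \<union> bnum nu ` {..<N} = {..<- int (Suc N)} \<union> bnum nu ` {..<Suc N}"
    using step by (auto simp: bnum_beyond lessThan_Suc)
  then show ?case
    using step by simp
qed

lemma part_state_inj: "part_state nu = part_state mu \<Longrightarrow> nu = mu"
proof -
  assume eq: "part_state nu = part_state mu"
  define N where "N = max (plen nu) (plen mu)"
  have img: "bnum lam ` {..<N} = {k \<in> occ (part_state lam). - int N \<le> k}" if "plen lam \<le> N" for lam
    unfolding occ_part_state[OF that] using bnum_ge by auto
  have "bnum nu ` {..<N} = bnum mu ` {..<N}"
    using img[of nu] img[of mu] eq by (simp add: N_def)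
  then show ?thesis
    by (rule bnum_image_eqD) (simp_all add: N_def)
qed

lemma part_state_states: "nu \<in> Par N M \<Longrightarrow> part_state nu \<in> states N M"
proof -
  assume nu: "nu \<in> Par N M"
  then have "bnum nu i < int M" for i
    by (intro bnum_less) (simp add: Par_def)
  then show ?thesis
    using nu by (auto simp: states_def occ_part_state[of nu N] Par_def)
qed

lemma cwedge_part_state:
  assumes nu: "nu \<in> Par N M"
  shows "cwedge N M eps (map (\<lambda>j. (bnum lam j, F j)) [0..<N]) (part_state nu) = wdet eps F N lam nu"
proof -
  let ?fs = "map (\<lambda>(a, F). czf eps a F) (map (\<lambda>j. (bnum lam j, F j)) [0..<N])"
  have len: "length ?fs = N"
    by simp
  have lt: "bnum nu i < int M" for i
    using nu by (intro bnum_less) (simp add: Par_def)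
  have "wedge N M ?fs (part_state nu) = Det (length ?fs) (\<lambda>i j. (?fs ! i) (bnum nu j))"
    unfolding len
    by (rule wedge_coeff[where fs = ?fs, unfolded len])
      (use nu lt in \<open>auto simp: bnum_strict bnum_ge Par_def occ_part_state[of nu N]\<close>)
  also have "\<dots> = wdet eps F N lam nu"
    unfolding wdet_def len by (rule det_mat_cong) (simp add: czf_def)
  finally show ?thesis .
qed

text \<open>Adding \<open>N\<close> fermions to the vacuum of charge \<open>- N\<close> gives charge
  0, and such states are indexed by partitions.\<close>

lemma cwedge_nonzeroD:
  assumes "cwedge N M eps fs S \<noteq> 0" "length fs = N"
  shows "\<exists>nu\<in>Par N M. S = part_state nu"
proof -
  from wedge_support[OF assms(1)] assms(2) obtain A where
    A: "A \<subseteq> win N M" "card A = N" "occ S = {..<- int N} \<union> A"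
    by auto
  from part_of_beta_set[OF A(1,2)] obtain nu where nu: "nu \<in> Par N M" "bnum nu ` {..<N} = A"
    by auto
  then have "S = part_state nu"
    using A(3) by (intro occ_eqI) (simp add: Par_def occ_part_state[of nu N])
  then show ?thesis
    using nu by blast
qed

lemma bnum_win: "pt lam 1 \<le> M \<Longrightarrow> j < N \<Longrightarrow> bnum lam j \<in> win N M"
  using bnum_ge[of j N lam] bnum_less[of lam M j] by simp

lemma map_upt_bnum:
  "map (\<lambda>j. (int (pt lam ([1..<Suc N] ! j)) - int ([1..<Suc N] ! j), F j)) [0..<length [1..<Suc N]] =
    map (\<lambda>j. (bnum lam j, F j)) [0..<N]"
  by (rule nth_equalityI) (auto simp: bnum_def simp del: upt_Suc)

lemma ket_g_eq:
  assumes M: "pt lam 1 \<le> M"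
  shows "ket_g N lam = cwedge N M 1 (map (\<lambda>j. (bnum lam j, geo_fps (cst beta) ^ j)) [0..<N])"
proof -
  interpret window N M 1 "- theta_fps"
    by unfold_locales (simp_all add: theta_fps_0)
  have "ket_g N lam = cwedge N M 1 (map (\<lambda>j. (int (pt lam ([1..<Suc N] ! j)) - int ([1..<Suc N] ! j),
      exp_fps (- theta_fps) ^ j)) [0..<length [1..<Suc N]])"
    unfolding ket_g_def theta_op_eq
  proof (rule foldr_exp_cwedge[where R = "(=)"])
    fix v fs assume "v = cwedge N M 1 fs"
    then show "exp_op (bop 1 (- theta_fps)) v = exp_op (wop N M 1 (- theta_fps)) (cwedge N M 1 fs)"
      using exp_bop_supported[OF cwedge_supported] by simp
  next
    fix i assume "i \<in> set [1..<Suc N]"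
    then obtain j where "i = Suc j" "j < N"
      by (cases i rule: nat.exhaust) (auto simp del: upt_Suc)
    then show "int (pt lam i) - int i \<in> win N M"
      using bnum_win[OF M, of j N] by (simp add: bnum_def)
  qed simp_all
  then show ?thesis
    unfolding map_upt_bnum exp_neg_theta_fps .
qed

lemma exp_H_ket_g:
  assumes M: "pt lam 1 \<le> M"
  shows "exp_op H_op (ket_g N lam) =
    cwedge N M 1 (map (\<lambda>j. (bnum lam j, h_fps * geo_fps (cst beta) ^ j)) [0..<N])"
proof -
  interpret window N M 1 H_fps
    by unfold_locales (simp_all add: H_fps_0)
  let ?fs = "map (\<lambda>j. (bnum lam j, geo_fps (cst beta) ^ j)) [0..<N]"
  have "exp_op H_op (ket_g N lam) = exp_op (wop N M 1 H_fps) (cwedge N M 1 ?fs)"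
    unfolding ket_g_eq[OF M] H_op_eq by (rule exp_bop_supported[OF cwedge_supported])
  also have "\<dots> = cwedge N M 1 (map (\<lambda>(a, F). (a, exp_fps H_fps * F)) ?fs)"
    using bnum_win[OF M] by (intro conjunct2[OF exp_cwedge]) auto
  finally show ?thesis
    by (simp add: exp_H_fps o_def)
qed

text \<open>In contrast to \<open>ket_g_eq\<close> the comparison is confined to
  \<open>states N M\<close>, since \<open>e^Theta\<close> also lifts modes from below
  \<open>- int N\<close>.\<close>

lemma ket_G_states:
  assumes M: "pt mu 1 \<le> M" and S: "S \<in> states N M"
  shows "ket_G N mu S = cwedge N M (- 1) (map (\<lambda>j. (bnum mu j, lin_fps (cst beta) ^ j)) [0..<N]) S"
proof -
  interpret window N M "- 1" theta_fps
    by unfold_locales (simp_all add: theta_fps_0)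
  have "\<forall>S\<in>states N M. ket_G N mu S =
      cwedge N M (- 1) (map (\<lambda>j. (int (pt mu ([1..<Suc N] ! j)) - int ([1..<Suc N] ! j),
      exp_fps theta_fps ^ j)) [0..<length [1..<Suc N]]) S"
    unfolding ket_G_def Theta_op_eq
  proof (rule foldr_exp_cwedge[where R = "\<lambda>v w. \<forall>S\<in>states N M. v S = w S"])
    fix k and v w :: "kfield mpser ket"
    assume "k \<in> win N M" "\<forall>S\<in>states N M. v S = w S"
    then show "\<forall>S\<in>states N M. psi k v S = psi k w S"
      by (auto intro: psi_cong)
  next
    fix v :: "kfield mpser ket" and fs assume "\<forall>S\<in>states N M. v S = cwedge N M (- 1) fs S"
    then show "\<forall>S\<in>states N M. exp_op (bop (- 1) theta_fps) v S =
        exp_op (wop N M (- 1) theta_fps) (cwedge N M (- 1) fs) S"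
      by (auto intro: exp_bop_cong)
  next
    fix i assume "i \<in> set [1..<Suc N]"
    then obtain j where "i = Suc j" "j < N"
      by (cases i rule: nat.exhaust) (auto simp del: upt_Suc)
    then show "int (pt mu i) - int i \<in> win N M"
      using bnum_win[OF M, of j N] by (simp add: bnum_def)
  qed simp_all
  then have "ket_G N mu S = cwedge N M (- 1) (map (\<lambda>j. (int (pt mu ([1..<Suc N] ! j)) - int ([1..<Suc N] ! j),
      exp_fps theta_fps ^ j)) [0..<length [1..<Suc N]]) S"
    using S by blast
  then show ?thesis
    unfolding map_upt_bnum exp_theta_fps .
qed

section \<open>Independence of \<open>ket_G\<close> from the number of fermions, and its
  coefficients\<close>

lemma (in window) shifted_vacuum_cwedge:
  assumes "r \<le> N"
  shows "\<exists>fs. shifted_vacuum r = cwedge N M eps fs \<and> (\<forall>(a, F)\<in>set fs. a \<in> win N M)"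
  using assms
proof (induction r rule: inc_induct)
  case base
  show ?case
    by (intro exI[of _ "[]"]) simp
next
  case (step r)
  then obtain fs where fs: "shifted_vacuum (Suc r) = cwedge N M eps fs" "\<forall>(a, F)\<in>set fs. a \<in> win N M"
    by auto
  have a: "- int (Suc r) \<in> win N M"
    using step by auto
  have "shifted_vacuum r = psif N M (czf eps (- int (Suc r)) 1) (cwedge N M eps fs)"
    unfolding psif_czf_1[OF eps a] fs(1)[symmetric] by (rule psi_shifted_vacuum[symmetric])
  then show ?case
    using fs(2) a by (intro exI[of _ "(- int (Suc r), 1) # fs"]) auto
qed

lemma psif_czf_lin:
  assumes "a \<in> win N M" "a + 1 \<in> win N M"
  shows "psif N M (czf (- 1) a (lin_fps b)) v = (\<lambda>S. psi a v S + b * psi (a + 1) v S)"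
proof
  fix S
  have "fps_nth (lin_fps b) l = (if l = 0 then 1 else if l = 1 then b else 0)" for l
    by (cases l) (simp_all add: lin_fps_def)
  then have cz: "czf (- 1) a (lin_fps b) k = (if k = a then 1 else if k = a + 1 then b else 0)" for k
    by (auto simp: czf_def cz_def nat_eq_iff)
  have "psif N M (czf (- 1) a (lin_fps b)) v S = (\<Sum>k\<in>{a, a + 1}. czf (- 1) a (lin_fps b) k * psi k v S)"
    unfolding psif_def using assms by (intro sum.mono_neutral_right) (auto simp: cz)
  then show "psif N M (czf (- 1) a (lin_fps b)) v S = psi a v S + b * psi (a + 1) v S"
    by (simp add: cz)
qed

text \<open>Start at the bottom \<open>N\<close> of the window, where the exponential acts
  trivially, and move up. Refilling one mode and using the induction hypothesis gives
  \<open>e |-n> = |-n> + beta psi_(-n) e |-(n+1)>\<close>; applying \<open>psi_(-n)\<close> once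
  more kills the correction.\<close>

lemma psi_exp_Theta_window:
  assumes "r < N" "0 < M"
  shows "psi (- int (Suc r)) (exp_op (wop N M (- 1) theta_fps) (shifted_vacuum (Suc r))) = shifted_vacuum r"
proof -
  interpret window N M "- 1" theta_fps
    by unfold_locales (simp_all add: theta_fps_0)
  let ?e = "exp_op (wop N M (- 1) theta_fps)"
  have "psi (- int k) (?e (shifted_vacuum k)) = shifted_vacuum (k - 1)" if "Suc r \<le> k" "k \<le> N" for k
    using that(2,1)
  proof (induction k rule: inc_induct)
    case base
    have "?e (shifted_vacuum N) = shifted_vacuum N"
      using exp_cwedge[of "[]"] by simp
    then show ?case
      using assms psi_shifted_vacuum[of "N - 1"] by simp
  next
    case (step n)
    let ?a = "- int (Suc n)"
    have a: "?a \<in> win N M" "?a + 1 \<in> win N M"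
      using step assms by auto
    obtain fs where fs: "shifted_vacuum (Suc n) = cwedge N M (- 1) fs" "\<forall>(a, F)\<in>set fs. a \<in> win N M"
      using shifted_vacuum_cwedge[of "Suc n"] step by auto
    have nil: "nilp (shifted_vacuum (Suc n))"
      unfolding fs(1) using fs(2) by (intro conjunct1[OF exp_cwedge]) auto
    have "(shifted_vacuum n :: kfield mpser ket) = psif N M (czf (- 1) ?a 1) (shifted_vacuum (Suc n))"
      unfolding psif_czf_1[OF eps a(1)] by (rule psi_shifted_vacuum[symmetric])
    then have "?e (shifted_vacuum n) = psif N M (czf (- 1) ?a (lin_fps (cst beta))) (?e (shifted_vacuum (Suc n)))"
      using exp_psif(2)[OF nil a(1), of 1] by (simp only: exp_theta_fps mult_1_right)
    also have "\<dots> = (\<lambda>S. shifted_vacuum n S + cst beta * psi (?a + 1) (?e (shifted_vacuum (Suc n))) S)"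
      unfolding psif_czf_lin[OF a] using step by simp
    finally have "psi (?a + 1) (?e (shifted_vacuum n)) = psi (?a + 1) (shifted_vacuum n)"
      by (simp only: psi_add psi_scale psi_twice) simp
    then show ?case
      using psi_shifted_vacuum[of "n - 1"] step by simp
  qed
  from this[of "Suc r"] show ?thesis
    using assms by simp
qed

lemma psi_exp_Theta: "psi (- int (Suc r)) (exp_op Theta_op (shifted_vacuum (Suc r))) = shifted_vacuum r"
proof
  fix S
  obtain N M where N: "Suc r \<le> N" "1 \<le> M" "S \<in> states N M"
    using ex_states by blast
  have "psi (- int (Suc r)) (exp_op Theta_op (shifted_vacuum (Suc r))) S =
      psi (- int (Suc r)) (exp_op (wop N M (- 1) theta_fps) (shifted_vacuum (Suc r))) S"
    unfolding Theta_op_eq using N by (intro psi_cong[of N M] exp_bop_cong) auto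
  also have "\<dots> = shifted_vacuum r S"
    using N by (subst psi_exp_Theta_window) auto
  finally show "psi (- int (Suc r)) (exp_op Theta_op (shifted_vacuum (Suc r))) S = shifted_vacuum r S" .
qed

text \<open>A zero part adds an innermost factor \<open>psi (- int (Suc n))\<close> with its
  exponential, which turns the deeper vacuum back into the previous one.\<close>

lemma ket_G_stable:
  assumes "plen mu \<le> r" "r \<le> N"
  shows "ket_G N mu = ket_G r mu"
  using assms(2)
proof (induction N rule: dec_induct)
  case (step n)
  have "pt mu (Suc n) = 0"
    using step assms by (intro pt_zero) simp
  then have "ket_G (Suc n) mu = foldr (\<lambda>i v. psi (int (pt mu i) - int i) (exp_op Theta_op v)) [1..<Suc n]
      (psi (- int (Suc n)) (exp_op Theta_op (shifted_vacuum (Suc n))))"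
    unfolding ket_G_def by simp
  also have "\<dots> = ket_G n mu"
    by (simp only: psi_exp_Theta ket_G_def)
  finally show ?case
    using step by simp
qed simp

lemma ket_G_part_state:
  assumes "plen mu \<le> r"
  shows "ket_G r mu (part_state nu) = cst (gco beta mu nu)"
proof -
  \<comment> \<open>\<open>N\<close> may exceed \<open>r\<close>: the coefficient at
    \<open>nu\<close> becomes a determinant in a window only with at least \<open>plen nu\<close>
    fermions.\<close>
  define N where "N = max r (plen nu)"
  define M where "M = max (pt mu 1) (pt nu 1)"
  have nu: "nu \<in> Par N M" and M: "pt mu 1 \<le> M" and N: "r \<le> N" "plen mu \<le> N" "plen nu \<le> N"
    using assms by (auto simp: Par_def N_def M_def)
  have "ket_G r mu (part_state nu) = ket_G N mu (part_state nu)"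
    by (simp add: ket_G_stable[OF assms N(1)])
  also have "\<dots> = wdet (- 1) (\<lambda>j. lin_fps (cst beta) ^ j) N mu nu"
    unfolding ket_G_states[OF M part_state_states[OF nu]] by (rule cwedge_part_state[OF nu])
  also have "\<dots> = gco (cst beta) mu nu"
    unfolding gco_def using N by (intro wdet_eq_skewdet) auto
  finally show ?thesis
    by (simp add: cst_gco)
qed

text \<open>The coefficients of \<open>e\<^bsup>H(x)\<^esup>|\<lambda>\<rangle>\<^sup>g\<close>.\<close>

definition uco :: "part \<Rightarrow> part \<Rightarrow> kfield mpser" where
  "uco lam nu = skewdet 1 (\<lambda>j. h_fps * geo_fps (cst beta) ^ j) lam nu"

lemma h_geo_nth_0: "fps_nth (h_fps * geo_fps (cst beta) ^ j) 0 = 1"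
  by (simp add: h_fps_def h_sym_0)

text \<open>The ket has finite support, so the pairing is a finite sum even though
  \<open>ket_G\<close> may have infinitely many nonzero coefficients.\<close>

lemma bra_G_eq:
  assumes "plen mu \<le> r" "plen lam \<le> s"
  shows "bra_G r mu (exp_op H_op (ket_g s lam)) =
    (\<Sum>nu\<in>Par (plen lam) (pt lam 1). cst (gco beta mu nu) * uco lam nu)"
proof -
  let ?M = "pt lam 1"
  let ?v = "exp_op H_op (ket_g s lam)"
  have v: "?v = cwedge s ?M 1 (map (\<lambda>j. (bnum lam j, h_fps * geo_fps (cst beta) ^ j)) [0..<s])"
    by (rule exp_H_ket_g) simp
  have val: "?v (part_state nu) = uco lam nu" if nu: "nu \<in> Par s ?M" for nu
  proof -
    have "?v (part_state nu) = wdet 1 (\<lambda>j. h_fps * geo_fps (cst beta) ^ j) s lam nu"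
      unfolding v by (rule cwedge_part_state[OF nu])
    also have "\<dots> = uco lam nu"
      unfolding uco_def using nu assms by (intro wdet_eq_skewdet h_geo_nth_0) (auto simp: Par_def)
    finally show ?thesis .
  qed
  have "bra_G r mu ?v = (\<Sum>S\<in>part_state ` Par s ?M. ket_G r mu S * ?v S)"
    unfolding bra_G_def omega_def
  proof (rule Sum_any.expand_superset)
    show "{S. ket_G r mu S * ?v S \<noteq> 0} \<subseteq> part_state ` Par s ?M"
    proof
      fix S assume "S \<in> {S. ket_G r mu S * ?v S \<noteq> 0}"
      then have "?v S \<noteq> 0"
        by auto
      then show "S \<in> part_state ` Par s ?M"
        unfolding v using cwedge_nonzeroD by fastforce
    qed
  qed (simp add: finite_Par)
  also have "\<dots> = (\<Sum>nu\<in>Par s ?M. ket_G r mu (part_state nu) * ?v (part_state nu))"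
    by (subst sum.reindex) (auto intro: inj_onI part_state_inj)
  also have "\<dots> = (\<Sum>nu\<in>Par s ?M. cst (gco beta mu nu) * uco lam nu)"
    by (simp add: ket_G_part_state[OF assms(1)] val)
  also have "\<dots> = (\<Sum>nu\<in>Par (plen lam) ?M. cst (gco beta mu nu) * uco lam nu)"
  proof (rule sum.mono_neutral_right[OF finite_Par])
    show "\<forall>nu\<in>Par s ?M - Par (plen lam) ?M. cst (gco beta mu nu) * uco lam nu = 0"
      using skewdet_nonzeroD unfolding uco_def by (metis DiffD2 mult_zero_right)
  qed (use assms in \<open>auto simp: Par_def\<close>)
  finally show ?thesis .
qed

section \<open>The coproduct\<close>

text \<open>A Jacobi-Trudi matrix belongs to the skew shape over the empty partition, whose beta
  numbers are \<open>- 1 - int i\<close>. Cauchy-Binet then multiplies the two series.\<close>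

lemma sum_jacobi_trudi_wdet:
  fixes Hx :: "'a :: comm_ring_1 fps"
  assumes "pt lam 1 \<le> M"
  shows "(\<Sum>nu\<in>Par N M. Det N (\<lambda>i j. cz Hx (bnum nu i + 1 + int j)) * wdet 1 F N lam nu) =
    Det N (\<lambda>i j. cz (Hx * F j) (bnum lam j + 1 + int i))"
proof -
  have "(\<Sum>nu\<in>Par N M. Det N (\<lambda>i j. cz Hx (bnum nu i + 1 + int j)) * wdet 1 F N lam nu) =
      (\<Sum>nu\<in>Par N M. Det N (\<lambda>i j. cz Hx (bnum nu j - (- 1 - int i))) *
        Det N (\<lambda>i j. cz (F i) (bnum lam i - bnum nu j)))"
  proof (rule sum.cong[OF refl])
    fix nu
    have "Det N (\<lambda>i j. cz Hx (bnum nu i + 1 + int j)) =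
        Det N (\<lambda>i j. cz Hx (bnum nu j + 1 + int i))"
      by (rule det_mat_transpose)
    then show "Det N (\<lambda>i j. cz Hx (bnum nu i + 1 + int j)) * wdet 1 F N lam nu =
        Det N (\<lambda>i j. cz Hx (bnum nu j - (- 1 - int i))) *
        Det N (\<lambda>i j. cz (F i) (bnum lam i - bnum nu j))"
      by (simp add: wdet_def algebra_simps)
  qed
  also have "\<dots> = Det N (\<lambda>i j. \<Sum>k\<in>win N M. cz Hx (k - (- 1 - int i)) * cz (F j) (bnum lam j - k))"
    by (rule cauchy_binet)
  also have "\<dots> = Det N (\<lambda>i j. cz (Hx * F j) (bnum lam j - (- 1 - int i)))"
    by (intro det_mat_cong cz_mult bnum_less assms) auto
  finally show ?thesis
    by (simp add: algebra_simps)
qed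

lemma fps_hom_mult:
  assumes "comm_ring_hom h" "\<And>m. fps_nth F' m = h (fps_nth F m)" "\<And>m. fps_nth G' m = h (fps_nth G m)"
  shows "fps_nth (F' * G') m = h (fps_nth (F * G) m)"
proof -
  interpret comm_ring_hom h
    by (rule assms)
  show ?thesis
    by (simp add: fps_mult_nth assms hom_sum hom_mult)
qed

lemma fps_hom_power:
  assumes "comm_ring_hom h" "\<And>m. fps_nth F' m = h (fps_nth F m)"
  shows "fps_nth (F' ^ j) m = h (fps_nth (F ^ j) m)"
proof -
  interpret comm_ring_hom h
    by (rule assms)
  show ?thesis
  proof (induction j arbitrary: m)
    case (Suc j)
    then show ?case
      using fps_hom_mult[OF assms(1), of F' F "F' ^ j" "F ^ j" m] assms(2) by simp
  qed simp
qed

lemma geo_fps_cst: "fps_nth (geo_fps (cst b) ^ j) m = cst (fps_nth (geo_fps b ^ j) m)"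
  by (rule fps_hom_power[OF cst_hom]) (simp add: geo_fps_def cst.hom_power cst.hom_uminus flip: cst.hom_uminus)

lemma cst_dco: "cst (dco b lam nu) = dco (cst b) lam nu"
  unfolding dco_def by (rule skewdet_hom[OF cst_hom, symmetric]) (rule geo_fps_cst)

text \<open>A Jacobi-Trudi formula for the dual Grothendieck polynomial. The variables enter only
  through \<open>h_fps\<close>, so the alphabet can be split inside the entries.\<close>

definition gdet :: "part \<Rightarrow> kfield mpser" where
  "gdet lam = det (mat (plen lam) (plen lam)
    (\<lambda>(i, j). cz (h_fps * geo_fps (cst beta) ^ j) (bnum lam j + 1 + int i)))"

lemma dual_grothendieck_det: "dual_grothendieck lam = gdet lam"
proof -
  let ?N = "plen lam" and ?M = "pt lam 1"
  have "dual_grothendieck lam = (\<Sum>nu\<in>Par ?N ?M.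
      Det ?N (\<lambda>i j. cz h_fps (bnum nu i + 1 + int j)) *
      wdet 1 (\<lambda>j. geo_fps (cst beta) ^ j) ?N lam nu)"
    unfolding dual_grothendieck_eq
  proof (rule sum.cong[OF refl])
    fix nu assume "nu \<in> Par ?N ?M"
    then have nu: "plen nu \<le> ?N"
      by (simp add: Par_def)
    have "cst (dco beta lam nu) = wdet 1 (\<lambda>j. geo_fps (cst beta) ^ j) ?N lam nu"
      unfolding cst_dco unfolding dco_def using nu by (intro wdet_eq_skewdet[symmetric]) auto
    then show "cst (dco beta lam nu) * schur nu =
        Det ?N (\<lambda>i j. cz h_fps (bnum nu i + 1 + int j)) *
        wdet 1 (\<lambda>j. geo_fps (cst beta) ^ j) ?N lam nu"
      by (simp add: schur_eq[OF nu] cz_h_fps mult.commute)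
  qed
  also have "\<dots> = gdet lam"
    unfolding gdet_def by (rule sum_jacobi_trudi_wdet) simp
  finally show ?thesis .
qed

definition hx_fps :: "kfield mpser fps" where
  "hx_fps = Abs_fps (\<lambda>m. emb_x (h_sym (int m)))"

definition hy_fps :: "kfield mpser fps" where
  "hy_fps = Abs_fps (\<lambda>m. emb_y (h_sym (int m)))"

text \<open>A monomial of degree \<open>d\<close> is counted exactly once in the convolution, at
  \<open>i\<close> equal to the degree of its even part.\<close>

lemma hx_hy_fps: "hx_fps * hy_fps = h_fps"
proof (rule fps_ext, rule mpser_eqI)
  fix d m
  have "cf (fps_nth (hx_fps * hy_fps) d) m =
      (\<Sum>i=0..d. if mdeg (evm m) = i then (if mdeg (odm m) = d - i then 1 else 0) else 0)"
    unfolding fps_mult_nth cf_sum by (intro sum.cong refl) (auto simp: hx_fps_def hy_fps_def cf_emb_mult)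
  also have "\<dots> = (if mdeg m = d then 1 else 0)"
    by (auto simp: mdeg_interleave[of m])
  finally show "cf (fps_nth (hx_fps * hy_fps) d) m = cf (fps_nth h_fps d) m"
    by (simp add: h_fps_def)
qed

text \<open>Cauchy-Binet read backwards after \<open>h_fps = hx_fps * hy_fps\<close>: the first
  factor gives Schur functions in one alphabet, and the second, with the inverse powers, gives
  \<open>uco\<close> in the other.\<close>

lemma gdet_coproduct:
  "gdet lam = (\<Sum>nu\<in>Par (plen lam) (pt lam 1). emb_x (schur nu) * emb_y (uco lam nu))"
proof -
  let ?N = "plen lam" and ?M = "pt lam 1"
  let ?F = "\<lambda>j. hy_fps * geo_fps (cst beta) ^ j"
  have F: "fps_nth (?F j) m = emb_y (fps_nth (h_fps * geo_fps (cst beta) ^ j) m)" for j m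
    by (rule fps_hom_mult[OF emb_y_hom]) (simp_all add: hy_fps_def h_fps_def geo_fps_cst cst_emb_y)
  have "(\<Sum>nu\<in>Par ?N ?M. emb_x (schur nu) * emb_y (uco lam nu)) = (\<Sum>nu\<in>Par ?N ?M.
      Det ?N (\<lambda>i j. cz hx_fps (bnum nu i + 1 + int j)) * wdet 1 ?F ?N lam nu)"
  proof (rule sum.cong[OF refl])
    fix nu assume "nu \<in> Par ?N ?M"
    then have nu: "plen nu \<le> ?N"
      by (simp add: Par_def)
    have cz: "cz hx_fps z = emb_x (h_sym z)" for z
      by (simp add: cz_def hx_fps_def h_sym_neg)
    have "emb_x (schur nu) = Det ?N (\<lambda>i j. cz hx_fps (bnum nu i + 1 + int j))"
      unfolding schur_eq[OF nu] emb_x.hom_det[symmetric]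
      by (rule arg_cong[of _ _ det]) (auto intro!: eq_matI simp: cz)
    moreover have "emb_y (uco lam nu) = skewdet 1 ?F lam nu"
      unfolding uco_def by (rule skewdet_hom[OF emb_y_hom F, symmetric])
    moreover have "fps_nth (?F j) 0 = 1" for j
      unfolding F h_geo_nth_0 by simp
    then have "skewdet 1 ?F lam nu = wdet 1 ?F ?N lam nu"
      using nu by (intro wdet_eq_skewdet[symmetric]) auto
    ultimately show "emb_x (schur nu) * emb_y (uco lam nu) =
        Det ?N (\<lambda>i j. cz hx_fps (bnum nu i + 1 + int j)) * wdet 1 ?F ?N lam nu"
      by simp
  qed
  also have "\<dots> = Det ?N (\<lambda>i j. cz (hx_fps * ?F j) (bnum lam j + 1 + int i))"
    by (rule sum_jacobi_trudi_wdet) simp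
  also have "\<dots> = gdet lam"
    unfolding gdet_def by (simp only: mult.assoc[symmetric] hx_hy_fps)
  finally show ?thesis
    by (rule sym)
qed

lemma coproduct_dual_grothendieck:
  "coproduct (dual_grothendieck lam) a b =
    (\<Sum>nu\<in>Par (plen lam) (pt lam 1). cf (schur nu) a * cf (uco lam nu) b)"
  unfolding coproduct_def dual_grothendieck_det gdet_coproduct by (simp add: cf_emb_mult)

section \<open>Expansions in the dual Grothendieck polynomials, and the skew ones\<close>

lemma dual_grothendieck_sum:
  assumes "finite K" "Par (plen mu) (pt mu 1) \<subseteq> K"
  shows "dual_grothendieck mu = (\<Sum>kap\<in>K. cst (dco beta mu kap) * schur kap)"
  unfolding dual_grothendieck_eq using assms dco_eq_0[of _ mu beta]
  by (intro sum.mono_neutral_left) auto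

lemma dual_grothendieck_combination:
  assumes "finite K" "\<And>mu. mu \<in> S \<Longrightarrow> Par (plen mu) (pt mu 1) \<subseteq> K"
  shows "(\<Sum>mu\<in>S. cst (d mu) * dual_grothendieck mu) =
    (\<Sum>kap\<in>K. cst (\<Sum>mu\<in>S. d mu * dco beta mu kap) * schur kap)"
proof -
  have "(\<Sum>mu\<in>S. cst (d mu) * dual_grothendieck mu) =
      (\<Sum>mu\<in>S. \<Sum>kap\<in>K. cst (d mu * dco beta mu kap) * schur kap)"
    by (intro sum.cong refl)
      (simp add: dual_grothendieck_sum[OF assms] sum_distrib_left cst.hom_mult mult.assoc)
  also have "\<dots> = (\<Sum>kap\<in>K. cst (\<Sum>mu\<in>S. d mu * dco beta mu kap) * schur kap)"
    by (subst sum.swap) (simp add: cst.hom_sum sum_distrib_right)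
  finally show ?thesis .
qed

text \<open>This inverts the Schur expansion of the \<open>dual_grothendieck mu\<close>, which takes
  the second inverse relation \<open>gco_dco'\<close>.\<close>

lemma schur_dual_grothendieck:
  assumes S: "finite S" "{mu. gco beta mu nu \<noteq> 0} \<subseteq> S"
  shows "(\<Sum>mu\<in>S. cst (gco beta mu nu) * dual_grothendieck mu) = schur nu"
proof -
  define K where "K = insert nu (\<Union>mu\<in>S. Par (plen mu) (pt mu 1))"
  have K: "finite K" "nu \<in> K" "\<And>mu. mu \<in> S \<Longrightarrow> Par (plen mu) (pt mu 1) \<subseteq> K"
    using S by (auto simp: K_def finite_Par)
  have "(\<Sum>mu\<in>S. cst (gco beta mu nu) * dual_grothendieck mu) =
      (\<Sum>kap\<in>K. cst (if nu = kap then 1 else 0) * schur kap)"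
    by (simp only: dual_grothendieck_combination[OF K(1,3)] gco_dco'[OF S])
  also have "\<dots> = (\<Sum>kap\<in>K. if nu = kap then schur kap else 0)"
    by (intro sum.cong refl) simp
  also have "\<dots> = schur nu"
    using K by simp
  finally show ?thesis .
qed

text \<open>Pairing the relation with the row \<open>gco beta rho\<close>, that is with the
  Grothendieck polynomial of \<open>rho\<close>, isolates \<open>d rho\<close>.\<close>

lemma dual_grothendieck_independent:
  assumes S: "finite S" and zero: "(\<Sum>mu\<in>S. cst (d mu) * dual_grothendieck mu) = 0" and rho: "rho \<in> S"
  shows "d rho = 0"
proof -
  define K where "K = (\<Union>mu\<in>S. Par (plen mu) (pt mu 1))"
  have K: "finite K" "\<And>mu. mu \<in> S \<Longrightarrow> Par (plen mu) (pt mu 1) \<subseteq> K"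
    using S by (auto simp: K_def finite_Par)
  define e where "e kap = (\<Sum>mu\<in>S. d mu * dco beta mu kap)" for kap
  have e0: "e kap = 0" if "kap \<notin> K" for kap
    unfolding e_def
  proof (intro sum.neutral ballI)
    fix mu assume "mu \<in> S"
    then have "kap \<notin> Par (plen mu) (pt mu 1)"
      using K(2) that by blast
    then show "d mu * dco beta mu kap = 0"
      by (simp add: dco_eq_0)
  qed
  have "(\<Sum>kap\<in>K. cst (e kap) * schur kap) = 0"
    unfolding e_def by (simp only: dual_grothendieck_combination[OF K, symmetric] zero)
  then have "e = (\<lambda>kap. 0)"
    using K e0 by (intro schur_sum_unique[of e K]) (auto intro: finite_subset[OF _ K(1)])
  then have "0 = (\<Sum>kap\<in>K. gco beta rho kap * e kap)"
    by simp
  also have "\<dots> = (\<Sum>mu\<in>S. d mu * (\<Sum>kap\<in>K. gco beta rho kap * dco beta mu kap))"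
    unfolding e_def sum_distrib_left by (subst sum.swap) (simp add: ac_simps)
  also have "\<dots> = (\<Sum>mu\<in>S. d mu * (if mu = rho then 1 else 0))"
    by (intro sum.cong refl arg_cong2[where f = "(*)"] gco_dco K)
  also have "\<dots> = d rho"
    using S rho by (simp add: if_distrib cong: if_cong)
  finally show ?thesis
    by simp
qed

lemma uco_Lam: "uco lam nu \<in> Lam"
proof -
  have "cz (h_fps * geo_fps (cst beta) ^ j) z \<in> Lam" for j z
  proof (cases "0 \<le> z")
    case True
    then show ?thesis
      by (auto simp: cz_def fps_mult_nth geo_fps_cst h_fps_def intro!: Lam_sum Lam_mult)
  qed (simp add: cz_def)
  then show ?thesis
    unfolding uco_def skewdet_def wdet_def by (intro Lam_det)
qed

text \<open>Existence: expand each \<open>schur nu\<close> in the coproduct formula. Uniqueness: for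
  a fixed monomial \<open>b\<close> of the second alphabet, the difference of two solutions is a
  linear relation among the independent \<open>dual_grothendieck mu\<close>.\<close>

lemma skew_dual_grothendieck_eq:
  "skew_dual_grothendieck lam =
    (\<lambda>mu. \<Sum>nu\<in>Par (plen lam) (pt lam 1). cst (gco beta mu nu) * uco lam nu)"
  (is "_ = ?F")
  unfolding skew_dual_grothendieck_def
proof (rule the_equality)
  let ?T = "Par (plen lam) (pt lam 1)"
  define S where "S = (\<Union>nu\<in>?T. {mu. gco beta mu nu \<noteq> 0})"
  have S: "finite S" "\<And>nu. nu \<in> ?T \<Longrightarrow> {mu. gco beta mu nu \<noteq> 0} \<subseteq> S"
    by (auto simp: S_def finite_Par gco_finite)
  have F0: "?F mu = 0" if "mu \<notin> S" for mu
    using that by (intro sum.neutral) (auto simp: S_def)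
  have sub: "{mu. ?F mu \<noteq> 0} \<subseteq> S"
    using F0 by blast
  have cop: "coproduct (dual_grothendieck lam) a b = (\<Sum>mu\<in>S. tensor (dual_grothendieck mu) (?F mu) a b)" for a b
  proof -
    have "(\<Sum>mu\<in>S. tensor (dual_grothendieck mu) (?F mu) a b) =
        (\<Sum>mu\<in>S. \<Sum>nu\<in>?T. (gco beta mu nu * cf (dual_grothendieck mu) a) * cf (uco lam nu) b)"
      by (simp only: tensor_def cf_sum cf_cst_mult sum_distrib_left) (simp only: ac_simps)
    also have "\<dots> = (\<Sum>nu\<in>?T. cf (\<Sum>mu\<in>S. cst (gco beta mu nu) * dual_grothendieck mu) a * cf (uco lam nu) b)"
      by (subst sum.swap) (simp add: sum_distrib_right)
    also have "\<dots> = (\<Sum>nu\<in>?T. cf (schur nu) a * cf (uco lam nu) b)"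
      by (intro sum.cong refl) (simp only: schur_dual_grothendieck[OF S])
    finally show ?thesis
      by (simp only: coproduct_dual_grothendieck)
  qed
  show main: "(\<forall>mu. ?F mu \<in> Lam) \<and> finite {mu. ?F mu \<noteq> 0} \<and>
      (\<forall>a b. coproduct (dual_grothendieck lam) a b =
        (\<Sum>mu | ?F mu \<noteq> 0. tensor (dual_grothendieck mu) (?F mu) a b))"
  proof (intro conjI allI)
    show "?F mu \<in> Lam" for mu
      by (intro Lam_sum Lam_mult uco_Lam) simp
    show "finite {mu. ?F mu \<noteq> 0}"
      using sub S(1) by (rule finite_subset)
    show "coproduct (dual_grothendieck lam) a b =
        (\<Sum>mu | ?F mu \<noteq> 0. tensor (dual_grothendieck mu) (?F mu) a b)" for a b
      unfolding cop using sub S(1) by (intro sum.mono_neutral_right) (auto simp: tensor_def)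
  qed
  fix F' assume F': "(\<forall>mu. F' mu \<in> Lam) \<and> finite {mu. F' mu \<noteq> 0} \<and>
      (\<forall>a b. coproduct (dual_grothendieck lam) a b =
        (\<Sum>mu | F' mu \<noteq> 0. tensor (dual_grothendieck mu) (F' mu) a b))"
  define V where "V = S \<union> {mu. F' mu \<noteq> 0}"
  have V: "finite V"
    using S F' by (simp add: V_def)
  have "F' mu = ?F mu" for mu
  proof (rule mpser_eqI)
    fix b
    define d where "d mu = cf (F' mu) b - cf (?F mu) b" for mu
    have zero: "(\<Sum>mu\<in>V. cst (d mu) * dual_grothendieck mu) = 0"
    proof (rule mpser_eqI)
      fix a
      have "(\<Sum>mu\<in>V. tensor (dual_grothendieck mu) (F' mu) a b) = coproduct (dual_grothendieck lam) a b"
        using F' V by (subst sum.mono_neutral_right[of V "{mu. F' mu \<noteq> 0}"]) (auto simp: V_def tensor_def)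
      moreover have "(\<Sum>mu\<in>V. tensor (dual_grothendieck mu) (?F mu) a b) = coproduct (dual_grothendieck lam) a b"
        unfolding cop
      proof (rule sum.mono_neutral_right[OF V])
        show "\<forall>mu\<in>V - S. tensor (dual_grothendieck mu) (?F mu) a b = 0"
          using F0 by (simp only: tensor_def) simp
      qed (simp add: V_def)
      ultimately show "cf (\<Sum>mu\<in>V. cst (d mu) * dual_grothendieck mu) a = cf 0 a"
        by (simp add: d_def tensor_def left_diff_distrib right_diff_distrib sum_subtractf
            mult.commute[of _ "cf (dual_grothendieck _) a"])
    qed
    have "d mu = 0"
    proof (cases "mu \<in> V")
      case True
      then show ?thesis
        by (rule dual_grothendieck_independent[OF V zero])
    next
      case False
      then have "mu \<notin> S" "F' mu = 0"
        by (auto simp: V_def)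
      then show ?thesis
        unfolding d_def by (simp only: F0[OF \<open>mu \<notin> S\<close>] diff_self)
    qed
    then show "cf (F' mu) b = cf (?F mu) b"
      by (simp add: d_def)
  qed
  then show "F' = ?F"
    by blast
qed

theorem theorem5p1:
  fixes lam mu :: part and r s :: nat
  assumes "plen mu \<le> r" and "plen lam \<le> s"
  shows "skew_dual_grothendieck lam mu = bra_G r mu (exp_op H_op (ket_g s lam))"
  unfolding skew_dual_grothendieck_eq bra_G_eq[OF assms] ..

end
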